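(* Let $\eta\in(0,\eta_0)$ be arbitrary, where $\eta_0:=\min(a+1,1-a)$, and let $\mu=\tilde f'(a)$. Then there exist positive constants $\varepsilon_0$ and $M_0$ such that, for all $\varepsilon\in(0,\varepsilon_0)$, the solution $u^\varepsilon$ of Problem $(P^\varepsilon)$ satisfies: (i) for all $x\in\Omega$, $$-1-\eta\le u^\varepsilon(x,\mu^{-1}\varepsilon^2|\ln\varepsilon|)\le 1+\eta;$$ (ii) for all $x\in\Omega$ such that $|u_0(x)-a|\ge M_0\varepsilon$: if $u_0(x)\ge a+M_0\varepsilon$ then $u^\varepsilon(x,\mu^{-1}\varepsilon^2|\ln\varepsilon|)\ge 1-\eta$; if $u_0(x)\le a-M_0\varepsilon$ then $u^\varepsilon(x,\mu^{-1}\varepsilon^2|\ln\varepsilon|)\le -1+\eta$.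
   Context: Setting. $\Omega$ is a smooth bounded domain in $\mathbb R^N$ ($N\ge2$), and $\nu$ is the Euclidean unit normal vector exterior to $\partial\Omega$. The nonlinearity $f(u,v)$ is a smooth real function of two real variables. Put $\tilde f(u):=f(u,0)=-W'(u)$ ($W$ a double-well potential). It is assumed that $\tilde f$ has exactly three zeros $-1<a<1$, that $\tilde f'(\pm1)<0$, $\tilde f'(a)>0$, and that $\int_{-1}^{1}\tilde f(u)\,du=0$. For $\varepsilon>0$, $u^\varepsilon$ denotes the solution of Problem $(P^\varepsilon)$: $$u_t=\Delta u+\frac1{\varepsilon^2}f\Big(u,\varepsilon\int_\Omega u\,dx\Big)\ \text{in }\Omega\times(0,\infty),\qquad \frac{\partial u}{\partial\nu}=0\ \text{on }\partial\Omega\times(0,\infty),\qquad u(x,0)=u_0(x)\ \text{in }\Omega .$$ Initial data. $u_0$ is independent of $\varepsilon$ and smooth, and $C_0\ge1$ is a constant such that $\|u_0\|_{C^0(\overline\Omega)}+\|\nabla u_0\|_{C^0(\overline\Omega)}+\|D^2u_0\|_{C^0(\overline\Omega)}\le C_0$. The set $\Gamma_0:=\{x\in\Omega:\ u_0(x)=a\}$ is a smooth closed hypersurface without boundary, with $\Gamma_0\subset\subset\Omega$ and $\nabla u_0(x)\ne0$ for $x\in\Gamma_0$. Denote by $\Omega_0^-$ the region enclosed by $\Gamma_0$ and by $\Omega_0^+$ the region enclosed between $\partial\Omega$ and $\Gamma_0$; it is assumed that $u_0>a$ in $\Omega_0^+$ and $u_0<a$ in $\Omega_0^-$. *)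

theory Defs
  imports "HOL-Analysis.Analysis"
begin

section \<open>Smoothness and differential operators\<close>

text \<open>Meaningful for open \<open>S\<close> only. In finite dimension, quantifying over all directions \<open>v\<close>
  gives the usual class of \<open>k\<close> times continuously differentiable functions.\<close>

primrec Ck_on :: "nat \<Rightarrow> 'a::real_normed_vector set \<Rightarrow> ('a \<Rightarrow> 'b::real_normed_vector) \<Rightarrow> bool" where
  "Ck_on 0 S g \<longleftrightarrow> continuous_on S g"
| "Ck_on (Suc k) S g \<longleftrightarrow>
     (\<forall>x\<in>S. g differentiable (at x)) \<and>
     (\<forall>v. Ck_on k S (\<lambda>x. frechet_derivative g (at x) v))"

definition smooth_on :: "'a::real_normed_vector set \<Rightarrow> ('a \<Rightarrow> 'b::real_normed_vector) \<Rightarrow> bool" where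
  "smooth_on S g \<longleftrightarrow> open S \<and> (\<forall>k. Ck_on k S g)"

text \<open>Smoothness up to the boundary: \<open>g\<close> is smooth in a neighbourhood of \<open>closure S\<close>. For the
  bounded domains with smooth boundary used here, every function that is smooth in \<open>S\<close> with all
  derivatives extending continuously to \<open>closure S\<close> has such an extension.\<close>

definition smooth_up_to_boundary :: "'a::real_normed_vector set \<Rightarrow> ('a \<Rightarrow> 'b::real_normed_vector) \<Rightarrow> bool" where
  "smooth_up_to_boundary S g \<longleftrightarrow> (\<exists>V. closure S \<subseteq> V \<and> smooth_on V g)"

definition partial_deriv :: "'n::finite \<Rightarrow> (real^'n \<Rightarrow> real) \<Rightarrow> real^'n \<Rightarrow> real" where
  "partial_deriv i g x = frechet_derivative g (at x) (axis i 1)"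

definition gradient :: "(real^'n::finite \<Rightarrow> real) \<Rightarrow> real^'n \<Rightarrow> real^'n" where
  "gradient g x = (\<chi> i. partial_deriv i g x)"

definition hessian :: "(real^'n::finite \<Rightarrow> real) \<Rightarrow> real^'n \<Rightarrow> real^'n^'n" where
  "hessian g x = (\<chi> i j. partial_deriv i (partial_deriv j g) x)"

definition laplacian :: "(real^'n::finite \<Rightarrow> real) \<Rightarrow> real^'n \<Rightarrow> real" where
  "laplacian g x = (\<Sum>i\<in>UNIV. partial_deriv i (partial_deriv i g) x)"

definition C0_norm :: "'a set \<Rightarrow> ('a \<Rightarrow> 'b::real_normed_vector) \<Rightarrow> real" where
  "C0_norm S g = (SUP x\<in>S. norm (g x))"


section \<open>Smooth domains, normals and hypersurfaces\<close>

definition local_defining_function ::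
    "(real^'n::finite) set \<Rightarrow> real^'n \<Rightarrow> (real^'n) set \<Rightarrow> (real^'n \<Rightarrow> real) \<Rightarrow> bool" where
  "local_defining_function \<Omega> p U g \<longleftrightarrow>
     p \<in> U \<and> smooth_on U g \<and> (\<forall>x\<in>U. gradient g x \<noteq> 0) \<and>
     \<Omega> \<inter> U = {x\<in>U. g x < 0} \<and> frontier \<Omega> \<inter> U = {x\<in>U. g x = 0}"

definition smooth_bounded_domain :: "(real^'n::finite) set \<Rightarrow> bool" where
  "smooth_bounded_domain \<Omega> \<longleftrightarrow>
     open \<Omega> \<and> connected \<Omega> \<and> bounded \<Omega> \<and> \<Omega> \<noteq> {} \<and>
     (\<forall>p\<in>frontier \<Omega>. \<exists>U g. local_defining_function \<Omega> p U g)"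

text \<open>As \<open>g\<close> is negative inside \<open>\<Omega>\<close>, its gradient points outwards; the normalised gradient does not
  depend on the choice of \<open>g\<close>.\<close>

definition outer_unit_normal :: "(real^'n::finite) set \<Rightarrow> real^'n \<Rightarrow> real^'n \<Rightarrow> bool" where
  "outer_unit_normal \<Omega> p n \<longleftrightarrow>
     (\<exists>U g. local_defining_function \<Omega> p U g \<and> n = gradient g p /\<^sub>R norm (gradient g p))"

text \<open>One-sided, since \<open>g\<close> is only meaningful on \<open>closure \<Omega>\<close>: the segment \<open>p - h *\<^sub>R n\<close> runs from the
  boundary point \<open>p\<close> into \<open>\<Omega>\<close>, whence the sign.\<close>

definition has_normal_derivative :: "(real^'n::finite \<Rightarrow> real) \<Rightarrow> real \<Rightarrow> real^'n \<Rightarrow> real^'n \<Rightarrow> bool" where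
  "has_normal_derivative g D p n \<longleftrightarrow>
     ((\<lambda>h. g (p - h *\<^sub>R n)) has_real_derivative (- D)) (at_right 0)"

definition smooth_closed_hypersurface :: "(real^'n::finite) set \<Rightarrow> bool" where
  "smooth_closed_hypersurface \<Gamma> \<longleftrightarrow>
     compact \<Gamma> \<and>
     (\<forall>p\<in>\<Gamma>. \<exists>U g. p \<in> U \<and> smooth_on U g \<and> (\<forall>x\<in>U. gradient g x \<noteq> 0) \<and>
                   \<Gamma> \<inter> U = {x\<in>U. g x = 0})"


section \<open>The nonlocal Neumann problem\<close>

text \<open>Classical solutions: continuous on \<open>closure \<Omega> \<times> [0,\<infinity>)\<close>, of class \<open>C\<^sup>2\<close> in space and \<open>C\<^sup>1\<close> in
  time on \<open>\<Omega> \<times> (0,\<infinity>)\<close>, with a normal derivative at the boundary for every positive time. Nothing is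
  required of the spatial derivatives at time \<open>0\<close>, because the initial datum need not satisfy the
  Neumann condition.\<close>

definition classical_regularity :: "(real^'n::finite) set \<Rightarrow> (real^'n \<Rightarrow> real \<Rightarrow> real) \<Rightarrow> bool" where
  "classical_regularity \<Omega> u \<longleftrightarrow>
     continuous_on (closure \<Omega> \<times> {0..}) (\<lambda>(x, t). u x t) \<and>
     (\<forall>t>0. Ck_on 2 \<Omega> (\<lambda>x. u x t)) \<and>
     (\<forall>x\<in>\<Omega>. \<forall>t>0. u x differentiable (at t)) \<and>
     continuous_on (\<Omega> \<times> {0<..}) (\<lambda>(x, t). deriv (u x) t) \<and>
     continuous_on (\<Omega> \<times> {0<..}) (\<lambda>(x, t). gradient (\<lambda>y. u y t) x) \<and>
     continuous_on (\<Omega> \<times> {0<..}) (\<lambda>(x, t). hessian (\<lambda>y. u y t) x)"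

definition solves_P ::
    "(real^'n::finite) set \<Rightarrow> (real \<Rightarrow> real \<Rightarrow> real) \<Rightarrow> (real^'n \<Rightarrow> real) \<Rightarrow> real \<Rightarrow>
     (real^'n \<Rightarrow> real \<Rightarrow> real) \<Rightarrow> bool" where
  "solves_P \<Omega> f u0 \<epsilon> u \<longleftrightarrow>
     classical_regularity \<Omega> u \<and>
     (\<forall>x\<in>\<Omega>. \<forall>t>0. deriv (u x) t =
        laplacian (\<lambda>y. u y t) x + 1 / \<epsilon>\<^sup>2 * f (u x t) (\<epsilon> * integral \<Omega> (\<lambda>y. u y t))) \<and>
     (\<forall>x\<in>frontier \<Omega>. \<forall>n. outer_unit_normal \<Omega> x n \<longrightarrow>
        (\<forall>t>0. has_normal_derivative (\<lambda>y. u y t) 0 x n)) \<and>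
     (\<forall>x\<in>\<Omega>. u x 0 = u0 x)"

end

theory Submission
  imports Defs
begin

text \<open>Comparison with explicit subsolutions replaces the ODE flow of \<open>f\<close>. Spatially constant
  subsolutions relaxing exponentially to \<open>-1 - \<eta>\<close> bound \<open>u\<close> from below, which also makes the nonlocal
  term \<open>O(\<epsilon>)\<close>. Fix \<open>x\<^sub>0\<close> with \<open>u\<^sub>0 x\<^sub>0 - a \<ge> M\<^sub>0 \<epsilon>\<close>, let \<open>\<phi> \<le> u\<^sub>0\<close> be a barrier
  that keeps a fixed fraction of \<open>u\<^sub>0 - a\<close> at \<open>x\<^sub>0\<close> and is very negative away from \<open>x\<^sub>0\<close>, and put
  \<open>\<zeta> = E (\<phi> - a) - B (2 \<epsilon> E - \<epsilon> + \<epsilon>\<^sup>2 E\<^sup>2)\<close> with \<open>E = exp (\<mu> t / \<epsilon>\<^sup>2)\<close>. Then \<open>P \<zeta>\<close> is a subsolution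
  whenever \<open>\<mu> z P' z \<le> f (P z) 0\<close> with room for error terms. The profile \<open>a + z / (1 + L z)\<close> lifts
  \<open>u\<close> to a fixed distance above \<open>a\<close>, and \<open>b - (b - a) (z / 2) powr (- q)\<close> then lifts it close to \<open>1\<close>; at
  the final time \<open>E = 1 / \<epsilon>\<close>, so \<open>\<zeta>\<close> is as large as desired at \<open>x\<^sub>0\<close>. Nothing prevents \<open>u\<^sub>0\<close> from
  attaining \<open>a\<close> on \<open>\<partial>\<Omega>\<close>, nor does \<open>u\<^sub>0\<close> satisfy the Neumann condition; near the boundary
  the barrier is therefore built from a local defining function, using that \<open>u\<^sub>0 - a\<close> has constant sign
  there. Upper bounds follow from the symmetry \<open>u \<mapsto> - u\<close>.\<close>

section \<open>One-dimensional jets and comparison by first touching\<close>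

text \<open>The factor E grows like the flow linearised at a, and a profile P with \<mu> z P' z
  \<le> f (P z) 0 turns z' = \<mu> z into a motion no faster than y' = f y 0. Such profiles exist in
  closed form with P'' / P' bounded, which replaces estimates on derivatives of the ODE flow in its
  initial value. The term p subtracted with weight B solves p' = (\<mu> / \<epsilon>^2) (p + B
  \<epsilon> + B (\<epsilon> E)^2): one source pays for the Laplacian of the barrier and for the
  nonlocal error, the other for its squared gradient. As \<epsilon> E \<le> 1 up to the final time,
  p stays below 3 B, so an initial excess of order \<epsilon>, magnified by 1 / \<epsilon>, survives
  it; this is the origin of the width M0 \<epsilon>. One profile does not suffice: the first sees
  only the expansion of f at a and saturates at height 1 / L, the second needs f bounded away from
  0. The nonlocal equation itself is not directly suited to comparison; the integral is frozen into
  a given function v of time, whose smallness comes from a continuation argument.\<close>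

definition jet2 :: "(real \<Rightarrow> real) \<Rightarrow> real \<Rightarrow> real \<Rightarrow> bool" where
  "jet2 q d e \<longleftrightarrow> (\<exists>P. (\<forall>\<^sub>F s in nhds 0. (q has_real_derivative P s) (at s)) \<and> P 0 = d \<and>
                     (P has_real_derivative e) (at 0))"

lemma jet2_cong:
  assumes "jet2 q d e" "\<And>s. q s = q' s" "d = d'" "e = e'"
  shows "jet2 q' d' e'"
  using assms by (metis ext)

lemma jet2_const: "jet2 (\<lambda>_. c) 0 0"
  unfolding jet2_def by (intro exI[of _ "\<lambda>_. 0"]) auto

lemma jet2_affine: "jet2 (\<lambda>s. c + s * d) d 0"
  unfolding jet2_def
  by (intro exI[of _ "\<lambda>_. d"] conjI always_eventually allI) (auto intro!: derivative_eq_intros)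

lemma jet2_add:
  assumes "jet2 p d e" "jet2 q d' e'"
  shows "jet2 (\<lambda>s. p s + q s) (d + d') (e + e')"
proof -
  obtain P Q where P: "\<forall>\<^sub>F s in nhds 0. (p has_real_derivative P s) (at s)" "P 0 = d" "(P has_real_derivative e) (at 0)"
    and Q: "\<forall>\<^sub>F s in nhds 0. (q has_real_derivative Q s) (at s)" "Q 0 = d'" "(Q has_real_derivative e') (at 0)"
    using assms unfolding jet2_def by blast
  have "\<forall>\<^sub>F s in nhds 0. ((\<lambda>s. p s + q s) has_real_derivative P s + Q s) (at s)"
    using P(1) Q(1) by eventually_elim (rule DERIV_add)
  then show ?thesis
    unfolding jet2_def using P Q by (intro exI[of _ "\<lambda>s. P s + Q s"]) (auto intro: DERIV_add)
qed

lemma jet2_mult: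
  assumes "jet2 p d e" "jet2 q d' e'"
  shows "jet2 (\<lambda>s. p s * q s) (d * q 0 + p 0 * d') (e * q 0 + 2 * (d * d') + p 0 * e')"
proof -
  obtain P Q where P: "\<forall>\<^sub>F s in nhds 0. (p has_real_derivative P s) (at s)" "P 0 = d" "(P has_real_derivative e) (at 0)"
    and Q: "\<forall>\<^sub>F s in nhds 0. (q has_real_derivative Q s) (at s)" "Q 0 = d'" "(Q has_real_derivative e') (at 0)"
    using assms unfolding jet2_def by blast
  have 1: "\<forall>\<^sub>F s in nhds 0. ((\<lambda>s. p s * q s) has_real_derivative P s * q s + p s * Q s) (at s)"
    using P(1) Q(1) by eventually_elim (auto intro!: derivative_eq_intros)
  have p: "(p has_real_derivative P 0) (at 0)" and q: "(q has_real_derivative Q 0) (at 0)"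
    using P(1) Q(1) eventually_nhds_x_imp_x by blast+
  have "((\<lambda>s. P s * q s + p s * Q s) has_real_derivative (e * q 0 + 2 * (d * d') + p 0 * e')) (at 0)"
    using p q P Q by (auto intro!: derivative_eq_intros)
  with 1 show ?thesis
    unfolding jet2_def using P Q by (intro exI[of _ "\<lambda>s. P s * q s + p s * Q s"]) auto
qed

lemma jet2_cmult: "jet2 q d e \<Longrightarrow> jet2 (\<lambda>s. c * q s) (c * d) (c * e)"
  using jet2_mult[OF jet2_const[of c]] by simp

lemma jet2_minus: "jet2 q d e \<Longrightarrow> jet2 (\<lambda>s. - q s) (- d) (- e)"
  using jet2_cmult[of q d e "-1"] by simp

lemma jet2_diff: "jet2 p d e \<Longrightarrow> jet2 q d' e' \<Longrightarrow> jet2 (\<lambda>s. p s - q s) (d - d') (e - e')"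
  using jet2_add[OF _ jet2_minus, of p d e q d' e'] by simp

lemma jet2_comp:
  assumes q: "jet2 q d e"
    and G: "\<forall>\<^sub>F y in nhds (q 0). (G has_real_derivative G' y) (at y)"
    and G': "(G' has_real_derivative G2) (at (q 0))"
  shows "jet2 (\<lambda>s. G (q s)) (G' (q 0) * d) (G' (q 0) * e + G2 * d\<^sup>2)"
proof -
  obtain P where P: "\<forall>\<^sub>F s in nhds 0. (q has_real_derivative P s) (at s)" "P 0 = d" "(P has_real_derivative e) (at 0)"
    using assms unfolding jet2_def by blast
  have q0: "(q has_real_derivative P 0) (at 0)"
    using P(1) eventually_nhds_x_imp_x by blast
  have "isCont q 0" using q0 DERIV_isCont by blast
  then have "filterlim q (nhds (q 0)) (nhds 0)"
    by (simp add: isCont_def tendsto_at_iff_tendsto_nhds)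
  then have "\<forall>\<^sub>F s in nhds 0. (G has_real_derivative G' (q s)) (at (q s))"
    using G by (auto simp: filterlim_iff)
  then have 1: "\<forall>\<^sub>F s in nhds 0. ((\<lambda>s. G (q s)) has_real_derivative G' (q s) * P s) (at s)"
    using P(1) by eventually_elim (rule DERIV_chain2)
  have "((\<lambda>s. G' (q s)) has_real_derivative G2 * P 0) (at 0)"
    using DERIV_chain2[OF G' q0] .
  then have "((\<lambda>s. G' (q s) * P s) has_real_derivative (G' (q 0) * e + G2 * d\<^sup>2)) (at 0)"
    using P by (auto intro!: derivative_eq_intros simp: power2_eq_square)
  with 1 show ?thesis
    unfolding jet2_def using P by (intro exI[of _ "\<lambda>s. G' (q s) * P s"]) auto
qed

text \<open>The second derivative is available at 0 only, so the mean value theorem replaces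
  Taylor's formula: if e < 0, then P 0 = 0 forces P < 0 to the right of 0, whence r < 0
  there.\<close>

lemma jet2_nonneg_at_minimum:
  assumes r: "jet2 r d e" and pos: "\<forall>\<^sub>F s in nhds 0. 0 \<le> r s" and zero: "r 0 = 0"
  shows "0 \<le> e"
proof (rule ccontr)
  assume "\<not> 0 \<le> e"
  then have e: "e < 0" by simp
  obtain P where P: "\<forall>\<^sub>F s in nhds 0. (r has_real_derivative P s) (at s)" "P 0 = d" "(P has_real_derivative e) (at 0)"
    using assms unfolding jet2_def by blast
  obtain d1 where d1: "d1 > 0" "\<And>s. dist s 0 < d1 \<Longrightarrow> (r has_real_derivative P s) (at s)"
    using P(1) unfolding eventually_nhds_metric by blast
  obtain d2 where d2: "d2 > 0" "\<And>s. dist s 0 < d2 \<Longrightarrow> 0 \<le> r s"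
    using pos unfolding eventually_nhds_metric by blast
  have "P 0 = 0"
    using DERIV_local_min[OF d1(2)[of 0] d2(1)] d1(1) d2(2) zero by (auto simp: dist_real_def)
  moreover obtain d3 where d3: "d3 > 0" "\<And>h. 0 < h \<Longrightarrow> h < d3 \<Longrightarrow> P (0 + h) < P 0"
    using DERIV_neg_dec_right[OF P(3) e] by auto
  ultimately have neg: "P h < 0" if "0 < h" "h < d3" for h using that by force
  define s where "s = min d1 (min d2 d3) / 2"
  have s: "0 < s" "s < d1" "s < d2" "s < d3" using d1(1) d2(1) d3(1) by (auto simp: s_def)
  obtain z where z: "0 < z" "z < s" "r s - r 0 = (s - 0) * P z"
    using MVT2[of 0 s r P] s d1(2) by (auto simp: dist_real_def)
  then have "r s < 0" using neg[of z] s zero by (auto simp: mult_pos_neg)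
  with d2(2)[of s] s show False by (auto simp: dist_real_def)
qed

text \<open>First contact sees nothing of the Laplacian but the pure second derivatives
  \<open>e i\<close> and their sum. Asking for them at a single point lets solutions, barriers and
  compositions with profiles share one calculus.\<close>

abbreviation axis_jets ::
    "(real^'n::finite \<Rightarrow> real) \<Rightarrow> real^'n \<Rightarrow> ('n \<Rightarrow> real) \<Rightarrow> ('n \<Rightarrow> real) \<Rightarrow> bool" where
  "axis_jets \<phi> x d e \<equiv> \<forall>i. jet2 (\<lambda>s. \<phi> (x + s *\<^sub>R axis i 1)) (d i) (e i)"

text \<open>Encodes a strictly negative outer normal derivative: \<phi> increases at rate D along -
  n. A function of zero normal derivative cannot then be touched from below. The last conjunct keeps
  the segment in closure \<Omega>, where the ordering is known.\<close>

abbreviation inward_increasing :: "(real^'n::finite) set \<Rightarrow> (real^'n \<Rightarrow> real) \<Rightarrow> real^'n \<Rightarrow> bool" where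
  "inward_increasing \<Omega> \<phi> x \<equiv> \<exists>n D. outer_unit_normal \<Omega> x n \<and> 0 < D \<and>
     ((\<lambda>h. \<phi> (x - h *\<^sub>R n)) has_real_derivative D) (at_right 0) \<and>
     (\<forall>\<^sub>F h in at_right 0. x - h *\<^sub>R n \<in> closure \<Omega>)"

text \<open>Keeps exactly the regularity that a first contact uses. The class is invariant under a
  change of sign, which is what carries lower bounds over to upper bounds.\<close>

definition reaction_solution ::
    "(real^'n::finite) set \<Rightarrow> (real \<Rightarrow> real \<Rightarrow> real) \<Rightarrow> (real^'n \<Rightarrow> real \<Rightarrow> real) \<Rightarrow> bool" where
  "reaction_solution \<Omega> F u \<longleftrightarrow>
     continuous_on (closure \<Omega> \<times> {0..}) (\<lambda>(x, t). u x t) \<and>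
     (\<forall>x\<in>\<Omega>. \<forall>t>0. \<exists>d e. axis_jets (\<lambda>z. u z t) x d e \<and>
        (u x has_real_derivative (\<Sum>i\<in>UNIV. e i) + F t (u x t)) (at t)) \<and>
     (\<forall>x\<in>frontier \<Omega>. \<forall>n. outer_unit_normal \<Omega> x n \<longrightarrow>
        (\<forall>t>0. has_normal_derivative (\<lambda>y. u y t) 0 x n))"

text \<open>The integral enters as an arbitrary function v of time. With v given, the equation is
  local and the comparison principle applies.\<close>

abbreviation nonlocal_solution ::
    "(real^'n::finite) set \<Rightarrow> (real \<Rightarrow> real \<Rightarrow> real) \<Rightarrow> real \<Rightarrow> (real \<Rightarrow> real) \<Rightarrow>
     (real^'n \<Rightarrow> real \<Rightarrow> real) \<Rightarrow> bool" where
  "nonlocal_solution \<Omega> f \<epsilon> v u \<equiv> reaction_solution \<Omega> (\<lambda>t y. 1 / \<epsilon>\<^sup>2 * f y (v t)) u"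

lemma reaction_solution_uminus:
  assumes "reaction_solution \<Omega> F u"
  shows "reaction_solution \<Omega> (\<lambda>t y. - F t (- y)) (\<lambda>x t. - u x t)"
  unfolding reaction_solution_def
proof (intro conjI ballI allI impI)
  show "continuous_on (closure \<Omega> \<times> {0..}) (\<lambda>(x, t). - u x t)"
    using assms unfolding reaction_solution_def by (auto simp: case_prod_unfold intro: continuous_on_minus)
next
  fix x and t :: real assume x: "x \<in> \<Omega>" and t: "0 < t"
  obtain d e where de: "\<And>i. jet2 (\<lambda>s. u (x + s *\<^sub>R axis i 1) t) (d i) (e i)"
     "(u x has_real_derivative (\<Sum>i\<in>UNIV. e i) + F t (u x t)) (at t)"
    using assms x t unfolding reaction_solution_def by blast
  show "\<exists>d e. axis_jets (\<lambda>z. - u z t) x d e \<and>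
        ((\<lambda>t. - u x t) has_real_derivative (\<Sum>i\<in>UNIV. e i) + - F t (- (- u x t))) (at t)"
    using jet2_minus[OF de(1)] DERIV_minus[OF de(2)]
    by (intro exI[of _ "\<lambda>i. - d i"] exI[of _ "\<lambda>i. - e i"]) (simp add: sum_negf)
next
  fix x n and t :: real assume "x \<in> frontier \<Omega>" "outer_unit_normal \<Omega> x n" "0 < t"
  then have "has_normal_derivative (\<lambda>y. u y t) 0 x n"
    using assms unfolding reaction_solution_def by blast
  then show "has_normal_derivative (\<lambda>y. - u y t) 0 x n"
    unfolding has_normal_derivative_def by (auto dest: DERIV_minus)
qed

text \<open>At the earliest contact time u - \<omega> has a local spatial minimum 0. Inside, the
  second derivatives are ordered, so the strict inequality makes u - \<omega> increase in time and
  hence negative shortly before; on the boundary the normal derivatives contradict each other. A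
  need not be a cylinder: \<open>nhd\<close> asks only for a backward neighbourhood of each possible
  contact point. \<open>boundary\<close> may use the ordering at earlier times, which a spatially
  constant \<omega> requires.\<close>

lemma reaction_solution_comparison:
  fixes u \<omega> :: "real^'n::finite \<Rightarrow> real \<Rightarrow> real"
  assumes sol: "reaction_solution \<Omega> F u"
    and op: "open \<Omega>"
    and A: "compact A" "A \<subseteq> closure \<Omega> \<times> {0..}"
    and cont: "continuous_on A (\<lambda>(x, t). \<omega> x t)"
    and initial: "\<And>x. (x, 0) \<in> A \<Longrightarrow> \<omega> x 0 < u x 0"
    and nhd: "\<And>x t. (x, t) \<in> A \<Longrightarrow> 0 < t \<Longrightarrow> u x t \<le> \<omega> x t \<Longrightarrow>
        \<exists>\<delta>>0. \<forall>y\<in>closure \<Omega>. \<forall>s. dist y x < \<delta> \<longrightarrow> t - \<delta> < s \<longrightarrow> s \<le> t \<longrightarrow> (y, s) \<in> A"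
    and interior: "\<And>x t. (x, t) \<in> A \<Longrightarrow> x \<in> \<Omega> \<Longrightarrow> 0 < t \<Longrightarrow> \<omega> x t = u x t \<Longrightarrow>
        \<exists>d e \<omega>t. axis_jets (\<lambda>z. \<omega> z t) x d e \<and>
          (\<omega> x has_real_derivative \<omega>t) (at t) \<and> \<omega>t < (\<Sum>i\<in>UNIV. e i) + F t (u x t)"
    and boundary: "\<And>x t. (x, t) \<in> A \<Longrightarrow> x \<in> frontier \<Omega> \<Longrightarrow> 0 < t \<Longrightarrow> \<omega> x t = u x t \<Longrightarrow>
        (\<And>y s. (y, s) \<in> A \<Longrightarrow> s < t \<Longrightarrow> \<omega> y s < u y s) \<Longrightarrow>
        inward_increasing \<Omega> (\<lambda>z. \<omega> z t) x"
    and xt: "(x, t) \<in> A"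
  shows "\<omega> x t < u x t"
proof (rule ccontr)
  assume neg: "\<not> \<omega> x t < u x t"
  define S where "S = {z\<in>A. (\<lambda>(x, t). u x t) z \<le> (\<lambda>(x, t). \<omega> x t) z}"
  have cu: "continuous_on A (\<lambda>(x, t). u x t)"
    using sol A(2) unfolding reaction_solution_def by (blast intro: continuous_on_subset)
  have "closed S"
    unfolding S_def using continuous_on_closed_Collect_le[OF cu cont] A(1) compact_imp_closed by blast
  moreover have "A \<inter> S = S" unfolding S_def by blast
  ultimately have "compact S" using compact_Int_closed[OF A(1), of S] by simp
  moreover have "(x, t) \<in> S" using xt neg by (simp add: S_def)
  then have "S \<noteq> {}" by blast
  ultimately obtain z0 where z0: "z0 \<in> S" "\<forall>z\<in>S. snd z0 \<le> snd z"
    using continuous_attains_inf[of S snd, OF _ _ continuous_on_snd[OF continuous_on_id]] by blast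
  obtain x0 t0 where z0eq: "z0 = (x0, t0)" by fastforce
  have x0: "(x0, t0) \<in> A" "u x0 t0 \<le> \<omega> x0 t0" using z0(1) z0eq by (auto simp: S_def)
  have t0: "0 < t0"
  proof -
    have "0 \<le> t0" using x0(1) A(2) by auto
    moreover have "t0 \<noteq> 0" using initial[of x0] x0 by auto
    ultimately show ?thesis by simp
  qed
  have before: "\<omega> y s < u y s" if "(y, s) \<in> A" "s < t0" for y s
  proof (rule ccontr)
    assume "\<not> \<omega> y s < u y s"
    then have "(y, s) \<in> S" using that(1) by (simp add: S_def)
    from bspec[OF z0(2) this] that(2) z0eq show False by simp
  qed
  obtain \<delta> where \<delta>: "\<delta> > 0"
    "\<And>y s. y \<in> closure \<Omega> \<Longrightarrow> dist y x0 < \<delta> \<Longrightarrow> t0 - \<delta> < s \<Longrightarrow> s \<le> t0 \<Longrightarrow> (y, s) \<in> A"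
    using nhd[OF x0(1) t0 x0(2)] by blast
  \<comment> \<open>\<open>before\<close> orders the functions at times below t0 only; letting such
    times tend to t0 preserves the weak ordering. The shift 2 + n keeps every sampled time strictly
    within \<delta> of t0.\<close>
  have le: "\<omega> y t0 \<le> u y t0" if y: "y \<in> closure \<Omega>" "dist y x0 < \<delta>" for y
  proof -
    define X where "X = (\<lambda>n. (y, t0 - \<delta> / (2 + real n)))"
    have XA: "X n \<in> A" for n
    proof -
      have "0 < \<delta> / (2 + real n)" "\<delta> * 1 < \<delta> * (2 + real n)"
        using \<delta>(1) by (auto intro!: mult_strict_left_mono)
      then have "\<delta> / (2 + real n) < \<delta>" "0 < \<delta> / (2 + real n)" by (auto simp: divide_less_eq)
      then show ?thesis unfolding X_def using \<delta>(2)[OF y] by auto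
    qed
    have yA: "(y, t0) \<in> A" using \<delta> y by auto
    have "(\<lambda>n. \<delta> / (2 + real n)) \<longlonglongrightarrow> 0"
      by (intro real_tendsto_divide_at_top[OF tendsto_const]
            filterlim_tendsto_add_at_top[OF tendsto_const] filterlim_real_sequentially)
    from tendsto_diff[OF tendsto_const[of t0] this]
    have Xlim: "X \<longlonglongrightarrow> (y, t0)"
      unfolding X_def by (intro tendsto_Pair tendsto_const) simp
    have l1: "(\<lambda>n. (\<lambda>(x, t). \<omega> x t) (X n)) \<longlonglongrightarrow> (\<lambda>(x, t). \<omega> x t) (y, t0)"
      by (rule continuous_on_tendsto_compose[OF cont Xlim yA]) (use XA in auto)
    have l2: "(\<lambda>n. (\<lambda>(x, t). u x t) (X n)) \<longlonglongrightarrow> (\<lambda>(x, t). u x t) (y, t0)"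
      by (rule continuous_on_tendsto_compose[OF cu Xlim yA]) (use XA in auto)
    have "(\<lambda>(x, t). \<omega> x t) (X n) \<le> (\<lambda>(x, t). u x t) (X n)" for n
    proof -
      have "0 < \<delta> / (2 + real n)" using \<delta>(1) by simp
      then have "\<omega> y (t0 - \<delta> / (2 + real n)) < u y (t0 - \<delta> / (2 + real n))"
        using XA[of n] unfolding X_def by (intro before) auto
      then show ?thesis by (simp add: X_def)
    qed
    then have "(\<lambda>(x, t). \<omega> x t) (y, t0) \<le> (\<lambda>(x, t). u x t) (y, t0)"
      by (intro LIMSEQ_le[OF l1 l2]) blast
    then show ?thesis by simp
  qed
  have x0cl: "x0 \<in> closure \<Omega>" using x0 A(2) by auto
  have eq: "\<omega> x0 t0 = u x0 t0" using le[of x0] x0cl x0(2) \<delta>(1) by auto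
  show False
  proof (cases "x0 \<in> \<Omega>")
    case True
    obtain d e \<omega>t where w: "\<And>i. jet2 (\<lambda>s. \<omega> (x0 + s *\<^sub>R axis i 1) t0) (d i) (e i)"
      "(\<omega> x0 has_real_derivative \<omega>t) (at t0)" "\<omega>t < (\<Sum>i\<in>UNIV. e i) + F t0 (u x0 t0)"
      using interior[OF x0(1) True t0 eq] by blast
    obtain d' e' where v: "\<And>i. jet2 (\<lambda>s. u (x0 + s *\<^sub>R axis i 1) t0) (d' i) (e' i)"
      "(u x0 has_real_derivative (\<Sum>i\<in>UNIV. e' i) + F t0 (u x0 t0)) (at t0)"
      using sol True t0 unfolding reaction_solution_def by blast
    have "e i \<le> e' i" for i
    proof -
      have "open (\<Omega> \<inter> ball x0 \<delta>)" "x0 \<in> \<Omega> \<inter> ball x0 \<delta>" using op True \<delta>(1) by auto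
      then obtain \<rho> where \<rho>: "\<rho> > 0" "ball x0 \<rho> \<subseteq> \<Omega> \<inter> ball x0 \<delta>" by (meson open_contains_ball)
      have "\<omega> (x0 + s *\<^sub>R axis i 1) t0 \<le> u (x0 + s *\<^sub>R axis i 1) t0" if "dist s 0 < \<rho>" for s
      proof -
        have "x0 + s *\<^sub>R axis i 1 \<in> ball x0 \<rho>" using that by (simp add: dist_norm)
        then show ?thesis using \<rho>(2) closure_subset[of \<Omega>] by (intro le) (auto simp: dist_commute)
      qed
      then have "\<forall>\<^sub>F s in nhds 0. 0 \<le> u (x0 + s *\<^sub>R axis i 1) t0 - \<omega> (x0 + s *\<^sub>R axis i 1) t0"
        using \<rho>(1) by (auto simp: eventually_nhds_metric)
      from jet2_nonneg_at_minimum[OF jet2_diff[OF v(1)[of i] w(1)[of i]] this] eq show ?thesis by auto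
    qed
    then have "(\<Sum>i\<in>UNIV. e i) \<le> (\<Sum>i\<in>UNIV. e' i)" by (intro sum_mono) auto
    then have lt: "0 < (\<Sum>i\<in>UNIV. e' i) + F t0 (u x0 t0) - \<omega>t" using w(3) by linarith
    have "((\<lambda>t. u x0 t - \<omega> x0 t) has_real_derivative (\<Sum>i\<in>UNIV. e' i) + F t0 (u x0 t0) - \<omega>t) (at t0)"
      using DERIV_diff[OF v(2) w(2)] .
    from DERIV_pos_inc_left[OF this lt] obtain c where c: "c > 0"
      "\<And>h. 0 < h \<Longrightarrow> h < c \<Longrightarrow> u x0 (t0 - h) - \<omega> x0 (t0 - h) < u x0 t0 - \<omega> x0 t0" by auto
    define h where "h = min c \<delta> / 2"
    have h: "0 < h" "h < c" "h < \<delta>" using c \<delta>(1) by (auto simp: h_def)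
    have "(x0, t0 - h) \<in> A" using \<delta>(2)[OF x0cl, of "t0 - h"] h \<delta>(1) by auto
    from before[OF this] c(2)[OF h(1,2)] eq h show False by auto
  next
    case False
    then have fr: "x0 \<in> frontier \<Omega>" using x0cl op by (simp add: frontier_def interior_open)
    obtain n D where n: "outer_unit_normal \<Omega> x0 n" "0 < D"
      "((\<lambda>h. \<omega> (x0 - h *\<^sub>R n) t0) has_real_derivative D) (at_right 0)"
      "\<forall>\<^sub>F h in at_right 0. x0 - h *\<^sub>R n \<in> closure \<Omega>"
      using boundary[OF x0(1) fr t0 eq before] by blast
    have "((\<lambda>h. u (x0 - h *\<^sub>R n) t0) has_real_derivative 0) (at_right 0)"
      using sol fr n(1) t0 unfolding reaction_solution_def has_normal_derivative_def by fastforce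
    from DERIV_diff[OF this n(3)]
    have "((\<lambda>h. u (x0 - h *\<^sub>R n) t0 - \<omega> (x0 - h *\<^sub>R n) t0) has_real_derivative - D) (at_right 0)" by simp
    then have lim: "((\<lambda>h. (u (x0 - h *\<^sub>R n) t0 - \<omega> (x0 - h *\<^sub>R n) t0) / h) \<longlongrightarrow> - D) (at_right 0)"
      using eq by (simp add: has_field_derivative_iff)
    have "((\<lambda>h. x0 - h *\<^sub>R n) \<longlongrightarrow> x0 - 0 *\<^sub>R n) (at_right 0)" by (intro tendsto_intros)
    then have "((\<lambda>h. x0 - h *\<^sub>R n) \<longlongrightarrow> x0) (at_right 0)" by simp
    then have "\<forall>\<^sub>F h in at_right 0. dist (x0 - h *\<^sub>R n) x0 < \<delta>" using \<delta>(1) by (rule tendstoD)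
    with n(4) have "\<forall>\<^sub>F h in at_right 0. 0 \<le> (u (x0 - h *\<^sub>R n) t0 - \<omega> (x0 - h *\<^sub>R n) t0) / h"
      using eventually_at_right_less[of 0]
      by eventually_elim (use le in \<open>auto intro!: divide_nonneg_pos\<close>)
    from tendsto_lowerbound[OF lim this] n(2) show False by auto
  qed
qed

section \<open>Second-order estimates for C2 functions\<close>

lemma Ck2_local_estimates:
  fixes g :: "real^'n::finite \<Rightarrow> real"
  assumes op: "open S" and Ck: "Ck_on 2 S g" and p: "p \<in> S"
  obtains r C where "r > 0" "C > 0" "ball p r \<subseteq> S" "continuous_on S (gradient g)"
    "\<And>x. x \<in> S \<Longrightarrow> (g has_derivative (\<lambda>h. gradient g x \<bullet> h)) (at x)"
    "\<And>x. x \<in> ball p r \<Longrightarrow> norm (gradient g x) \<le> C"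
    "\<And>x y. x \<in> ball p r \<Longrightarrow> y \<in> ball p r \<Longrightarrow>
       \<bar>g y - g x - gradient g x \<bullet> (y - x)\<bar> \<le> C * (norm (y - x))\<^sup>2"
    "\<And>x i. x \<in> S \<Longrightarrow>
       jet2 (\<lambda>s. g (x + s *\<^sub>R axis i 1)) (gradient g x $ i) (partial_deriv i (partial_deriv i g) x)"
    "\<And>x i. x \<in> ball p r \<Longrightarrow> \<bar>partial_deriv i (partial_deriv i g) x\<bar> \<le> C"
proof -
  \<comment> \<open>\<open>Ck_on 2\<close> provides derivatives direction by direction. Along the
    axes they are the entries of the Hessian, and linearity recovers all other directions.\<close>
  define H where "H i j x = frechet_derivative (\<lambda>x. frechet_derivative g (at x) (axis i 1)) (at x) (axis j 1)"
    for i j :: 'n and x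
  have diff1: "g differentiable (at x)" if "x \<in> S" for x
    using Ck that by (simp add: numeral_2_eq_2)
  have diff2: "(\<lambda>x. frechet_derivative g (at x) (axis i 1)) differentiable (at x)" if "x \<in> S" for x and i :: 'n
    using Ck that by (simp add: numeral_2_eq_2)
  have contH: "continuous_on S (H i j)" for i j
    using Ck unfolding H_def by (simp add: numeral_2_eq_2)
  have lin: "L h = (\<Sum>i\<in>UNIV. h $ i * L (axis i 1))" if "(f has_derivative L) F"
    for f L h and F :: "(real^'n) filter"
  proof -
    have l: "linear L" using has_derivative_linear[OF that] .
    have "h = (\<Sum>i\<in>UNIV. h $ i *\<^sub>R axis i 1)" using basis_expansion[of h] by (simp add: scalar_mult_eq_scaleR)
    then have "L h = L (\<Sum>i\<in>UNIV. h $ i *\<^sub>R axis i 1)" by simp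
    also have "\<dots> = (\<Sum>i\<in>UNIV. h $ i * L (axis i 1))"
      by (simp add: linear_sum[OF l] linear_cmul[OF l])
    finally show ?thesis .
  qed
  have D1: "(g has_derivative (\<lambda>h. gradient g x \<bullet> h)) (at x)" if "x \<in> S" for x
  proof -
    have w: "(g has_derivative frechet_derivative g (at x)) (at x)"
      using diff1[OF that] frechet_derivative_works by blast
    have "frechet_derivative g (at x) = (\<lambda>h. gradient g x \<bullet> h)"
      by (rule ext, subst lin[OF w])
        (simp add: gradient_def partial_deriv_def inner_vec_def mult.commute)
    with w show ?thesis by simp
  qed
  have D2: "((\<lambda>x. gradient g x $ i) has_derivative (\<lambda>h. \<Sum>j\<in>UNIV. h $ j * H i j x)) (at x)"
    if "x \<in> S" for x i
  proof -
    let ?f = "\<lambda>x. frechet_derivative g (at x) (axis i 1)"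
    have w: "(?f has_derivative frechet_derivative ?f (at x)) (at x)"
      using diff2[OF that] frechet_derivative_works by blast
    have "frechet_derivative ?f (at x) = (\<lambda>h. \<Sum>j\<in>UNIV. h $ j * H i j x)"
      by (rule ext, subst lin[OF w]) (simp add: H_def)
    with w show ?thesis by (simp add: gradient_def partial_deriv_def)
  qed
  have contN: "continuous_on S (gradient g)"
  proof (rule continuous_at_imp_continuous_on, rule ballI)
    fix x assume "x \<in> S"
    then have "((\<lambda>y. gradient g y $ i) \<longlongrightarrow> gradient g x $ i) (at x)" for i
      using has_derivative_continuous[OF D2[of x i]] by (simp add: isCont_def)
    then show "isCont (gradient g) x" unfolding isCont_def by (intro vec_tendstoI)
  qed
  obtain r where r: "r > 0" "cball p r \<subseteq> S" using op p open_contains_cball by blast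
  have "\<exists>B. \<forall>x\<in>cball p r. \<bar>H i j x\<bar> \<le> B" for i j
  proof -
    have "compact (H i j ` cball p r)"
      using contH r(2) by (intro compact_continuous_image) (auto intro: continuous_on_subset)
    then show ?thesis using bounded_iff[of "H i j ` cball p r"] compact_imp_bounded by auto
  qed
  then obtain B where B: "\<And>i j x. x \<in> cball p r \<Longrightarrow> \<bar>H i j x\<bar> \<le> B i j" by metis
  define B0 where "B0 = (\<Sum>i\<in>UNIV. \<Sum>j\<in>UNIV. B i j)"
  have B_nonneg: "0 \<le> B i j" for i j using B[of p i j] r(1) by auto
  have B0: "B i j \<le> B0" for i j
  proof -
    have "B i j \<le> (\<Sum>j\<in>UNIV. B i j)" by (intro member_le_sum) (auto simp: B_nonneg)
    also have "\<dots> \<le> B0" unfolding B0_def by (intro member_le_sum) (auto simp: B_nonneg sum_nonneg)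
    finally show ?thesis .
  qed
  have HB: "\<bar>H i j x\<bar> \<le> B0" if "x \<in> cball p r" for i j x using B[OF that] B0 order_trans by blast
  have B0_nonneg: "0 \<le> B0" using B_nonneg B0 order_trans by blast
  have "compact (gradient g ` cball p r)"
    using contN r(2) by (intro compact_continuous_image) (auto intro: continuous_on_subset)
  from compact_imp_bounded[OF this] have "\<exists>N0. \<forall>x\<in>cball p r. norm (gradient g x) \<le> N0"
    unfolding bounded_iff by auto
  then obtain N0 where N0: "\<And>x. x \<in> cball p r \<Longrightarrow> norm (gradient g x) \<le> N0" by blast
  \<comment> \<open>One constant for the gradient, the Hessian entries and the Taylor remainder: in
    dimension n, a quadratic form with entries bounded by B0 is at most n^2 B0 |w|^2.\<close>
  define C where "C = 1 + \<bar>N0\<bar> + B0 + real CARD('n) * real CARD('n) * B0"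
  have C: "0 < C" "B0 \<le> C" "N0 \<le> C" "real CARD('n) * real CARD('n) * B0 \<le> C"
  proof -
    have "0 \<le> real CARD('n) * real CARD('n) * B0" using B0_nonneg by simp
    then show "0 < C" "B0 \<le> C" "N0 \<le> C" "real CARD('n) * real CARD('n) * B0 \<le> C"
      unfolding C_def using B0_nonneg by linarith+
  qed
  have line: "((\<lambda>s. x + s *\<^sub>R y) has_derivative (\<lambda>h. h *\<^sub>R y)) (at s)" for x y :: "real^'n" and s :: real
    by (auto intro!: derivative_eq_intros)
  have L1: "((\<lambda>s. g (x + s *\<^sub>R y)) has_real_derivative gradient g (x + s *\<^sub>R y) \<bullet> y) (at s)"
    if "x + s *\<^sub>R y \<in> S" for x y s
    using has_derivative_compose[OF line D1[OF that]]
    by (simp add: has_field_derivative_def mult.commute[of _ "_ \<bullet> _"] mult_commute_abs)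
  have L2i: "((\<lambda>s. gradient g (x + s *\<^sub>R y) $ i) has_real_derivative (\<Sum>j\<in>UNIV. y $ j * H i j (x + s *\<^sub>R y))) (at s)"
    if "x + s *\<^sub>R y \<in> S" for x y s i
  proof -
    have "(\<lambda>h. \<Sum>j\<in>UNIV. (h *\<^sub>R y) $ j * H i j (x + s *\<^sub>R y)) = (*) (\<Sum>j\<in>UNIV. y $ j * H i j (x + s *\<^sub>R y))"
      by (rule ext) (simp add: sum_distrib_left mult_ac)
    with has_derivative_compose[OF line D2[OF that, of i]] show ?thesis
      by (simp add: has_field_derivative_def)
  qed
  have L2: "((\<lambda>s. gradient g (x + s *\<^sub>R y) \<bullet> y) has_real_derivative
      (\<Sum>i\<in>UNIV. (\<Sum>j\<in>UNIV. y $ j * H i j (x + s *\<^sub>R y)) * y $ i)) (at s)"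
    if "x + s *\<^sub>R y \<in> S" for x y s
    unfolding inner_vec_def inner_real_def
    by (intro DERIV_sum DERIV_cmult_right L2i that)
  show thesis
  proof
    show "r > 0" "0 < C" "ball p r \<subseteq> S" "continuous_on S (gradient g)"
      using r C contN ball_subset_cball by blast+
    show "(g has_derivative (\<lambda>h. gradient g x \<bullet> h)) (at x)" if "x \<in> S" for x using D1[OF that] .
    show "norm (gradient g x) \<le> C" if "x \<in> ball p r" for x using N0[of x] that C by auto
    have Hii: "partial_deriv i (partial_deriv i g) x = H i i x" for x i
      by (simp add: H_def partial_deriv_def[abs_def])
    show "\<bar>partial_deriv i (partial_deriv i g) x\<bar> \<le> C" if "x \<in> ball p r" for x i
      using HB[of x i i] that C(2) by (simp add: Hii)
    show "jet2 (\<lambda>s. g (x + s *\<^sub>R axis i 1)) (gradient g x $ i) (partial_deriv i (partial_deriv i g) x)"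
      if xS: "x \<in> S" for x i
      unfolding jet2_def Hii
      proof (intro exI conjI)
        have "open ((\<lambda>s. x + s *\<^sub>R axis i 1) -` S)"
          by (intro open_vimage op continuous_intros)
        then have "\<forall>\<^sub>F s in nhds 0. s \<in> (\<lambda>s. x + s *\<^sub>R axis i 1) -` S"
          using xS by (intro eventually_nhds_in_open) auto
        then show "\<forall>\<^sub>F s in nhds 0. ((\<lambda>s. g (x + s *\<^sub>R axis i 1)) has_real_derivative
             gradient g (x + s *\<^sub>R axis i 1) \<bullet> axis i 1) (at s)"
          by eventually_elim (auto intro: L1)
        show "gradient g (x + 0 *\<^sub>R axis i 1) \<bullet> axis i 1 = gradient g x $ i"
          by (simp add: inner_axis)
        have "(\<Sum>j\<in>UNIV. axis i 1 $ j * H i j x) = H i i x"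
          by (simp add: axis_def if_distrib[of "\<lambda>z. z * _"] cong: if_cong)
        then show "((\<lambda>s. gradient g (x + s *\<^sub>R axis i 1) \<bullet> axis i 1) has_real_derivative H i i x) (at 0)"
          using L2i[of x 0 "axis i 1" i] xS by (simp add: inner_axis)
      qed
    show "\<bar>g y - g x - gradient g x \<bullet> (y - x)\<bar> \<le> C * (norm (y - x))\<^sup>2"
      if x: "x \<in> ball p r" and y: "y \<in> ball p r" for x y
    proof -
      define w where "w = y - x"
      have seg: "x + s *\<^sub>R w \<in> cball p r" if "0 \<le> s" "s \<le> 1" for s
      proof -
        have "(1 - s) *\<^sub>R x + s *\<^sub>R y \<in> cball p r"
          using x y that by (intro convexD[OF convex_cball]) auto
        then show ?thesis by (simp add: w_def algebra_simps)
      qed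
      obtain \<xi> where \<xi>: "0 < \<xi>" "\<xi> < 1" "g (x + 1 *\<^sub>R w) - g (x + 0 *\<^sub>R w) = (1 - 0) * (gradient g (x + \<xi> *\<^sub>R w) \<bullet> w)"
      proof -
        have "((\<lambda>s. g (x + s *\<^sub>R w)) has_real_derivative gradient g (x + s *\<^sub>R w) \<bullet> w) (at s)"
          if "0 \<le> s" "s \<le> 1" for s
          using seg[OF that] r(2) by (intro L1) blast
        from MVT2[of 0 1, OF zero_less_one this] that show ?thesis by blast
      qed
      \<comment> \<open>A second mean value theorem, for the directional derivative on [0, \<xi>].
        The remainder becomes \<xi> Q with \<xi> < 1; the factor 1/2 of Taylor's formula is given
        up.\<close>
      obtain \<zeta> where \<zeta>: "0 < \<zeta>" "\<zeta> < \<xi>" "gradient g (x + \<xi> *\<^sub>R w) \<bullet> w - gradient g (x + 0 *\<^sub>R w) \<bullet> w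
          = (\<xi> - 0) * (\<Sum>i\<in>UNIV. (\<Sum>j\<in>UNIV. w $ j * H i j (x + \<zeta> *\<^sub>R w)) * w $ i)"
      proof -
        have "((\<lambda>s. gradient g (x + s *\<^sub>R w) \<bullet> w) has_real_derivative
            (\<Sum>i\<in>UNIV. (\<Sum>j\<in>UNIV. w $ j * H i j (x + s *\<^sub>R w)) * w $ i)) (at s)"
          if "0 \<le> s" "s \<le> \<xi>" for s
        proof -
          have "s \<le> 1" using that \<xi>(2) by simp
          with seg[OF that(1)] r(2) show ?thesis by (intro L2) blast
        qed
        from MVT2[of 0 \<xi>, OF \<xi>(1) this] that show ?thesis by blast
      qed
      define Q where "Q = (\<Sum>i\<in>UNIV. (\<Sum>j\<in>UNIV. w $ j * H i j (x + \<zeta> *\<^sub>R w)) * w $ i)"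
      have z: "x + \<zeta> *\<^sub>R w \<in> cball p r" using seg \<zeta> \<xi> by auto
      have "\<bar>Q\<bar> \<le> (\<Sum>i\<in>(UNIV::'n set). \<bar>(\<Sum>j\<in>UNIV. w $ j * H i j (x + \<zeta> *\<^sub>R w)) * w $ i\<bar>)"
        unfolding Q_def by (rule sum_abs)
      also have "\<dots> \<le> (\<Sum>i\<in>(UNIV::'n set). real CARD('n) * (norm w * B0) * norm w)"
      proof (rule sum_mono)
        fix i :: 'n
        have "\<bar>\<Sum>j\<in>UNIV. w $ j * H i j (x + \<zeta> *\<^sub>R w)\<bar> \<le> (\<Sum>j\<in>UNIV. \<bar>w $ j * H i j (x + \<zeta> *\<^sub>R w)\<bar>)"
          by (rule sum_abs)
        also have "\<dots> \<le> (\<Sum>j\<in>(UNIV::'n set). norm w * B0)"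
          using HB[OF z] component_le_norm_cart[of w] by (intro sum_mono) (auto simp: abs_mult intro!: mult_mono)
        finally have "\<bar>\<Sum>j\<in>UNIV. w $ j * H i j (x + \<zeta> *\<^sub>R w)\<bar> \<le> real CARD('n) * (norm w * B0)" by simp
        then show "\<bar>(\<Sum>j\<in>UNIV. w $ j * H i j (x + \<zeta> *\<^sub>R w)) * w $ i\<bar> \<le> real CARD('n) * (norm w * B0) * norm w"
          using component_le_norm_cart[of w i] B0_nonneg by (auto simp: abs_mult intro!: mult_mono)
      qed
      also have "\<dots> = (real CARD('n) * real CARD('n) * B0) * (norm w)\<^sup>2"
        by (simp add: power2_eq_square)
      also have "\<dots> \<le> C * (norm w)\<^sup>2" using C(4) by (intro mult_right_mono) auto
      finally have Q: "\<bar>Q\<bar> \<le> C * (norm w)\<^sup>2" .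
      have "g y - g x - gradient g x \<bullet> (y - x) = \<xi> * Q"
        using \<xi>(3) \<zeta>(3) by (simp add: Q_def w_def)
      moreover have "\<xi> * \<bar>Q\<bar> \<le> 1 * \<bar>Q\<bar>" using \<xi> by (intro mult_right_mono) auto
      ultimately show ?thesis using Q \<xi> by (simp add: abs_mult w_def)
    qed
  qed
qed

section \<open>Boundary charts\<close>

lemma jet2_norm_sq: "jet2 (\<lambda>s. (norm (x + s *\<^sub>R axis i 1 - x0))\<^sup>2) (2 * (x - x0) $ i) 2"
  for x x0 :: "real^'n::finite"
proof -
  have "(norm (x + s *\<^sub>R axis i 1 - x0))\<^sup>2 = (norm (x - x0))\<^sup>2 + s * (2 * (x - x0) $ i) + s * s" for s
  proof -
    have "(norm ((x - x0) + s *\<^sub>R axis i 1))\<^sup>2 = (norm (x - x0))\<^sup>2 + s * (2 * (x - x0) $ i) + s * s"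
      by (simp only: power2_norm_eq_inner inner_add_left inner_add_right)
        (simp add: inner_axis inner_axis' algebra_simps)
    then show ?thesis by (simp add: algebra_simps)
  qed
  moreover have "jet2 (\<lambda>s. s * s) 0 2"
    using jet2_mult[OF jet2_affine[of 0 1] jet2_affine[of 0 1]] by simp
  ultimately show ?thesis using jet2_add[OF jet2_affine] by fastforce
qed

text \<open>g is a defining function, negative inside, and N its gradient; C bounds |N| from both
  sides as well as all second-order quantities. The smallness 1 / (4 C^3) of g is matched to the
  weight 2 C^3 in \<open>bowl\<close>: together they leave half of the quadratic term
  intact.\<close>

locale boundary_chart =
  fixes \<Omega> :: "(real^'n::finite) set" and p :: "real^'n" and r C :: real
    and g :: "real^'n \<Rightarrow> real" and N :: "real^'n \<Rightarrow> real^'n"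
  assumes r_pos: "0 < r" and C_ge: "1 \<le> C"
    and g_neg: "x \<in> ball p r \<Longrightarrow> x \<in> \<Omega> \<longleftrightarrow> g x < 0"
    and g_zero: "x \<in> ball p r \<Longrightarrow> x \<in> frontier \<Omega> \<longleftrightarrow> g x = 0"
    and g_small: "x \<in> ball p r \<Longrightarrow> \<bar>g x\<bar> \<le> 1 / (4 * C ^ 3)"
    and N_lower: "x \<in> ball p r \<Longrightarrow> 1 / C \<le> norm (N x)"
    and N_upper: "x \<in> ball p r \<Longrightarrow> norm (N x) \<le> C"
    and taylor: "x \<in> ball p r \<Longrightarrow> y \<in> ball p r \<Longrightarrow>
      \<bar>g y - g x - N x \<bullet> (y - x)\<bar> \<le> C * (norm (y - x))\<^sup>2"
    and g_jet: "x \<in> ball p r \<Longrightarrow> \<exists>e. jet2 (\<lambda>s. g (x + s *\<^sub>R axis i 1)) (N x $ i) e \<and> \<bar>e\<bar> \<le> C"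
    and g_deriv: "x \<in> ball p r \<Longrightarrow> (g has_derivative (\<lambda>h. N x \<bullet> h)) (at x)"
    and normal: "x \<in> ball p r \<Longrightarrow> x \<in> frontier \<Omega> \<Longrightarrow> outer_unit_normal \<Omega> x (N x /\<^sub>R norm (N x))"

lemma boundary_chart_exists:
  assumes dom: "smooth_bounded_domain \<Omega>" and p: "p \<in> frontier \<Omega>"
  obtains r C g N where "boundary_chart \<Omega> p r C g N"
proof -
  obtain U g where Ug: "local_defining_function \<Omega> p U g"
    using dom p unfolding smooth_bounded_domain_def by blast
  then have U: "p \<in> U" "open U" "Ck_on 2 U g" and grad: "\<And>x. x \<in> U \<Longrightarrow> gradient g x \<noteq> 0"
    and in_iff: "\<Omega> \<inter> U = {x\<in>U. g x < 0}" and fr_iff: "frontier \<Omega> \<inter> U = {x\<in>U. g x = 0}"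
    unfolding local_defining_function_def smooth_on_def by auto
  obtain r0 C0 where r0: "r0 > 0" "C0 > 0" "ball p r0 \<subseteq> U" and cont: "continuous_on U (gradient g)"
    and der: "\<And>x. x \<in> U \<Longrightarrow> (g has_derivative (\<lambda>h. gradient g x \<bullet> h)) (at x)"
    and bd: "\<And>x. x \<in> ball p r0 \<Longrightarrow> norm (gradient g x) \<le> C0"
    and ty: "\<And>x y. x \<in> ball p r0 \<Longrightarrow> y \<in> ball p r0 \<Longrightarrow>
       \<bar>g y - g x - gradient g x \<bullet> (y - x)\<bar> \<le> C0 * (norm (y - x))\<^sup>2"
    and jt: "\<And>x i. x \<in> U \<Longrightarrow>
       jet2 (\<lambda>s. g (x + s *\<^sub>R axis i 1)) (gradient g x $ i) (partial_deriv i (partial_deriv i g) x)"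
      "\<And>x i. x \<in> ball p r0 \<Longrightarrow> \<bar>partial_deriv i (partial_deriv i g) x\<bar> \<le> C0"
    using Ck2_local_estimates[OF U(2,3,1)] by metis
  define n0 where "n0 = norm (gradient g p)"
  have n0: "0 < n0" using grad[OF U(1)] by (simp add: n0_def)
  \<comment> \<open>The summand 2 / n0 makes 1 / C at most n0 / 2, the lower bound that the norm of
    the gradient keeps near p by continuity.\<close>
  define C where "C = C0 + 2 / n0 + 1"
  have C: "C0 \<le> C" "1 \<le> C" "1 / C \<le> n0 / 2"
  proof -
    have "0 < 2 / n0" using n0 by simp
    then show "C0 \<le> C" "1 \<le> C" using r0 by (auto simp: C_def)
    have "2 / n0 \<le> C" "0 < C" using r0 \<open>0 < 2 / n0\<close> unfolding C_def by linarith+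
    have "1 / C \<le> 1 / (2 / n0)"
      by (rule divide_left_mono[OF \<open>2 / n0 \<le> C\<close> _ mult_pos_pos[OF \<open>0 < C\<close> \<open>0 < 2 / n0\<close>]]) simp
    then show "1 / C \<le> n0 / 2" by simp
  qed
  have gp: "g p = 0" using fr_iff p U(1) by blast
  have "((\<lambda>x. norm (gradient g x)) \<longlongrightarrow> n0) (nhds p)"
    using continuous_on_interior[OF cont, of p] U
    by (auto simp: interior_open continuous_within tendsto_at_iff_tendsto_nhds n0_def intro!: tendsto_norm)
  then have ev1: "\<forall>\<^sub>F x in nhds p. n0 / 2 < norm (gradient g x)" using n0 by (intro order_tendstoD) auto
  have "(g \<longlongrightarrow> 0) (nhds p)"
    using has_derivative_continuous[OF der[OF U(1)]] tendsto_at_iff_tendsto_nhds[of g p] gp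
    by (simp add: continuous_within)
  then have ev2: "\<forall>\<^sub>F x in nhds p. dist (g x) 0 < 1 / (4 * C ^ 3)"
    using C by (intro tendstoD) auto
  from eventually_conj[OF ev1 ev2] obtain r1 where r1: "r1 > 0"
    "\<And>x. dist x p < r1 \<Longrightarrow> n0 / 2 < norm (gradient g x) \<and> dist (g x) 0 < 1 / (4 * C ^ 3)"
    unfolding eventually_nhds_metric by blast
  define r where "r = min r0 r1"
  have sub: "x \<in> ball p r0" "x \<in> U" "dist x p < r1" if "x \<in> ball p r" for x
    using that r0(3) by (auto simp: r_def dist_commute)
  show thesis
  proof (rule that[of r C g "gradient g"], unfold_locales)
    show "0 < r" "1 \<le> C" using r0 r1 C by (auto simp: r_def)
    fix x assume x: "x \<in> ball p r"
    note s = sub[OF x]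
    show "x \<in> \<Omega> \<longleftrightarrow> g x < 0" "x \<in> frontier \<Omega> \<longleftrightarrow> g x = 0"
      using in_iff fr_iff s(2) by blast+
    show "\<bar>g x\<bar> \<le> 1 / (4 * C ^ 3)" "1 / C \<le> norm (gradient g x)" "norm (gradient g x) \<le> C"
      using r1(2)[OF s(3)] C(1,3) bd[OF s(1)] by auto
    show "(g has_derivative (\<lambda>h. gradient g x \<bullet> h)) (at x)" using der[OF s(2)] .
    show "\<exists>e. jet2 (\<lambda>s. g (x + s *\<^sub>R axis i 1)) (gradient g x $ i) e \<and> \<bar>e\<bar> \<le> C" for i
      using jt(1)[OF s(2), of i] order_trans[OF jt(2)[OF s(1), of i] C(1)] by blast
    show "outer_unit_normal \<Omega> x (gradient g x /\<^sub>R norm (gradient g x))" if "x \<in> frontier \<Omega>"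
      using Ug s(2) unfolding outer_unit_normal_def local_defining_function_def by blast
    show "\<bar>g y - g x - gradient g x \<bullet> (y - x)\<bar> \<le> C * (norm (y - x))\<^sup>2" if "y \<in> ball p r" for y
      using ty[OF s(1) sub(1)[OF that]] C(1) by (meson mult_right_mono order_trans zero_le_power2)
  qed
qed

context boundary_chart
begin

lemma closure_cases: "x \<in> closure \<Omega> \<Longrightarrow> x \<in> \<Omega> \<or> x \<in> frontier \<Omega>"
  by (metis DiffI frontier_def interior_subset subsetD)

lemma g_nonpos: "x \<in> ball p r \<Longrightarrow> x \<in> closure \<Omega> \<Longrightarrow> g x \<le> 0"
  using g_neg g_zero closure_cases by (metis less_eq_real_def)

text \<open>A substitute for convexity: since g q = 0 and g x \<le> 0, closure \<Omega> crosses the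
  tangent plane at q by a quadratic amount at most.\<close>

lemma normal_cone:
  assumes "q \<in> ball p r" "q \<in> frontier \<Omega>" "x \<in> ball p r" "x \<in> closure \<Omega>"
  shows "N q \<bullet> (x - q) \<le> C * (norm (x - q))\<^sup>2"
proof -
  have "g q = 0" "g x \<le> 0" using assms g_zero g_nonpos by auto
  then show ?thesis using taylor[OF assms(1,3)] by linarith
qed

lemma N_pos: "x \<in> ball p r \<Longrightarrow> 0 < norm (N x)"
  using N_lower C_ge by (meson less_le_trans zero_less_divide_1_iff zero_less_one)

lemma N_sq: "x \<in> ball p r \<Longrightarrow> 1 \<le> C\<^sup>2 * (norm (N x))\<^sup>2"
proof -
  assume x: "x \<in> ball p r"
  have "1 \<le> C * norm (N x)" using N_lower[OF x] C_ge by (simp add: field_simps)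
  then have "1\<^sup>2 \<le> (C * norm (N x))\<^sup>2" by (intro power_mono) auto
  then show ?thesis by (simp add: power_mult_distrib)
qed

lemma inward_normal:
  assumes q: "q \<in> ball p r" "q \<in> frontier \<Omega>"
  shows "\<forall>\<^sub>F h in at_right 0. q - h *\<^sub>R (N q /\<^sub>R norm (N q)) \<in> closure \<Omega>"
proof -
  define n where "n = N q /\<^sub>R norm (N q)"
  have n1: "norm n = 1" using N_pos[OF q(1)] by (simp add: n_def)
  have Nn: "N q \<bullet> n = norm (N q)"
    using N_pos[OF q(1)] by (simp add: n_def power2_norm_eq_inner[symmetric] power2_eq_square)
  have "((\<lambda>h. q - h *\<^sub>R n) \<longlongrightarrow> q - 0 *\<^sub>R n) (at_right 0)" by (intro tendsto_intros)
  then have "((\<lambda>h. q - h *\<^sub>R n) \<longlongrightarrow> q) (at_right 0)" by simp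
  then have "\<forall>\<^sub>F h in at_right 0. q - h *\<^sub>R n \<in> ball p r"
    using q(1) by (intro topological_tendstoD) auto
  \<comment> \<open>Along the inner normal g falls at rate at least 1 / C while the Taylor error is
    C h^2, so this range of h suffices.\<close>
  moreover have "\<forall>\<^sub>F h in at_right 0. h < 1 / C\<^sup>2"
    by (rule eventually_at_right_real[THEN eventually_mono])
      (use C_ge in auto)
  ultimately show ?thesis unfolding n_def[symmetric] using eventually_at_right_less[of 0]
  proof eventually_elim
    case (elim h)
    have "\<bar>g (q - h *\<^sub>R n) - g q - N q \<bullet> (- (h *\<^sub>R n))\<bar> \<le> C * h\<^sup>2"
      using taylor[OF q(1) elim(1)] n1 by simp
    then have "g (q - h *\<^sub>R n) \<le> - h * norm (N q) + C * h\<^sup>2"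
      using g_zero[OF q(1)] q(2) Nn by simp
    moreover have "- h * norm (N q) \<le> - h * (1 / C)"
      using N_lower[OF q(1)] elim(3) by (intro mult_left_mono_neg) auto
    ultimately have "g (q - h *\<^sub>R n) \<le> h * (C * h - 1 / C)" by (simp add: algebra_simps power2_eq_square)
    moreover have "C * h < 1 / C"
      using elim(2) C_ge by (simp add: field_simps power2_eq_square)
    then have "h * (C * h - 1 / C) < 0" using elim(3) by (intro mult_pos_neg) auto
    ultimately have "q - h *\<^sub>R n \<in> \<Omega>" using g_neg[OF elim(1)] by linarith
    then show ?case using closure_subset by blast
  qed
qed

lemma normal_derivative:
  assumes "q \<in> ball p r" "(\<phi> has_derivative L) (at q)"
  shows "((\<lambda>h. \<phi> (q - h *\<^sub>R n)) has_real_derivative - L n) (at_right 0)"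
proof -
  have l: "linear L" using assms(2) has_derivative_linear by blast
  have "((\<lambda>h. q - h *\<^sub>R n) has_derivative (\<lambda>h. - h *\<^sub>R n)) (at 0)"
    by (auto intro!: derivative_eq_intros)
  from has_derivative_compose[OF this, of \<phi> L] assms(2)
  have "((\<lambda>h. \<phi> (q - h *\<^sub>R n)) has_derivative (\<lambda>h. L (- h *\<^sub>R n))) (at 0)" by simp
  moreover have "(\<lambda>h. L (- h *\<^sub>R n)) = (*) (- L n)"
    by (rule ext) (simp only: linear_cmul[OF l] real_scaleR_def, simp)
  ultimately show ?thesis
    unfolding has_field_derivative_def using has_derivative_at_withinI by metis
qed

text \<open>The second summand makes the outer normal derivative positive on \<open>frontier \<Omega>\<close> although \<open>\<Omega>\<close>
  need not be convex.\<close>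

definition bowl :: "real^'n \<Rightarrow> real \<Rightarrow> real^'n \<Rightarrow> real" where
  "bowl x0 k x = (norm (x - x0))\<^sup>2 + 2 * C ^ 3 * ((norm (x - x0))\<^sup>2 + k) * g x"

lemma bowl_center: "x0 \<in> ball p r \<Longrightarrow> x0 \<in> closure \<Omega> \<Longrightarrow> 0 \<le> k \<Longrightarrow> bowl x0 k x0 \<le> 0"
  using g_nonpos[of x0] C_ge by (simp add: bowl_def mult_nonneg_nonpos)

text \<open>\<open>g_small\<close> limits the second summand to half of |x - x0|^2 + k, which gives
  the lower bound; g \<le> 0 on closure \<Omega> gives the upper one.\<close>

lemma bowl_bounds:
  assumes "x \<in> ball p r" "x \<in> closure \<Omega>" "0 \<le> k"
  shows "(norm (x - x0))\<^sup>2 / 2 - k / 2 \<le> bowl x0 k x" "bowl x0 k x \<le> (norm (x - x0))\<^sup>2"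
proof -
  let ?Q = "(norm (x - x0))\<^sup>2 + k"
  have Q: "0 \<le> ?Q" using assms(3) by simp
  have g: "g x \<le> 0" "- g x \<le> 1 / (4 * C ^ 3)" using g_nonpos g_small assms by force+
  show "bowl x0 k x \<le> (norm (x - x0))\<^sup>2"
    unfolding bowl_def using Q g(1) C_ge by (simp add: mult_nonneg_nonpos)
  have "2 * C ^ 3 * ?Q * - g x \<le> 2 * C ^ 3 * ?Q * (1 / (4 * C ^ 3))"
    using g(2) Q C_ge by (intro mult_left_mono) auto
  also have "\<dots> = ?Q / 2" using C_ge by (simp add: field_simps)
  finally show "(norm (x - x0))\<^sup>2 / 2 - k / 2 \<le> bowl x0 k x" unfolding bowl_def by (simp add: field_simps)
qed

lemma bowl_has_derivative:
  assumes "x \<in> ball p r"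
  shows "(bowl x0 k has_derivative (\<lambda>h. 2 * ((x - x0) \<bullet> h) +
     2 * C ^ 3 * (2 * ((x - x0) \<bullet> h) * g x + ((norm (x - x0))\<^sup>2 + k) * (N x \<bullet> h)))) (at x)"
proof -
  have "((\<lambda>x. (x - x0) \<bullet> (x - x0) + 2 * C ^ 3 * ((x - x0) \<bullet> (x - x0) + k) * g x) has_derivative
     (\<lambda>h. 2 * ((x - x0) \<bullet> h) + 2 * C ^ 3 * (2 * ((x - x0) \<bullet> h) * g x + ((x - x0) \<bullet> (x - x0) + k) * (N x \<bullet> h)))) (at x)"
    by (rule derivative_eq_intros g_deriv assms refl)+ (auto simp: algebra_simps inner_commute)
  then show ?thesis unfolding bowl_def power2_norm_eq_inner by simp
qed

text \<open>On the boundary g = 0, so the derivative of the weight |x - x0|^2 drops out of the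
  second summand. After multiplication by m = |N q|, the first summand contributes at least - 2 C
  \<rho> by \<open>normal_cone\<close>, the second at least 2 C (\<rho> + k) because C^2 m^2 \<ge>
  1; what remains is 2 C k. The offset k keeps this positive even when q = x0.\<close>

lemma bowl_normal_derivative:
  assumes q: "q \<in> ball p r" "q \<in> frontier \<Omega>" and x0: "x0 \<in> ball p r" "x0 \<in> closure \<Omega>" and k: "0 < k"
  obtains D where "0 < D" "((\<lambda>h. bowl x0 k (q - h *\<^sub>R (N q /\<^sub>R norm (N q)))) has_real_derivative - D) (at_right 0)"
proof -
  define n where "n = N q /\<^sub>R norm (N q)"
  define m where "m = norm (N q)"
  define \<rho> where "\<rho> = (norm (q - x0))\<^sup>2"
  define D where "D = 2 * ((q - x0) \<bullet> n) + 2 * C ^ 3 * (2 * ((q - x0) \<bullet> n) * g q + (\<rho> + k) * (N q \<bullet> n))"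
  have m: "0 < m" "1 \<le> C\<^sup>2 * m\<^sup>2" using N_pos N_sq q by (auto simp: m_def)
  have gq: "g q = 0" using g_zero q by blast
  have Nn: "N q \<bullet> n = m" unfolding n_def m_def using m(1)
    by (simp add: power2_norm_eq_inner[symmetric] power2_eq_square m_def)
  have nm: "m * ((q - x0) \<bullet> n) = - (N q \<bullet> (x0 - q))"
    using m(1) by (simp add: n_def m_def inner_diff_right inner_diff_left inner_commute)
  have "m * D = 2 * (m * ((q - x0) \<bullet> n)) + 2 * C * (\<rho> + k) * (C\<^sup>2 * m\<^sup>2)"
    by (simp add: D_def gq Nn algebra_simps power2_eq_square power3_eq_cube)
  also have "\<dots> \<ge> - 2 * (C * \<rho>) + 2 * C * (\<rho> + k) * 1"
  proof (rule add_mono)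
    show "- 2 * (C * \<rho>) \<le> 2 * (m * ((q - x0) \<bullet> n))"
      using normal_cone[OF q x0] by (simp add: nm \<rho>_def norm_minus_commute)
    show "2 * C * (\<rho> + k) * 1 \<le> 2 * C * (\<rho> + k) * (C\<^sup>2 * m\<^sup>2)"
      using m(2) C_ge k by (intro mult_left_mono) (auto simp: \<rho>_def)
  qed
  finally have "2 * C * k \<le> m * D" by (simp add: algebra_simps)
  then have "0 < m * D" using C_ge k by (smt (verit) mult_pos_pos)
  then have "0 < D" using m(1) by (simp add: zero_less_mult_iff)
  moreover have "((\<lambda>h. bowl x0 k (q - h *\<^sub>R n)) has_real_derivative - D) (at_right 0)"
    unfolding D_def \<rho>_def by (rule normal_derivative[OF q(1) bowl_has_derivative[OF q(1)]])
  ultimately show ?thesis using that n_def by blast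
qed

text \<open>Uniformity in the centre and in k is the point: barriers will be centred anywhere in the
  chart, with a k that tends to 0 together with u0 x0 - a.\<close>

lemma bowl_jet:
  obtains M where "0 < M" "\<And>x0 k x i. x0 \<in> ball p r \<Longrightarrow> x \<in> ball p r \<Longrightarrow> 0 \<le> k \<Longrightarrow> k \<le> 1 \<Longrightarrow>
     \<exists>d e. jet2 (\<lambda>s. bowl x0 k (x + s *\<^sub>R axis i 1)) d e \<and> \<bar>d\<bar> \<le> M \<and> \<bar>e\<bar> \<le> M"
proof -
  \<comment> \<open>\<open>M1\<close> and \<open>M2\<close> bound, through the product rule, the
    first and second derivatives of (|x - x0|^2 + k) g, using |x - x0| \<le> 2 r and |g| \<le>
    1.\<close>
  define M1 where "M1 = 4 * r * 1 + (4 * r\<^sup>2 + 1) * C"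
  define M2 where "M2 = 2 * 1 + 2 * (4 * r * C) + (4 * r\<^sup>2 + 1) * C"
  define M where "M = 4 * r + 2 * C ^ 3 * M1 + 2 + 2 * C ^ 3 * M2"
  have nonneg: "0 \<le> M1" "0 \<le> M2" using r_pos C_ge by (auto simp: M1_def M2_def)
  show thesis
  proof (rule that[of M])
    show "0 < M" using nonneg r_pos C_ge by (auto simp: M_def intro!: add_pos_nonneg)
    fix x0 x i and k :: real assume x0: "x0 \<in> ball p r" and x: "x \<in> ball p r" and k: "0 \<le> k" "k \<le> 1"
    define \<rho> where "\<rho> = norm (x - x0)"
    have "\<rho> \<le> 2 * r"
      using dist_triangle[of x x0 p] x0 x unfolding \<rho>_def by (simp add: dist_norm norm_minus_commute)
    then have \<rho>: "0 \<le> \<rho>" "\<rho>\<^sup>2 \<le> 4 * r\<^sup>2"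
      using power_mono[of \<rho> "2 * r" 2] by (auto simp: \<rho>_def)
    have y: "\<bar>(x - x0) $ i\<bar> \<le> 2 * r"
      using component_le_norm_cart[of "x - x0" i] \<open>\<rho> \<le> 2 * r\<close> by (simp add: \<rho>_def)
    have "1 \<le> 4 * C ^ 3" using one_le_power[OF C_ge, of 3] by linarith
    then have "1 / (4 * C ^ 3) \<le> 1" using C_ge by (simp add: divide_le_eq)
    then have g: "\<bar>g x\<bar> \<le> 1" using g_small[OF x] by linarith
    have Ni: "\<bar>N x $ i\<bar> \<le> C" using component_le_norm_cart[of "N x" i] N_upper[OF x] by linarith
    obtain e where e: "jet2 (\<lambda>s. g (x + s *\<^sub>R axis i 1)) (N x $ i) e" "\<bar>e\<bar> \<le> C" using g_jet[OF x] by blast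
    have Q: "jet2 (\<lambda>s. (norm (x + s *\<^sub>R axis i 1 - x0))\<^sup>2 + k) (2 * (x - x0) $ i) 2"
      using jet2_add[OF jet2_norm_sq jet2_const[of k]] by simp
    define d' where "d' = 2 * (x - x0) $ i * g x + (\<rho>\<^sup>2 + k) * N x $ i"
    define e' where "e' = 2 * g x + 2 * (2 * (x - x0) $ i * N x $ i) + (\<rho>\<^sup>2 + k) * e"
    have "jet2 (\<lambda>s. ((norm (x + s *\<^sub>R axis i 1 - x0))\<^sup>2 + k) * g (x + s *\<^sub>R axis i 1)) d' e'"
      by (rule jet2_cong[OF jet2_mult[OF Q e(1)]]) (simp_all add: d'_def e'_def \<rho>_def)
    from jet2_add[OF jet2_norm_sq jet2_cmult[OF this, of "2 * C ^ 3"]]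
    have J: "jet2 (\<lambda>s. bowl x0 k (x + s *\<^sub>R axis i 1)) (2 * (x - x0) $ i + 2 * C ^ 3 * d') (2 + 2 * C ^ 3 * e')"
      unfolding bowl_def by (simp only: mult.assoc)
    have Qb: "\<bar>\<rho>\<^sup>2 + k\<bar> \<le> 4 * r\<^sup>2 + 1" using \<rho> k by auto
    have y2: "\<bar>2 * (x - x0) $ i\<bar> \<le> 4 * r" using y by simp
    have a1: "\<bar>2 * (x - x0) $ i * g x\<bar> \<le> 4 * r * 1"
      unfolding abs_mult[of "2 * (x - x0) $ i"] using r_pos by (intro mult_mono[OF y2 g]) auto
    have a2: "\<bar>(\<rho>\<^sup>2 + k) * N x $ i\<bar> \<le> (4 * r\<^sup>2 + 1) * C"
      unfolding abs_mult using Qb Ni by (intro mult_mono) auto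
    have a3: "\<bar>(\<rho>\<^sup>2 + k) * e\<bar> \<le> (4 * r\<^sup>2 + 1) * C"
      unfolding abs_mult using Qb e by (intro mult_mono) auto
    have a4: "\<bar>2 * (x - x0) $ i * N x $ i\<bar> \<le> 4 * r * C"
      unfolding abs_mult[of "2 * (x - x0) $ i"] using r_pos by (intro mult_mono[OF y2 Ni]) auto
    have "\<bar>d'\<bar> \<le> M1" using a1 a2 unfolding d'_def M1_def by linarith
    then have "\<bar>2 * C ^ 3 * d'\<bar> \<le> 2 * C ^ 3 * M1" unfolding abs_mult using C_ge by (intro mult_mono) auto
    moreover have "\<bar>e'\<bar> \<le> M2" using a3 a4 g unfolding e'_def M2_def by linarith
    then have "\<bar>2 * C ^ 3 * e'\<bar> \<le> 2 * C ^ 3 * M2" unfolding abs_mult using C_ge by (intro mult_mono) auto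
    moreover have "0 \<le> 2 * C ^ 3 * M1" "0 \<le> 2 * C ^ 3 * M2" using nonneg C_ge by auto
    ultimately have "\<bar>2 * (x - x0) $ i + 2 * C ^ 3 * d'\<bar> \<le> M" "\<bar>2 + 2 * C ^ 3 * e'\<bar> \<le> M"
      using y r_pos unfolding M_def by linarith+
    then show "\<exists>d e. jet2 (\<lambda>s. bowl x0 k (x + s *\<^sub>R axis i 1)) d e \<and> \<bar>d\<bar> \<le> M \<and> \<bar>e\<bar> \<le> M"
      using J by blast
  qed
qed

end

section \<open>Spatially constant subsolutions\<close>

lemma nonneg_at_right_end:
  fixes w :: "real \<Rightarrow> real"
  assumes "continuous_on {0..t} w" "0 < t" "\<And>s. 0 \<le> s \<Longrightarrow> s < t \<Longrightarrow> 0 \<le> w s"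
  shows "0 \<le> w t"
proof -
  have "closure {0..<t} = {0..t}" using assms(2) by simp
  then show ?thesis
    using continuous_ge_on_closure[of "{0..<t}" w t 0] assms by simp
qed

text \<open>A function of time alone has zero normal derivative, so contact at a boundary point p is
  not excluded directly. There the slack \<sigma> pays for a bump: a second comparison, near p, with
  \<psi> + \<delta> (R^2 / 8 - bowl p k) puts u strictly above \<psi> at p. The tolerance \<tau>
  covers the values that the bump adds to \<psi>.\<close>

lemma above_spatially_constant:
  fixes u :: "real^'n::finite \<Rightarrow> real \<Rightarrow> real"
  assumes dom: "smooth_bounded_domain \<Omega>"
    and sol: "reaction_solution \<Omega> F u"
    and \<psi>: "\<And>t. 0 < t \<Longrightarrow> t \<le> T \<Longrightarrow> (\<psi> has_real_derivative \<psi>' t) (at t)"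
    and cont: "continuous_on {0..T} \<psi>"
    and strict: "0 < \<sigma>" "0 < \<tau>"
      "\<And>t y. 0 < t \<Longrightarrow> t \<le> T \<Longrightarrow> \<bar>y - \<psi> t\<bar> \<le> \<tau> \<Longrightarrow> \<psi>' t + \<sigma> \<le> F t y"
    and initial: "\<And>x. x \<in> closure \<Omega> \<Longrightarrow> \<psi> 0 < u x 0"
    and x: "x \<in> closure \<Omega>" and t: "0 \<le> t" "t \<le> T"
  shows "\<psi> t < u x t"
proof -
  have op: "open \<Omega>" and bd: "bounded \<Omega>" and ne: "\<Omega> \<noteq> {}" using dom by (auto simp: smooth_bounded_domain_def)
  have comp: "compact (closure \<Omega>)" using bd by (simp add: compact_closure)
  define A where "A = closure \<Omega> \<times> {0..T}"
  have contu: "continuous_on (closure \<Omega> \<times> {0..}) (\<lambda>(x, t). u x t)"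
    using sol by (simp add: reaction_solution_def)
  show ?thesis
  proof (rule reaction_solution_comparison[OF sol op, of A "\<lambda>x t. \<psi> t"])
    show "compact A" "A \<subseteq> closure \<Omega> \<times> {0..}" "(x, t) \<in> A"
      using comp x t by (auto simp: A_def intro: compact_Times)
    show "continuous_on A (\<lambda>(x, t). \<psi> t)"
      unfolding A_def case_prod_unfold
      by (rule continuous_on_compose2[OF cont continuous_on_snd[OF continuous_on_id]]) auto
    show "\<psi> 0 < u x 0" if "(x, 0) \<in> A" for x using initial that by (auto simp: A_def)
    show "\<exists>\<delta>>0. \<forall>y\<in>closure \<Omega>. \<forall>s. dist y x < \<delta> \<longrightarrow> t - \<delta> < s \<longrightarrow> s \<le> t \<longrightarrow> (y, s) \<in> A"
      if "(x, t) \<in> A" "0 < t" for x t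
      using that by (intro exI[of _ t]) (auto simp: A_def)
    show "\<exists>d e \<omega>t. (\<forall>i::'n. jet2 (\<lambda>s. \<psi> t) (d i) (e i)) \<and>
          (\<psi> has_real_derivative \<omega>t) (at t) \<and> \<omega>t < (\<Sum>i\<in>UNIV. e i) + F t (u x t)"
      if "(x, t) \<in> A" "x \<in> \<Omega>" "0 < t" "\<psi> t = u x t" for x and t :: real
    proof (intro exI conjI allI)
      have tT: "t \<le> T" using that by (simp add: A_def)
      show "jet2 (\<lambda>s. \<psi> t) 0 0" by (rule jet2_const)
      show "(\<psi> has_real_derivative \<psi>' t) (at t)" using \<psi> that(3) tT by blast
      show "\<psi>' t < (\<Sum>i\<in>(UNIV::'n set). 0) + F t (u x t)"
        using strict(3)[OF that(3) tT, of "u x t"] that(4) strict(1,2) by simp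
    qed
  next
    fix p and t :: real
    assume pA: "(p, t) \<in> A" and p: "p \<in> frontier \<Omega>" and t: "0 < t" and touch: "\<psi> t = u p t"
      and before: "\<And>y s. (y, s) \<in> A \<Longrightarrow> s < t \<Longrightarrow> \<psi> s < u y s"
    have tT: "t \<le> T" using pA by (simp add: A_def)
    have le: "\<psi> t \<le> u y t" if y: "y \<in> closure \<Omega>" for y
    proof -
      have "continuous_on {0..t} (\<lambda>s. (\<lambda>(x, t). u x t) (y, s) - \<psi> s)"
        using y tT
        by (intro continuous_on_diff continuous_on_compose2[OF contu] continuous_on_subset[OF cont] continuous_intros) auto
      then have "continuous_on {0..t} (\<lambda>s. u y s - \<psi> s)" by simp
      moreover have "0 \<le> u y s - \<psi> s" if "0 \<le> s" "s < t" for s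
        using before[of y s] y that tT by (simp add: A_def)
      ultimately have "0 \<le> u y t - \<psi> t" using nonneg_at_right_end[of t "\<lambda>s. u y s - \<psi> s"] t by blast
      then show ?thesis by simp
    qed
    obtain r C g N where "boundary_chart \<Omega> p r C g N" using boundary_chart_exists[OF dom p] .
    then interpret boundary_chart \<Omega> p r C g N .
    obtain M where M: "0 < M" "\<And>x0 k x i. x0 \<in> ball p r \<Longrightarrow> x \<in> ball p r \<Longrightarrow> 0 \<le> k \<Longrightarrow> k \<le> 1 \<Longrightarrow>
     \<exists>d e. jet2 (\<lambda>s. bowl x0 k (x + s *\<^sub>R axis i 1)) d e \<and> \<bar>d\<bar> \<le> M \<and> \<bar>e\<bar> \<le> M"
      using bowl_jet by blast
    define R where "R = min (r / 2) 1"
    have R: "0 < R" "R < r" "R \<le> 1" "R\<^sup>2 \<le> 1" using r_pos by (auto simp: R_def power_le_one)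
    \<comment> \<open>On the sphere of radius R, \<open>bowl\<close> is then at least R^2 / 2 - R^2
      / 4, so the bump is negative there, while it is positive at p.\<close>
    define k where "k = R\<^sup>2 / 2"
    have k: "0 < k" "k \<le> 1" "k / 2 = R\<^sup>2 / 4" using R by (auto simp: k_def)
    have pr: "p \<in> ball p r" using r_pos by simp
    have pcl: "p \<in> closure \<Omega>" using p by (simp add: frontier_def)
    obtain x1 where x1: "x1 \<in> closure \<Omega>" "\<And>y. y \<in> closure \<Omega> \<Longrightarrow> u x1 0 \<le> u y 0"
    proof -
      have "continuous_on (closure \<Omega>) (\<lambda>y. (\<lambda>(x, t). u x t) (y, 0))"
        by (intro continuous_on_compose2[OF contu] continuous_intros) auto
      from continuous_attains_inf[OF comp _ this] ne
      have "\<exists>x\<in>closure \<Omega>. \<forall>y\<in>closure \<Omega>. u x 0 \<le> u y 0" by simp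
      then show ?thesis using that by blast
    qed
    define m where "m = u x1 0 - \<psi> 0"
    have m: "0 < m" using initial[OF x1(1)] by (simp add: m_def)
    define n where "n = real CARD('n)"
    have n: "0 < n" by (simp add: n_def)
    \<comment> \<open>The bump is at most 2 \<delta> in size. The three entries keep it within
      \<tau>, below the initial gap m, and keep the loss in the Laplacian, at most n \<delta> M,
      below \<sigma>.\<close>
    define \<delta> where "\<delta> = min (\<tau> / 2) (min (m / 3) (\<sigma> / (2 * n * M)))"
    have \<delta>: "0 < \<delta>" "\<delta> * 2 \<le> \<tau>" "\<delta> * 2 < m" "n * (\<delta> * M) < \<sigma>"
    proof -
      have q: "0 < \<sigma> / (2 * n * M)" using strict n M(1) by simp
      show "0 < \<delta>" "\<delta> * 2 \<le> \<tau>" "\<delta> * 2 < m" using strict m q by (auto simp: \<delta>_def min_def)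
      have "\<delta> * (n * M) \<le> \<sigma> / (2 * n * M) * (n * M)"
        using n M(1) by (intro mult_right_mono) (auto simp: \<delta>_def)
      also have "\<dots> = \<sigma> / 2" using n M(1) by simp
      finally show "n * (\<delta> * M) < \<sigma>" using strict(1) by (simp add: mult_ac)
    qed
    define \<omega> where "\<omega> = (\<lambda>y s. \<psi> s + \<delta> * (R\<^sup>2 / 8 - bowl p k y))"
    define B where "B = (closure \<Omega> \<inter> cball p R) \<times> {0..t}"
    have inr: "y \<in> ball p r" if "y \<in> cball p R" for y using that R by auto
    have small: "\<bar>R\<^sup>2 / 8 - bowl p k y\<bar> \<le> 2" if y: "y \<in> closure \<Omega> \<inter> cball p R" for y
    proof -
      have "(norm (y - p))\<^sup>2 \<le> 1"
        using y R by (intro power_le_one) (auto simp: dist_norm norm_minus_commute)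
      moreover have "0 \<le> (norm (y - p))\<^sup>2" "0 \<le> R\<^sup>2" by auto
      ultimately show ?thesis using bowl_bounds[of y k p] inr[of y] y k R by (auto simp: abs_le_iff)
    qed
    have \<delta>small: "\<bar>\<delta> * (R\<^sup>2 / 8 - bowl p k y)\<bar> \<le> \<delta> * 2" if "y \<in> closure \<Omega> \<inter> cball p R" for y
      unfolding abs_mult using small[OF that] \<delta>(1) by (intro mult_mono) auto
    have "\<omega> p t < u p t"
    proof (rule reaction_solution_comparison[OF sol op, of B \<omega>])
      show "compact B" unfolding B_def using comp by (intro compact_Times compact_Int) auto
      show "B \<subseteq> closure \<Omega> \<times> {0..}" by (auto simp: B_def)
      show "(p, t) \<in> B" using pcl R t by (auto simp: B_def)
      have "continuous_on (closure \<Omega> \<inter> cball p R) (bowl p k)"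
        using has_derivative_continuous[OF bowl_has_derivative[OF inr]]
        by (intro continuous_at_imp_continuous_on) auto
      then show "continuous_on B (\<lambda>(x, t). \<omega> x t)"
        unfolding B_def \<omega>_def case_prod_unfold using tT
        by (intro continuous_intros continuous_on_compose2[OF cont continuous_on_snd[OF continuous_on_id]]
            continuous_on_compose2[of _ "bowl p k" _ fst]) auto
      show "\<omega> y 0 < u y 0" if "(y, 0) \<in> B" for y
        using \<delta>small[of y] \<delta>(3) x1(2)[of y] that by (auto simp: B_def \<omega>_def m_def)
    next
      fix y s assume y: "(y, s) \<in> B" and s: "0 < s" and above: "u y s \<le> \<omega> y s"
      \<comment> \<open>No contact on the sphere, where \<omega> < \<psi> \<le> u; for s = t the
        second inequality is \<open>le\<close>, before that it is the absence of earlier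
        contact.\<close>
      have "dist p y \<noteq> R"
      proof
        assume "dist p y = R"
        then have "R\<^sup>2 / 4 \<le> bowl p k y"
          using bowl_bounds(1)[of y k p] inr[of y] y k by (auto simp: B_def dist_norm norm_minus_commute)
        then have "R\<^sup>2 / 8 - bowl p k y < 0" using zero_less_power[OF R(1), of 2] by linarith
        then have "\<omega> y s < \<psi> s" using \<delta>(1) by (simp add: \<omega>_def mult_pos_neg)
        moreover have "\<psi> s \<le> u y s"
        proof (cases "s = t")
          case True
          then show ?thesis using le y by (auto simp: B_def)
        next
          case False
          then have "\<psi> s < u y s" using y tT by (intro before) (auto simp: A_def B_def)
          then show ?thesis by simp
        qed
        ultimately show False using above by simp
      qed
      then have yR: "dist p y < R" using y by (auto simp: B_def)
      have "z \<in> cball p R" if "dist z y < R - dist p y" for z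
        using dist_triangle[of p z y] that by (auto simp: dist_commute)
      then show "\<exists>\<delta>>0. \<forall>z\<in>closure \<Omega>. \<forall>s'. dist z y < \<delta> \<longrightarrow> s - \<delta> < s' \<longrightarrow> s' \<le> s \<longrightarrow> (z, s') \<in> B"
        using yR s y by (intro exI[of _ "min s (R - dist p y)"]) (auto simp: B_def)
    next
      fix y s assume y: "(y, s) \<in> B" and y\<Omega>: "y \<in> \<Omega>" and s: "0 < s" and eq: "\<omega> y s = u y s"
      have yc: "y \<in> closure \<Omega> \<inter> cball p R" "y \<in> ball p r" "s \<le> T" using y inr tT by (auto simp: B_def)
      have "\<forall>i. \<exists>d e. jet2 (\<lambda>s. bowl p k (y + s *\<^sub>R axis i 1)) d e \<and> \<bar>d\<bar> \<le> M \<and> \<bar>e\<bar> \<le> M"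
        using M(2)[OF pr yc(2)] k by auto
      then obtain d e where de: "\<And>i. jet2 (\<lambda>s. bowl p k (y + s *\<^sub>R axis i 1)) (d i) (e i)"
        "\<And>i. \<bar>e i\<bar> \<le> M" by metis
      show "\<exists>d e \<omega>t. axis_jets (\<lambda>z. \<omega> z s) y d e \<and>
          (\<omega> y has_real_derivative \<omega>t) (at s) \<and> \<omega>t < (\<Sum>i\<in>UNIV. e i) + F s (u y s)"
      proof (intro exI conjI allI)
        show "jet2 (\<lambda>h. \<omega> (y + h *\<^sub>R axis i 1) s) (0 + \<delta> * (0 - d i)) (0 + \<delta> * (0 - e i))" for i
          unfolding \<omega>_def by (intro jet2_add jet2_const jet2_cmult jet2_diff de)
        show "(\<omega> y has_real_derivative \<psi>' s + 0) (at s)"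
          unfolding \<omega>_def by (intro DERIV_add DERIV_const \<psi> s yc)
        have "(\<Sum>i\<in>(UNIV::'n set). 0 + \<delta> * (0 - e i)) \<ge> (\<Sum>i\<in>(UNIV::'n set). - (\<delta> * M))"
        proof (rule sum_mono)
          fix i show "- (\<delta> * M) \<le> 0 + \<delta> * (0 - e i)"
            using de(2)[of i] \<delta>(1) by (simp add: abs_le_iff)
        qed
        then have "- (n * (\<delta> * M)) \<le> (\<Sum>i\<in>(UNIV::'n set). 0 + \<delta> * (0 - e i))" by (simp add: n_def)
        moreover have "\<psi>' s + \<sigma> \<le> F s (u y s)"
          using \<delta>small[OF yc(1)] \<delta>(2) eq by (intro strict(3) s yc) (auto simp: \<omega>_def)
        ultimately show "\<psi>' s + 0 < (\<Sum>i\<in>(UNIV::'n set). 0 + \<delta> * (0 - e i)) + F s (u y s)"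
          using \<delta>(4) by linarith
      qed
    next
      fix y s assume y: "(y, s) \<in> B" and yf: "y \<in> frontier \<Omega>"
      have yr: "y \<in> ball p r" using y inr by (auto simp: B_def)
      let ?n = "N y /\<^sub>R norm (N y)"
      obtain D where D: "0 < D" "((\<lambda>h. bowl p k (y - h *\<^sub>R ?n)) has_real_derivative - D) (at_right 0)"
        using bowl_normal_derivative[OF yr yf pr pcl k(1)] .
      show "inward_increasing \<Omega> (\<lambda>z. \<omega> z s) y"
      proof (intro exI conjI)
        show "outer_unit_normal \<Omega> y ?n" using normal[OF yr yf] .
        show "0 < \<delta> * D" using \<delta>(1) D(1) by simp
        show "((\<lambda>h. \<omega> (y - h *\<^sub>R ?n) s) has_real_derivative \<delta> * D) (at_right 0)"
          unfolding \<omega>_def by (rule derivative_eq_intros D(2) refl)+ simp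
        show "\<forall>\<^sub>F h in at_right 0. y - h *\<^sub>R ?n \<in> closure \<Omega>" using inward_normal[OF yr yf] .
      qed
    qed
    moreover have "\<psi> t < \<omega> p t"
    proof -
      have "0 < R\<^sup>2 / 8 - bowl p k p" using bowl_center[OF pr pcl, of k] k(1) zero_less_power[OF R(1), of 2]
        by linarith
      then show ?thesis using \<delta>(1) by (simp add: \<omega>_def)
    qed
    \<comment> \<open>A constant cannot increase inwards; the case is closed because \<psi> t <
      \<omega> p t < u p t contradicts the contact at p.\<close>
    ultimately show "inward_increasing \<Omega> (\<lambda>z. \<psi> t) p"
      using touch by simp
  qed
qed

section \<open>Barriers at a point\<close>

lemma positive_along_segment:
  fixes w :: "'a::real_normed_vector \<Rightarrow> real"
  assumes "continuous_on (closed_segment x y) w" "\<And>z. z \<in> closed_segment x y \<Longrightarrow> w z \<noteq> 0" "0 < w x"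
  shows "0 < w y"
proof (rule ccontr)
  assume "\<not> 0 < w y"
  then have "w y \<le> 0" "0 \<le> w x" using assms(3) by auto
  moreover have "connected (w ` closed_segment x y)"
    using assms(1) by (intro connected_continuous_image) auto
  ultimately have "0 \<in> w ` closed_segment x y"
    using connectedD_interval[of "w ` closed_segment x y" "w y" "w x" 0] by auto
  then show False using assms(2) by force
qed

text \<open>Cuts a chart down to the ball on which further local information about u0, such as the
  sign of u0 - a, is valid.\<close>

lemma boundary_chart_shrink:
  assumes "boundary_chart \<Omega> p r C g N" "0 < r'" "r' \<le> r"
  shows "boundary_chart \<Omega> p r' C g N"
proof -
  interpret boundary_chart \<Omega> p r C g N by fact
  have sub: "x \<in> ball p r" if "x \<in> ball p r'" for x using that assms(3) by auto
  show ?thesis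
  proof
    fix x y i assume x: "x \<in> ball p r'"
    note xr = sub[OF x]
    show "x \<in> \<Omega> \<longleftrightarrow> g x < 0" "x \<in> frontier \<Omega> \<longleftrightarrow> g x = 0" "\<bar>g x\<bar> \<le> 1 / (4 * C ^ 3)"
      "1 / C \<le> norm (N x)" "norm (N x) \<le> C" "(g has_derivative (\<lambda>h. N x \<bullet> h)) (at x)"
      "\<exists>e. jet2 (\<lambda>s. g (x + s *\<^sub>R axis i 1)) (N x $ i) e \<and> \<bar>e\<bar> \<le> C"
      using g_neg[OF xr] g_zero[OF xr] g_small[OF xr] N_lower[OF xr] N_upper[OF xr] g_deriv[OF xr] g_jet[OF xr]
      by blast+
    show "\<bar>g y - g x - N x \<bullet> (y - x)\<bar> \<le> C * (norm (y - x))\<^sup>2" if "y \<in> ball p r'"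
      using taylor[OF xr sub[OF that]] .
    show "outer_unit_normal \<Omega> x (N x /\<^sub>R norm (N x))" if "x \<in> frontier \<Omega>"
      using normal[OF xr that] .
  qed (use assms(2) C_ge in auto)
qed

text \<open>The value - K on the sphere, where - K will be a lower bound of u, keeps the region of
  comparison away from the edge of the ball. The share 1 / M of u0 x0 - a at the centre is what the
  dynamics amplify. M also bounds the squared gradient from above and the Laplacian from below, the
  two ways in which \<phi> enters the subsolution inequality. R and \<phi> may vary with x0; M is a
  parameter because one value has to serve all x0.\<close>

definition lower_barrier ::
    "(real^'n::finite) set \<Rightarrow> (real^'n \<Rightarrow> real) \<Rightarrow> real \<Rightarrow> real \<Rightarrow> real \<Rightarrow> real^'n \<Rightarrow> bool" where
  "lower_barrier \<Omega> u0 a K M x0 \<longleftrightarrow> (\<exists>R>0. \<exists>\<phi>.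
     continuous_on (closure \<Omega> \<inter> cball x0 R) \<phi> \<and>
     (\<forall>x\<in>closure \<Omega> \<inter> cball x0 R. \<phi> x \<le> u0 x) \<and>
     (\<forall>x\<in>closure \<Omega>. dist x0 x = R \<longrightarrow> \<phi> x \<le> - K) \<and>
     a + (u0 x0 - a) / M \<le> \<phi> x0 \<and>
     (\<forall>x\<in>\<Omega> \<inter> ball x0 R. \<exists>d e. axis_jets \<phi> x d e \<and>
        (\<Sum>i\<in>UNIV. (d i)\<^sup>2) \<le> M \<and> - M \<le> (\<Sum>i\<in>UNIV. e i)) \<and>
     (\<forall>x\<in>frontier \<Omega> \<inter> ball x0 R. inward_increasing \<Omega> \<phi> x))"

lemma lower_barrier_mono:
  assumes "lower_barrier \<Omega> u0 a K M x0" "0 < M" "M \<le> M'" "a < u0 x0"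
  shows "lower_barrier \<Omega> u0 a K M' x0"
proof -
  have "(u0 x0 - a) / M' \<le> (u0 x0 - a) / M"
    using assms by (intro divide_left_mono) auto
  moreover obtain R \<phi> where "0 < R" and 1: "continuous_on (closure \<Omega> \<inter> cball x0 R) \<phi>"
    "\<forall>x\<in>closure \<Omega> \<inter> cball x0 R. \<phi> x \<le> u0 x"
    "\<forall>x\<in>closure \<Omega>. dist x0 x = R \<longrightarrow> \<phi> x \<le> - K"
    and 2: "a + (u0 x0 - a) / M \<le> \<phi> x0"
    and 3: "\<And>x. x \<in> \<Omega> \<inter> ball x0 R \<Longrightarrow> \<exists>d e. axis_jets \<phi> x d e \<and>
        (\<Sum>i\<in>UNIV. (d i)\<^sup>2) \<le> M \<and> - M \<le> (\<Sum>i\<in>UNIV. e i)"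
    and 4: "\<forall>x\<in>frontier \<Omega> \<inter> ball x0 R. inward_increasing \<Omega> \<phi> x"
    using assms(1) unfolding lower_barrier_def by (elim exE conjE) blast
  moreover have "\<exists>d e. axis_jets \<phi> x d e \<and>
        (\<Sum>i\<in>UNIV. (d i)\<^sup>2) \<le> M' \<and> - M' \<le> (\<Sum>i\<in>UNIV. e i)"
    if x: "x \<in> \<Omega> \<inter> ball x0 R" for x
  proof -
    obtain d e where "\<forall>i. jet2 (\<lambda>s. \<phi> (x + s *\<^sub>R axis i 1)) (d i) (e i)"
        "(\<Sum>i\<in>UNIV. (d i)\<^sup>2) \<le> M" "- M \<le> (\<Sum>i\<in>UNIV. e i)"
      using 3[OF x] by blast
    moreover from this have "(\<Sum>i\<in>UNIV. (d i)\<^sup>2) \<le> M'" "- M' \<le> (\<Sum>i\<in>UNIV. e i)"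
      using assms(3) by linarith+
    ultimately show ?thesis by blast
  qed
  ultimately show ?thesis
    unfolding lower_barrier_def by (intro exI[of _ R] exI[of _ \<phi>] conjI 1 4) auto
qed

lemma sum_square_bounds:
  fixes d e :: "'n::finite \<Rightarrow> real"
  assumes "\<And>i. \<bar>d i\<bar> \<le> B" "\<And>i. \<bar>e i\<bar> \<le> B" "0 \<le> B"
  shows "(\<Sum>i\<in>UNIV. (d i)\<^sup>2) \<le> real CARD('n) * (B\<^sup>2 + B)" "- (real CARD('n) * (B\<^sup>2 + B)) \<le> (\<Sum>i\<in>UNIV. e i)"
proof -
  have "(\<Sum>i\<in>UNIV. (d i)\<^sup>2) \<le> (\<Sum>i\<in>(UNIV::'n set). B\<^sup>2 + B)"
  proof (rule sum_mono)
    fix i show "(d i)\<^sup>2 \<le> B\<^sup>2 + B" using power_mono[OF assms(1), of i 2] assms(3) by simp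
  qed
  then show "(\<Sum>i\<in>UNIV. (d i)\<^sup>2) \<le> real CARD('n) * (B\<^sup>2 + B)" by simp
  have "(\<Sum>i\<in>(UNIV::'n set). - (B\<^sup>2 + B)) \<le> (\<Sum>i\<in>UNIV. e i)"
  proof (rule sum_mono)
    fix i show "- (B\<^sup>2 + B) \<le> e i" using assms(2)[of i] zero_le_power2[of B] by linarith
  qed
  then show "- (real CARD('n) * (B\<^sup>2 + B)) \<le> (\<Sum>i\<in>UNIV. e i)" by (simp add: algebra_simps)
qed

text \<open>The tangent plane minus a steep paraboloid: A \<ge> L keeps it below u0 by the quadratic
  expansion, and A R^2 \<ge> |K| + |H| + L R brings it below - K on the sphere. R = r / 4 keeps the
  ball around each x0 in ball p (r / 2) inside ball p r, hence off the boundary.\<close>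

lemma lower_barrier_interior:
  fixes u0 :: "real^'n::finite \<Rightarrow> real"
  assumes op: "open \<Omega>" and r: "0 < r" "ball p r \<subseteq> \<Omega>" and L: "0 \<le> L"
    and v: "\<And>x. x \<in> ball p r \<Longrightarrow> norm (v x) \<le> L"
    and taylor: "\<And>x y. x \<in> ball p r \<Longrightarrow> y \<in> ball p r \<Longrightarrow>
       \<bar>u0 y - u0 x - v x \<bullet> (y - x)\<bar> \<le> L * (norm (y - x))\<^sup>2"
    and H: "\<And>x. x \<in> ball p r \<Longrightarrow> u0 x \<le> H"
  obtains M where "0 < M" "\<And>x. x \<in> ball p (r / 2) \<Longrightarrow> a < u0 x \<Longrightarrow> lower_barrier \<Omega> u0 a K M x"
proof -
  define R where "R = r / 4"
  have R: "0 < R" using r by (simp add: R_def)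
  define A where "A = L + (\<bar>K\<bar> + \<bar>H\<bar> + L * R) / R\<^sup>2"
  have A: "L \<le> A" "0 \<le> A" "\<bar>K\<bar> + \<bar>H\<bar> + L * R \<le> A * R\<^sup>2"
  proof -
    have q: "0 \<le> (\<bar>K\<bar> + \<bar>H\<bar> + L * R) / R\<^sup>2" using L R by simp
    then show "L \<le> A" "0 \<le> A" using L by (auto simp: A_def)
    have "A * R\<^sup>2 = L * R\<^sup>2 + (\<bar>K\<bar> + \<bar>H\<bar> + L * R)" using R by (simp add: A_def field_simps)
    then show "\<bar>K\<bar> + \<bar>H\<bar> + L * R \<le> A * R\<^sup>2" using L by simp
  qed
  define B where "B = L + A * (2 * R) + A * 2"
  have B: "0 \<le> B" using L A R by (simp add: B_def)
  define M where "M = 1 + real CARD('n) * (B\<^sup>2 + B)"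
  have M: "1 \<le> M" using B by (simp add: M_def)
  show thesis
  proof (rule that[of M])
    show "0 < M" using M by simp
    fix x0 assume x0: "x0 \<in> ball p (r / 2)" and pos: "a < u0 x0"
    define \<phi> where "\<phi> x = u0 x0 + v x0 \<bullet> (x - x0) - A * (norm (x - x0))\<^sup>2" for x
    have x0r: "x0 \<in> ball p r" using x0 r by auto
    have sub: "x \<in> ball p r" if "x \<in> cball x0 R" for x
      using that x0 r dist_triangle[of p x x0] by (auto simp: R_def)
    show "lower_barrier \<Omega> u0 a K M x0"
      unfolding lower_barrier_def
    proof (intro exI[of _ R] exI[of _ \<phi>] conjI ballI impI)
      show "0 < R" by (rule R)
      show "continuous_on (closure \<Omega> \<inter> cball x0 R) \<phi>"
        unfolding \<phi>_def by (intro continuous_intros)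
      show "\<phi> x \<le> u0 x" if "x \<in> closure \<Omega> \<inter> cball x0 R" for x
      proof -
        have "L * (norm (x - x0))\<^sup>2 \<le> A * (norm (x - x0))\<^sup>2" using A(1) by (intro mult_right_mono) auto
        then show ?thesis using taylor[OF x0r sub[of x]] that by (simp add: \<phi>_def)
      qed
      show "\<phi> x \<le> - K" if "dist x0 x = R" for x
      proof -
        have n: "norm (x - x0) = R" using that by (simp add: dist_norm norm_minus_commute)
        have "v x0 \<bullet> (x - x0) \<le> norm (v x0) * norm (x - x0)" by (rule norm_cauchy_schwarz)
        also have "\<dots> \<le> L * R" using v[OF x0r] R n L by (intro mult_mono) auto
        finally show ?thesis using H[OF x0r] A(3) n by (simp add: \<phi>_def)
      qed
      have "(u0 x0 - a) / M \<le> u0 x0 - a" using M pos by (simp add: divide_le_eq)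
      then show "a + (u0 x0 - a) / M \<le> \<phi> x0" by (simp add: \<phi>_def)
    next
      fix x assume x: "x \<in> \<Omega> \<inter> ball x0 R"
      define d where "d i = v x0 $ i - A * (2 * (x - x0) $ i)" for i
      have jet: "jet2 (\<lambda>s. \<phi> (x + s *\<^sub>R axis i 1)) (d i) (- (A * 2))" for i
      proof -
        have "jet2 (\<lambda>s. (u0 x0 + v x0 \<bullet> (x - x0)) + s * v x0 $ i - A * (norm (x + s *\<^sub>R axis i 1 - x0))\<^sup>2)
            (v x0 $ i - A * (2 * (x - x0) $ i)) (0 - A * 2)"
          by (intro jet2_diff jet2_affine jet2_cmult jet2_norm_sq) 
        then show ?thesis
          by (rule jet2_cong) (auto simp: \<phi>_def d_def algebra_simps inner_axis)
      qed
      have db: "\<bar>d i\<bar> \<le> B" for i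
      proof -
        have 1: "\<bar>v x0 $ i\<bar> \<le> L" using v[OF x0r] component_le_norm_cart[of "v x0" i] by linarith
        have "\<bar>2 * (x - x0) $ i\<bar> \<le> 2 * R"
          using x component_le_norm_cart[of "x - x0" i] by (auto simp: dist_norm norm_minus_commute)
        then have "\<bar>A * (2 * (x - x0) $ i)\<bar> \<le> A * (2 * R)"
          using A(2) by (simp only: abs_mult[of A]) (intro mult_mono, auto)
        with 1 show ?thesis using A(2) unfolding d_def B_def by linarith
      qed
      have eb: "\<bar>- (A * 2)\<bar> \<le> B" using A L R by (simp add: B_def)
      have bounds: "(\<Sum>i\<in>UNIV. (d i)\<^sup>2) \<le> M" "- M \<le> (\<Sum>i\<in>(UNIV::'n set). - (A * 2))"
        using sum_square_bounds[of d B "\<lambda>_. - (A * 2)", OF db eb B] unfolding M_def by linarith+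
      show "\<exists>d e. axis_jets \<phi> x d e \<and>
        (\<Sum>i\<in>UNIV. (d i)\<^sup>2) \<le> M \<and> - M \<le> (\<Sum>i\<in>UNIV. e i)"
        by (intro exI conjI allI, rule jet, rule bounds(1), rule bounds(2))
    next
      fix x assume "x \<in> frontier \<Omega> \<inter> ball x0 R"
      then have "x \<in> \<Omega>" "x \<in> frontier \<Omega>" using sub[of x] r by auto
      then show "inward_increasing \<Omega> \<phi> x"
        using op by (simp add: frontier_def interior_open)
    qed
  qed
qed

section \<open>Sign of the initial datum near the boundary\<close>

context boundary_chart
begin

text \<open>\<Omega> \<inter> ball p r is not known to be connected, but any two points of \<Omega>
  in a much smaller ball are joined within it by three segments: each point is pushed inwards along
  its own N, and the pushed points are joined. A continuous function without zeros keeps its sign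
  along this path.\<close>

lemma sign_near_boundary:
  fixes w :: "real^'n \<Rightarrow> real"
  assumes cont: "continuous_on (\<Omega> \<inter> ball p r) w" and nz: "\<And>x. x \<in> \<Omega> \<inter> ball p r \<Longrightarrow> w x \<noteq> 0"
  obtains \<delta> where "0 < \<delta>" "\<delta> \<le> r"
    "(\<forall>x\<in>\<Omega> \<inter> ball p \<delta>. 0 < w x) \<or> (\<forall>x\<in>\<Omega> \<inter> ball p \<delta>. w x < 0)"
proof -
  \<comment> \<open>Pushed points move by at most s C, whence r / (4 C). The push lowers g by s /
    C^2, and the errors add up to 17 C^3 s^2: one C^3 s^2 from \<open>descent\<close>, and 16 C^3
    s^2 from the joining segment, whose length is at most 4 s C.\<close>
  define s where "s = min (r / (4 * C)) (1 / (18 * C ^ 5))"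
  have C0: "0 < C" using C_ge by simp
  have s: "0 < s" "2 * s * C < r" "17 * C ^ 5 * s < 1"
  proof -
    show s0: "0 < s" using r_pos C0 by (simp add: s_def)
    have "s * (4 * C) \<le> r / (4 * C) * (4 * C)" using C0 by (intro mult_right_mono) (auto simp: s_def)
    then have "s * (4 * C) \<le> r" using C0 by simp
    moreover have "0 < s * C" using s0 C0 by simp
    ultimately show "2 * s * C < r" by linarith
    have "s * (18 * C ^ 5) \<le> 1 / (18 * C ^ 5) * (18 * C ^ 5)" using C0 by (intro mult_right_mono) (auto simp: s_def)
    then have "18 * (C ^ 5 * s) \<le> 1" using C0 by (simp add: mult_ac)
    moreover have "0 < C ^ 5 * s" using s0 C0 by simp
    ultimately have "17 * (C ^ 5 * s) < 1" by linarith
    then show "17 * C ^ 5 * s < 1" by (simp only: mult.assoc)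
  qed
  have sC: "s \<le> s * C" using s C_ge by simp
  have sr: "s < r" using sC s(1,2) by linarith
  have small: "17 * C ^ 3 * s\<^sup>2 < s / C\<^sup>2"
  proof -
    have "(17 * C ^ 5 * s) * s < 1 * s" using s by (intro mult_strict_right_mono) auto
    then show ?thesis using C0 by (simp add: field_simps power2_eq_square power3_eq_cube eval_nat_numeral)
  qed
  have ballr: "x - t *\<^sub>R N x \<in> ball p r" if "x \<in> ball p s" "0 \<le> t" "t \<le> s" for x t
  proof -
    have "x \<in> ball p r" using that(1) s sC sr by auto
    then have "norm (t *\<^sub>R N x) \<le> s * C" using N_upper that by (auto intro!: mult_mono)
    moreover have "dist p (x - t *\<^sub>R N x) \<le> dist p x + norm (t *\<^sub>R N x)"
      using dist_triangle[of p "x - t *\<^sub>R N x" x] by (simp add: dist_norm)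
    moreover have "dist p x < s" using that(1) by simp
    ultimately have "dist p (x - t *\<^sub>R N x) < r" using s sC by linarith
    then show ?thesis by simp
  qed
  have descent: "g (x - t *\<^sub>R N x) \<le> g x - t / C\<^sup>2 + C ^ 3 * t\<^sup>2"
    if x: "x \<in> ball p s" "0 \<le> t" "t \<le> s" for x t
  proof -
    have xr: "x \<in> ball p r" using x(1) s sC sr by auto
    have "g (x - t *\<^sub>R N x) \<le> g x - t * (norm (N x))\<^sup>2 + C * (t * norm (N x))\<^sup>2"
      using taylor[OF xr ballr[OF x]] x(2) by (simp add: power2_norm_eq_inner abs_le_iff algebra_simps)
    moreover have "t * (1 / C\<^sup>2) \<le> t * (norm (N x))\<^sup>2"
      using N_sq[OF xr] C0 x(2) by (intro mult_left_mono) (auto simp: field_simps)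
    moreover have "C * (t * norm (N x))\<^sup>2 \<le> C * (t * C)\<^sup>2"
      using N_upper[OF xr] C0 x(2) by (intro mult_left_mono power_mono mult_mono) auto
    ultimately show ?thesis by (simp add: power2_eq_square power3_eq_cube mult_ac)
  qed
  have seg1: "closed_segment x (x - s *\<^sub>R N x) \<subseteq> \<Omega> \<inter> ball p r" if x: "x \<in> \<Omega> \<inter> ball p s" for x
  proof
    fix z assume "z \<in> closed_segment x (x - s *\<^sub>R N x)"
    then obtain \<theta> where \<theta>: "0 \<le> \<theta>" "\<theta> \<le> 1" "z = x - (\<theta> * s) *\<^sub>R N x"
      by (auto simp: in_segment algebra_simps)
    have t: "0 \<le> \<theta> * s" "\<theta> * s \<le> s" using \<theta> s(1) by (auto simp: mult_left_le_one_le)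
    have xr: "x \<in> ball p r" using x s sC sr by auto
    have zr: "z \<in> ball p r" using ballr[OF _ t, of x] x \<theta>(3) by simp
    have "C ^ 3 * (\<theta> * s)\<^sup>2 \<le> (\<theta> * s) * (C ^ 3 * s)"
      using t C0 mult_left_mono[OF t(2) mult_nonneg_nonneg[OF t(1), of "C ^ 3"]] by (simp add: power2_eq_square mult_ac)
    also have "\<dots> \<le> (\<theta> * s) * (1 / C\<^sup>2)"
    proof (rule mult_left_mono[OF _ t(1)])
      have "0 < C ^ 5 * s" using s(1) C0 by simp
      then have "C ^ 5 * s \<le> 1" using s(3) unfolding mult.assoc by linarith
      then show "C ^ 3 * s \<le> 1 / C\<^sup>2" using C0 by (simp add: field_simps eval_nat_numeral)
    qed
    finally have "g z \<le> g x" using descent[OF _ t, of x] x \<theta>(3) by simp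
    then show "z \<in> \<Omega> \<inter> ball p r" using x zr g_neg[OF zr] g_neg[OF xr] by auto
  qed
  have seg2: "closed_segment (x - s *\<^sub>R N x) (y - s *\<^sub>R N y) \<subseteq> \<Omega> \<inter> ball p r"
    if x: "x \<in> \<Omega> \<inter> ball p s" and y: "y \<in> \<Omega> \<inter> ball p s" for x y
  proof
    define a b where "a = x - s *\<^sub>R N x" and "b = y - s *\<^sub>R N y"
    have xr: "x \<in> ball p r" "y \<in> ball p r" using x y s sC sr by auto
    have ab: "a \<in> ball p r" "b \<in> ball p r" using ballr[of _ s] x y s by (auto simp: a_def b_def)
    have ga: "g a \<le> - s / C\<^sup>2 + C ^ 3 * s\<^sup>2" and gb: "g b \<le> - s / C\<^sup>2 + C ^ 3 * s\<^sup>2"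
      using descent[of x s] descent[of y s] g_neg[OF xr(1)] g_neg[OF xr(2)] x y s by (auto simp: a_def b_def)
    have "norm (a - b) \<le> 4 * (s * C)"
    proof -
      have "norm (a - b) \<le> norm (x - y) + norm (s *\<^sub>R N x) + norm (s *\<^sub>R N y)"
        unfolding a_def b_def using norm_triangle_ineq4[of "x - y" "s *\<^sub>R N x - s *\<^sub>R N y"]
          norm_triangle_ineq4[of "s *\<^sub>R N x" "s *\<^sub>R N y"] by (simp add: algebra_simps)
      moreover have "norm (x - y) \<le> 2 * s"
        using x y dist_triangle[of x y p] by (auto simp: dist_norm norm_minus_commute)
      moreover have "norm (s *\<^sub>R N x) \<le> s * C" "norm (s *\<^sub>R N y) \<le> s * C"
        using N_upper xr s by (auto intro!: mult_left_mono)
      ultimately show ?thesis using sC by linarith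
    qed
    fix z assume "z \<in> closed_segment (x - s *\<^sub>R N x) (y - s *\<^sub>R N y)"
    then have z: "z \<in> closed_segment a b" by (simp add: a_def b_def)
    then obtain \<theta> where \<theta>: "0 \<le> \<theta>" "\<theta> \<le> 1" "z = (1 - \<theta>) *\<^sub>R a + \<theta> *\<^sub>R b" by (auto simp: in_segment)
    have zr: "z \<in> ball p r" using z ab convex_ball convex_contains_segment by blast
    have nz: "norm (a - z) \<le> 4 * (s * C)" "norm (b - z) \<le> 4 * (s * C)"
      using segment_bound[OF z] \<open>norm (a - b) \<le> 4 * (s * C)\<close> by (simp_all add: norm_minus_commute)
    have dz: "(norm (a - z))\<^sup>2 \<le> (4 * (s * C))\<^sup>2" "(norm (b - z))\<^sup>2 \<le> (4 * (s * C))\<^sup>2"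
      by (intro power_mono nz norm_ge_zero)+
    have low: "g z + N z \<bullet> (a - z) - C * (4 * (s * C))\<^sup>2 \<le> g a" "g z + N z \<bullet> (b - z) - C * (4 * (s * C))\<^sup>2 \<le> g b"
      using taylor[OF zr ab(1)] taylor[OF zr ab(2)] mult_left_mono[OF dz(1), of C] mult_left_mono[OF dz(2), of C] C0
      by linarith+
    have "(1 - \<theta>) * (g z + N z \<bullet> (a - z) - C * (4 * (s * C))\<^sup>2) + \<theta> * (g z + N z \<bullet> (b - z) - C * (4 * (s * C))\<^sup>2)
       \<le> (1 - \<theta>) * (- s / C\<^sup>2 + C ^ 3 * s\<^sup>2) + \<theta> * (- s / C\<^sup>2 + C ^ 3 * s\<^sup>2)"
      using \<theta> low ga gb by (intro add_mono mult_left_mono) (auto intro: order_trans)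
    \<comment> \<open>Expanding at z itself makes the first-order terms cancel in the convex
      combination, so the values of g at the two ends bound g z up to a quadratic error.\<close>
    moreover have "(1 - \<theta>) * (N z \<bullet> (a - z)) + \<theta> * (N z \<bullet> (b - z)) = 0"
    proof -
      have "(1 - \<theta>) * (N z \<bullet> (a - z)) + \<theta> * (N z \<bullet> (b - z)) = N z \<bullet> ((1 - \<theta>) *\<^sub>R (a - z) + \<theta> *\<^sub>R (b - z))"
        by (simp add: inner_add_right)
      also have "(1 - \<theta>) *\<^sub>R (a - z) + \<theta> *\<^sub>R (b - z) = 0" using \<theta>(3) by (simp add: algebra_simps)
      finally show ?thesis by simp
    qed
    moreover have "g' - P \<le> Q" if "(1 - \<theta>) * (g' + \<alpha> - P) + \<theta> * (g' + \<beta> - P) \<le> (1 - \<theta>) * Q + \<theta> * Q"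
      "(1 - \<theta>) * \<alpha> + \<theta> * \<beta> = 0" for g' \<alpha> \<beta> P Q :: real
      using that by (simp add: algebra_simps)
    ultimately have "g z - C * (4 * (s * C))\<^sup>2 \<le> - s / C\<^sup>2 + C ^ 3 * s\<^sup>2" by blast
    moreover have "C * (4 * (s * C))\<^sup>2 = 16 * (C ^ 3 * s\<^sup>2)" by (simp add: power2_eq_square power3_eq_cube)
    ultimately have "g z < 0" using small by simp
    then show "z \<in> \<Omega> \<inter> ball p r" using g_neg[OF zr] zr by simp
  qed
  have transfer: "0 < w' y"
    if x: "x \<in> \<Omega> \<inter> ball p s" and y: "y \<in> \<Omega> \<inter> ball p s" and wx: "0 < w' x"
      and c: "continuous_on (\<Omega> \<inter> ball p r) w'" and z: "\<And>x. x \<in> \<Omega> \<inter> ball p r \<Longrightarrow> w' x \<noteq> 0" for x y and w' :: "real^'n \<Rightarrow> real"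
  proof -
    note pos = positive_along_segment[OF continuous_on_subset[OF c]]
    have "0 < w' (x - s *\<^sub>R N x)"
      by (rule pos[OF seg1[OF x] _ wx]) (use z seg1[OF x] in blast)
    then have "0 < w' (y - s *\<^sub>R N y)"
      by (rule pos[OF seg2[OF x y], rotated]) (use z seg2[OF x y] in blast)
    moreover have "closed_segment (y - s *\<^sub>R N y) y \<subseteq> \<Omega> \<inter> ball p r"
      using seg1[OF y] by (simp add: closed_segment_commute)
    ultimately show ?thesis by (intro pos[of "y - s *\<^sub>R N y" y]) (use z in blast)+
  qed
  show thesis
  proof (rule that[of s])
    show "0 < s" "s \<le> r" using s sC sr by auto
    show "(\<forall>x\<in>\<Omega> \<inter> ball p s. 0 < w x) \<or> (\<forall>x\<in>\<Omega> \<inter> ball p s. w x < 0)"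
    proof (cases "\<exists>x\<in>\<Omega> \<inter> ball p s. 0 < w x")
      case True
      then obtain x where x: "x \<in> \<Omega> \<inter> ball p s" "0 < w x" by blast
      have "0 < w y" if "y \<in> \<Omega> \<inter> ball p s" for y by (rule transfer[OF x(1) that x(2) cont]) (rule nz)
      then show ?thesis by blast
    next
      case False
      have "w y < 0" if y: "y \<in> \<Omega> \<inter> ball p s" for y
      proof -
        have "y \<in> \<Omega> \<inter> ball p r" using y s sC sr by auto
        then have "w y \<noteq> 0" by (rule nz)
        moreover have "w y \<le> 0" using False y by (simp add: not_less)
        ultimately show ?thesis by simp
      qed
      then show ?thesis by blast
    qed
  qed
qed

end

context boundary_chart
begin

text \<open>Since \<open>u0\<close> stays above \<open>a\<close>, the part of its gradient that does not point along the inner normal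
  is controlled by \<open>sqrt (u0 x - a)\<close>, as for any nonnegative function with bounded second
  derivatives.\<close>

lemma gradient_decomposition:
  fixes u0 :: "real^'n \<Rightarrow> real"
  assumes L: "1 \<le> L"
    and v: "\<And>x. x \<in> ball p r \<Longrightarrow> norm (v x) \<le> L"
    and taylor_u0: "\<And>x y. x \<in> ball p r \<Longrightarrow> y \<in> ball p r \<Longrightarrow>
       \<bar>u0 y - u0 x - v x \<bullet> (y - x)\<bar> \<le> L * (norm (y - x))\<^sup>2"
    and H: "1 \<le> H" "\<And>x. x \<in> ball p r \<Longrightarrow> u0 x - a \<le> H"
    and above: "\<And>x. x \<in> \<Omega> \<inter> ball p r \<Longrightarrow> a \<le> u0 x"
  obtains B where "0 < B" "\<And>x. x \<in> \<Omega> \<inter> ball p (r / 2) \<Longrightarrow> a < u0 x \<Longrightarrow>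
     \<exists>c\<ge>0. c \<le> L * C \<and> norm (v x + c *\<^sub>R N x) \<le> B * sqrt (u0 x - a)"
proof -
  \<comment> \<open>The entry 1 / (4 C^4) gives |w| \<le> 2 for the test direction w below, and r /
    8 then keeps x + s w in the chart. Dividing by sqrt H transfers the bound to s = \<sigma> sqrt
    h.\<close>
  define sm where "sm = min (1 / (4 * C ^ 4)) (r / 8)"
  have C0: "0 < C" using C_ge by simp
  have sm: "0 < sm" using r_pos C0 by (simp add: sm_def)
  define \<sigma> where "\<sigma> = sm / sqrt H"
  have \<sigma>: "0 < \<sigma>" using sm H by (simp add: \<sigma>_def)
  define B where "B = 1 / \<sigma> + \<sigma> * (4 * L + 4 * C ^ 4 * L)"
  have B: "0 < B" using \<sigma> L C0 by (simp add: B_def add_pos_nonneg)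
  show thesis
  proof (rule that[OF B])
    fix x assume x: "x \<in> \<Omega> \<inter> ball p (r / 2)" and pos: "a < u0 x"
    define h where "h = u0 x - a"
    have h: "0 < h" using pos by (simp add: h_def)
    have xr: "x \<in> ball p r" using x r_pos by auto
    have Npos: "0 < norm (N x)" using N_pos[OF xr] .
    \<comment> \<open>This c makes \<tau> the projection of v x onto the half-space of vectors with
      nonnegative inner product with N x. Hence c (N x \<bullet> \<tau>) = 0, and v x \<bullet>
      \<tau> = |\<tau>|^2.\<close>
    define c where "c = max 0 (- (v x \<bullet> N x) / (norm (N x))\<^sup>2)"
    define \<tau> where "\<tau> = v x + c *\<^sub>R N x"
    have c0: "0 \<le> c" by (simp add: c_def)
    have vN: "\<bar>v x \<bullet> N x\<bar> \<le> L * norm (N x)"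
      using Cauchy_Schwarz_ineq2[of "v x" "N x"] v[OF xr] by (meson mult_right_mono norm_ge_zero order_trans)
    have cN: "c * (norm (N x))\<^sup>2 \<le> L * norm (N x)" "- (v x \<bullet> N x) \<le> c * (norm (N x))\<^sup>2"
    proof -
      have "- (v x \<bullet> N x) / (norm (N x))\<^sup>2 \<le> c" by (simp add: c_def)
      then show "- (v x \<bullet> N x) \<le> c * (norm (N x))\<^sup>2" using Npos by (simp add: field_simps)
      show "c * (norm (N x))\<^sup>2 \<le> L * norm (N x)"
      proof (cases "c = 0")
        case True
        then show ?thesis using L Npos by simp
      next
        case False
        then have "c = - (v x \<bullet> N x) / (norm (N x))\<^sup>2" by (auto simp: c_def max_def split: if_splits)
        then have "c * (norm (N x))\<^sup>2 = - (v x \<bullet> N x)" using Npos by simp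
        then show ?thesis using vN by linarith
      qed
    qed
    have N\<tau>: "0 \<le> N x \<bullet> \<tau>" using cN(2) by (simp add: \<tau>_def inner_add_right power2_norm_eq_inner inner_commute)
    have v\<tau>: "v x \<bullet> \<tau> = (norm \<tau>)\<^sup>2"
    proof -
      have "c * (N x \<bullet> \<tau>) = 0"
      proof (cases "c = 0")
        case False
        then have "c = - (v x \<bullet> N x) / (norm (N x))\<^sup>2" by (auto simp: c_def max_def split: if_splits)
        then have "c * (norm (N x))\<^sup>2 = - (v x \<bullet> N x)" using Npos by simp
        then show ?thesis by (simp add: \<tau>_def inner_add_right power2_norm_eq_inner inner_commute)
      qed simp
      moreover have "(norm \<tau>)\<^sup>2 = v x \<bullet> \<tau> + c * (N x \<bullet> \<tau>)"
        unfolding power2_norm_eq_inner by (subst (1) \<tau>_def) (simp add: inner_add_left)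
      ultimately show ?thesis by simp
    qed
    have cle: "c \<le> L * C"
    proof -
      have "c * norm (N x) * norm (N x) \<le> L * norm (N x)" using cN(1) by (simp add: power2_eq_square mult.assoc)
      then have "c * norm (N x) \<le> L" using Npos by simp
      moreover have "c * (1 / C) \<le> c * norm (N x)" using N_lower[OF xr] c0 by (intro mult_left_mono)
      ultimately have "c * (1 / C) \<le> L" by linarith
      then show ?thesis using C0 by (simp add: field_simps)
    qed
    define s where "s = \<sigma> * sqrt h"
    have s0: "0 < s" using \<sigma> h by (simp add: s_def)
    have ssm: "s \<le> sm"
    proof -
      have "sqrt h \<le> sqrt H" using H(2)[OF xr] by (simp add: h_def)
      then have "s \<le> \<sigma> * sqrt H" unfolding s_def using \<sigma> by (intro mult_left_mono) auto
      also have "\<dots> = sm" using H by (simp add: \<sigma>_def)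
      finally show ?thesis .
    qed
    have "norm \<tau> \<le> B * sqrt h"
    proof (cases "\<tau> = 0")
      case True
      then show ?thesis using B h by simp
    next
      case False
      then have \<tau>0: "0 < norm \<tau>" by simp
      \<comment> \<open>The first part decreases u0 at rate |\<tau>| and does not point outwards.
        The inward tilt, proportional to s, offsets the error 4 C s^2 in the expansion of g, so that
        the test point stays in \<Omega>.\<close>
      define w where "w = - (\<tau> /\<^sub>R norm \<tau>) - (4 * C ^ 3 * s) *\<^sub>R N x"
      have "(4 * C ^ 3 * s) * norm (N x) \<le> (4 * C ^ 3 * s) * C"
        using N_upper[OF xr] C0 s0 by (intro mult_left_mono) auto
      also have "\<dots> = (4 * C ^ 4) * s" by (simp add: eval_nat_numeral)
      also have "\<dots> \<le> (4 * C ^ 4) * (1 / (4 * C ^ 4))"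
        using ssm C0 by (intro mult_left_mono) (auto simp: sm_def)
      also have "\<dots> = 1" using C0 by simp
      finally have "norm w \<le> 1 + 1"
        unfolding w_def using \<tau>0 C0 s0
        by (intro norm_triangle_le_diff add_mono) (auto simp: abs_mult)
      then have w2: "norm w \<le> 2" by simp
      have sw: "norm (s *\<^sub>R w) \<le> s * 2" using w2 s0 by (auto intro!: mult_left_mono)
      have sw2: "(norm (s *\<^sub>R w))\<^sup>2 \<le> 4 * s\<^sup>2" using power_mono[OF sw, of 2] by (simp add: power_mult_distrib)
      have yr: "x + s *\<^sub>R w \<in> ball p r"
      proof -
        have "dist p (x + s *\<^sub>R w) \<le> dist p x + norm (s *\<^sub>R w)"
          using dist_triangle[of p "x + s *\<^sub>R w" x] by (simp add: dist_norm)
        moreover have "s \<le> r / 8" using ssm by (simp add: sm_def)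
        ultimately show ?thesis using x sw r_pos by auto
      qed
      have Nw: "N x \<bullet> w \<le> - (4 * C * s)"
      proof -
        have "N x \<bullet> w = - ((N x \<bullet> \<tau>) / norm \<tau>) - (4 * C ^ 3 * s) * (norm (N x))\<^sup>2"
          by (simp add: w_def inner_diff_right power2_norm_eq_inner divide_inverse mult.commute)
        moreover have "0 \<le> (N x \<bullet> \<tau>) / norm \<tau>" using N\<tau> by simp
        moreover have "(4 * C * s) * 1 \<le> (4 * C * s) * (C\<^sup>2 * (norm (N x))\<^sup>2)"
          using N_sq[OF xr] C0 s0 by (intro mult_left_mono) auto
        moreover have "(4 * C * s) * (C\<^sup>2 * (norm (N x))\<^sup>2) = (4 * C ^ 3 * s) * (norm (N x))\<^sup>2"
          by (simp add: power2_eq_square power3_eq_cube)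
        ultimately show ?thesis by linarith
      qed
      have vw: "v x \<bullet> w \<le> - norm \<tau> + 4 * C ^ 4 * L * s"
      proof -
        have "v x \<bullet> w = - ((v x \<bullet> \<tau>) / norm \<tau>) + (4 * C ^ 3 * s) * - (v x \<bullet> N x)"
          by (simp add: w_def inner_diff_right divide_inverse mult.commute)
        moreover have "(v x \<bullet> \<tau>) / norm \<tau> = norm \<tau>" using \<tau>0 v\<tau> by (simp add: power2_eq_square)
        moreover have "(4 * C ^ 3 * s) * - (v x \<bullet> N x) \<le> (4 * C ^ 3 * s) * (L * C)"
        proof (rule mult_left_mono)
          have "L * norm (N x) \<le> L * C" using N_upper[OF xr] L by (intro mult_left_mono) auto
          then show "- (v x \<bullet> N x) \<le> L * C" using vN by linarith
        qed (use C0 s0 in auto)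
        moreover have "(4 * C ^ 3 * s) * (L * C) = 4 * C ^ 4 * L * s" by (simp add: eval_nat_numeral)
        ultimately show ?thesis by linarith
      qed
      have "g (x + s *\<^sub>R w) \<le> g x + s * (N x \<bullet> w) + C * (norm (s *\<^sub>R w))\<^sup>2"
        using taylor[OF xr yr] by (simp add: abs_le_iff)
      also have "\<dots> \<le> g x + s * - (4 * C * s) + C * (4 * s\<^sup>2)"
        using Nw s0 sw2 C0 by (intro add_mono mult_left_mono order_refl) auto
      also have "\<dots> = g x" by (simp add: power2_eq_square)
      finally have "x + s *\<^sub>R w \<in> \<Omega>" using g_neg[OF xr] g_neg[OF yr] x by auto
      \<comment> \<open>Descent at rate |\<tau>| over the length s can use up only h plus O(s^2).
        With s proportional to sqrt h this yields |\<tau>| = O(sqrt h).\<close>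
      then have "a \<le> u0 (x + s *\<^sub>R w)" using above yr by blast
      also have "u0 (x + s *\<^sub>R w) \<le> u0 x + s * (v x \<bullet> w) + L * (norm (s *\<^sub>R w))\<^sup>2"
        using taylor_u0[OF xr yr] by (simp add: abs_le_iff)
      also have "\<dots> \<le> u0 x + s * (- norm \<tau> + 4 * C ^ 4 * L * s) + L * (4 * s\<^sup>2)"
        using vw s0 sw2 L by (intro add_mono mult_left_mono order_refl) auto
      finally have "s * norm \<tau> \<le> h + s * (s * (4 * L + 4 * C ^ 4 * L))"
        by (simp add: h_def power2_eq_square algebra_simps)
      also have "h = s * (sqrt h / \<sigma>)" using \<sigma> h by (simp add: s_def)
      finally have "s * norm \<tau> \<le> s * (sqrt h / \<sigma> + s * (4 * L + 4 * C ^ 4 * L))"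
        by (simp only: distrib_left)
      then have "norm \<tau> \<le> sqrt h / \<sigma> + s * (4 * L + 4 * C ^ 4 * L)" using s0 by simp
      also have "\<dots> = B * sqrt h" by (simp add: B_def s_def algebra_simps)
      finally show ?thesis .
    qed
    then show "\<exists>c\<ge>0. c \<le> L * C \<and> norm (v x + c *\<^sub>R N x) \<le> B * sqrt (u0 x - a)"
      using c0 cle by (auto simp: \<tau>_def h_def)
  qed
qed

text \<open>The normal part of the gradient is modelled by - c (g - g x0), which does not decrease
  inwards because c \<ge> 0 and so respects the boundary condition. The remaining part, of size B
  sqrt h, is absorbed by Young's inequality into h / 4 and a quadratic term. \<open>bowl\<close>
  supplies the strict inward increase and the descent to - K.\<close>

lemma lower_barrier_boundary:
  fixes u0 :: "real^'n \<Rightarrow> real"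
  assumes L: "1 \<le> L"
    and v: "\<And>x. x \<in> ball p r \<Longrightarrow> norm (v x) \<le> L"
    and taylor_u0: "\<And>x y. x \<in> ball p r \<Longrightarrow> y \<in> ball p r \<Longrightarrow>
       \<bar>u0 y - u0 x - v x \<bullet> (y - x)\<bar> \<le> L * (norm (y - x))\<^sup>2"
    and H: "1 \<le> H" "\<And>x. x \<in> ball p r \<Longrightarrow> u0 x - a \<le> H"
    and above: "\<And>x. x \<in> \<Omega> \<inter> ball p r \<Longrightarrow> a \<le> u0 x"
  obtains M where "0 < M"
    "\<And>x. x \<in> \<Omega> \<inter> ball p (r / 2) \<Longrightarrow> a < u0 x \<Longrightarrow> lower_barrier \<Omega> u0 a K M x"
proof -
  obtain B where B: "0 < B" and decomp: "\<And>x. x \<in> \<Omega> \<inter> ball p (r / 2) \<Longrightarrow> a < u0 x \<Longrightarrow>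
     \<exists>c\<ge>0. c \<le> L * C \<and> norm (v x + c *\<^sub>R N x) \<le> B * sqrt (u0 x - a)"
    using gradient_decomposition[OF L v taylor_u0 H above] by blast
  obtain Mb where Mb: "0 < Mb" "\<And>x0 k x i. x0 \<in> ball p r \<Longrightarrow> x \<in> ball p r \<Longrightarrow> 0 \<le> k \<Longrightarrow> k \<le> 1 \<Longrightarrow>
     \<exists>d e. jet2 (\<lambda>s. bowl x0 k (x + s *\<^sub>R axis i 1)) d e \<and> \<bar>d\<bar> \<le> Mb \<and> \<bar>e\<bar> \<le> Mb"
    using bowl_jet by blast
  have C0: "0 < C" using C_ge by simp
  define R where "R = r / 4"
  have R: "0 < R" using r_pos by (simp add: R_def)
  \<comment> \<open>\<open>A0\<close> collects the quadratic errors: B^2 from Young's inequality, L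
    C^2 from the expansion of g weighted by c \<le> L C, and L from u0. \<open>E\<close> is the drop
    required on the sphere, where c (g - g x0) costs at most 2 L C.\<close>
  define A0 where "A0 = B\<^sup>2 + L * C\<^sup>2 + L"
  define E where "E = \<bar>K\<bar> + \<bar>a\<bar> + H + 2 * (L * C)"
  have E: "0 \<le> E" using L C0 H by (simp add: E_def)
  have A0: "0 \<le> A0" using L C0 by (simp add: A0_def)
  define A where "A = 2 * A0 + H + 2 * E / R\<^sup>2"
  have A: "2 * A0 \<le> A" "H \<le> A" "1 \<le> A" "E \<le> A * (R\<^sup>2 / 2)"
  proof -
    have q: "0 \<le> 2 * E / R\<^sup>2" using E by simp
    show "2 * A0 \<le> A" "H \<le> A" "1 \<le> A" using q A0 H(1) unfolding A_def by linarith+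
    have "A * (R\<^sup>2 / 2) = (2 * A0 + H) * (R\<^sup>2 / 2) + E" using R by (simp add: A_def field_simps)
    then show "E \<le> A * (R\<^sup>2 / 2)" using A0 H by simp
  qed
  define D where "D = L * C * C + A * Mb"
  have D: "0 \<le> D" using L C0 A Mb(1) by (simp add: D_def)
  \<comment> \<open>The summand 2 accounts for the centre, where only h / 2 is retained.\<close>
  define M where "M = 2 + real CARD('n) * (D\<^sup>2 + D)"
  have M: "2 \<le> M" using D by (simp add: M_def)
  show thesis
  proof (rule that[of M])
    show "0 < M" using M by simp
    fix x0 assume x0: "x0 \<in> \<Omega> \<inter> ball p (r / 2)" and pos: "a < u0 x0"
    have x0r: "x0 \<in> ball p r" using x0 r_pos by auto
    have x0cl: "x0 \<in> closure \<Omega>" using x0 closure_subset by blast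
    have sub: "x \<in> ball p r" if "x \<in> cball x0 R" for x
      using that x0 r_pos dist_triangle[of p x x0] by (auto simp: R_def)
    define h where "h = u0 x0 - a"
    have h: "0 < h" "h \<le> H" using pos H(2)[OF x0r] by (auto simp: h_def)
    obtain c where c: "0 \<le> c" "c \<le> L * C" "norm (v x0 + c *\<^sub>R N x0) \<le> B * sqrt h"
      using decomp[OF x0 pos] by (auto simp: h_def)
    \<comment> \<open>The height h is spent as h / 2 at the centre, h / 4 on the offset of
      \<open>bowl\<close>, equal to A k / 2, and h / 4 on Young's inequality. H \<le> A gives k
      \<le> 1.\<close>
    define k where "k = h / (2 * A)"
    have k: "0 < k" "k \<le> 1" "A * (k / 2) = h / 4"
      using h A by (auto simp: k_def field_simps)
    define \<phi> where "\<phi> x = a + h / 2 - c * (g x - g x0) - A * bowl x0 k x" for x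
    have upper: "\<phi> x \<le> a + 3 / 4 * h - c * (g x - g x0) - A * ((norm (x - x0))\<^sup>2 / 2)"
      if x: "x \<in> closure \<Omega> \<inter> cball x0 R" for x
    proof -
      have "A * ((norm (x - x0))\<^sup>2 / 2 - k / 2) \<le> A * bowl x0 k x"
        using bowl_bounds(1)[of x k x0] x sub[of x] k A by (intro mult_left_mono) auto
      then show ?thesis using k(3) by (simp add: \<phi>_def right_diff_distrib)
    qed
    have g1: "\<bar>g x\<bar> \<le> 1" if "x \<in> ball p r" for x
    proof -
      have "1 \<le> 4 * C ^ 3" using one_le_power[OF C_ge, of 3] by linarith
      then have "1 / (4 * C ^ 3) \<le> 1" using C0 by (simp add: divide_le_eq)
      then show ?thesis using g_small[OF that] by linarith
    qed
    show "lower_barrier \<Omega> u0 a K M x0"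
      unfolding lower_barrier_def
    proof (intro exI[of _ R] exI[of _ \<phi>] conjI ballI impI)
      show "0 < R" by (rule R)
      have "continuous_on (closure \<Omega> \<inter> cball x0 R) g" "continuous_on (closure \<Omega> \<inter> cball x0 R) (bowl x0 k)"
        using has_derivative_continuous[OF g_deriv[OF sub]] has_derivative_continuous[OF bowl_has_derivative[OF sub]]
        by (auto intro!: continuous_at_imp_continuous_on)
      then show "continuous_on (closure \<Omega> \<inter> cball x0 R) \<phi>"
        unfolding \<phi>_def by (intro continuous_intros)
    next
      fix x assume x: "x \<in> closure \<Omega> \<inter> cball x0 R"
      have xr: "x \<in> ball p r" using sub x by blast
      define \<rho> where "\<rho> = norm (x - x0)"
      have \<rho>: "0 \<le> \<rho>" by (simp add: \<rho>_def)
      have "(v x0 + c *\<^sub>R N x0) \<bullet> (x - x0) \<ge> - (B * sqrt h * \<rho>)"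
        using Cauchy_Schwarz_ineq2[of "v x0 + c *\<^sub>R N x0" "x - x0"] mult_right_mono[OF c(3) \<rho>]
        unfolding \<rho>_def by linarith
      moreover have "B * sqrt h * \<rho> \<le> h / 4 + B\<^sup>2 * \<rho>\<^sup>2"
      proof -
        have "0 \<le> (sqrt h / 2 - B * \<rho>)\<^sup>2" by simp
        also have "\<dots> = h / 4 - B * sqrt h * \<rho> + B\<^sup>2 * \<rho>\<^sup>2"
          using h by (simp add: power2_diff power_mult_distrib power_divide)
        finally show ?thesis by simp
      qed
      moreover have "(v x0 + c *\<^sub>R N x0) \<bullet> (x - x0) = v x0 \<bullet> (x - x0) + c * (N x0 \<bullet> (x - x0))"
        by (simp add: inner_add_left)
      moreover have "u0 x0 + v x0 \<bullet> (x - x0) - L * \<rho>\<^sup>2 \<le> u0 x"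
        using taylor_u0[OF x0r xr] by (simp add: \<rho>_def abs_le_iff)
      moreover have "c * (N x0 \<bullet> (x - x0)) \<le> c * (g x - g x0 + C * \<rho>\<^sup>2)"
        using taylor[OF x0r xr] c(1) by (intro mult_left_mono) (auto simp: \<rho>_def abs_le_iff)
      moreover have "c * (g x - g x0 + C * \<rho>\<^sup>2) = c * (g x - g x0) + c * (C * \<rho>\<^sup>2)" by (simp only: distrib_left)
      moreover have "c * (C * \<rho>\<^sup>2) \<le> L * C * (C * \<rho>\<^sup>2)"
        using c(2) C0 by (intro mult_right_mono) auto
      moreover have "L * C * (C * \<rho>\<^sup>2) + B\<^sup>2 * \<rho>\<^sup>2 + L * \<rho>\<^sup>2 = A0 * \<rho>\<^sup>2"
        by (simp add: A0_def algebra_simps power2_eq_square)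
      moreover have "A0 * \<rho>\<^sup>2 \<le> A / 2 * \<rho>\<^sup>2" using A(1) by (intro mult_right_mono) auto
      moreover have "A / 2 * \<rho>\<^sup>2 = A * (\<rho>\<^sup>2 / 2)" by simp
      moreover have "\<phi> x \<le> a + 3 / 4 * h - c * (g x - g x0) - A * (\<rho>\<^sup>2 / 2)"
        using upper[OF x] by (simp add: \<rho>_def)
      moreover have "u0 x0 = a + h" by (simp add: h_def)
      ultimately show "\<phi> x \<le> u0 x" by linarith
    next
      fix x assume x: "x \<in> closure \<Omega>" "dist x0 x = R"
      then have x': "x \<in> closure \<Omega> \<inter> cball x0 R" by simp
      have xr: "x \<in> ball p r" using sub x' by blast
      have "\<bar>c * (g x - g x0)\<bar> \<le> L * C * 2"
        unfolding abs_mult using c g1[OF xr] g1[OF x0r] L C0 by (intro mult_mono) auto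
      moreover have "norm (x - x0) = R" using x by (simp add: dist_norm norm_minus_commute)
      ultimately show "\<phi> x \<le> - K" using upper[OF x'] h A(4) unfolding E_def by (auto simp: abs_le_iff)
    next
      have "h / M \<le> h / 2" using M h by (intro divide_left_mono) auto
      moreover have "A * bowl x0 k x0 \<le> 0"
        using bowl_center[OF x0r x0cl, of k] k A by (simp add: mult_nonneg_nonpos)
      moreover have "c * (g x0 - g x0) = 0" by simp
      ultimately show "a + (u0 x0 - a) / M \<le> \<phi> x0" unfolding \<phi>_def h_def[symmetric] by linarith
    next
      fix x assume x: "x \<in> \<Omega> \<inter> ball x0 R"
      then have xr: "x \<in> ball p r" using sub by auto
      have "\<forall>i. \<exists>d e. jet2 (\<lambda>s. bowl x0 k (x + s *\<^sub>R axis i 1)) d e \<and> \<bar>d\<bar> \<le> Mb \<and> \<bar>e\<bar> \<le> Mb"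
        using Mb(2)[OF x0r xr] k by auto
      then obtain d e where de: "\<And>i. jet2 (\<lambda>s. bowl x0 k (x + s *\<^sub>R axis i 1)) (d i) (e i)"
        "\<And>i. \<bar>d i\<bar> \<le> Mb" "\<And>i. \<bar>e i\<bar> \<le> Mb" by metis
      have "\<forall>i. \<exists>e. jet2 (\<lambda>s. g (x + s *\<^sub>R axis i 1)) (N x $ i) e \<and> \<bar>e\<bar> \<le> C" using g_jet[OF xr] by blast
      then obtain e' where e': "\<And>i. jet2 (\<lambda>s. g (x + s *\<^sub>R axis i 1)) (N x $ i) (e' i)" "\<And>i. \<bar>e' i\<bar> \<le> C" by metis
      define d1 where "d1 i = - (c * N x $ i) - A * d i" for i
      define e1 where "e1 i = - (c * e' i) - A * e i" for i
      have jet: "jet2 (\<lambda>s. \<phi> (x + s *\<^sub>R axis i 1)) (d1 i) (e1 i)" for i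
      proof -
        have "jet2 (\<lambda>s. a + h / 2 - c * (g (x + s *\<^sub>R axis i 1) - g x0) - A * bowl x0 k (x + s *\<^sub>R axis i 1))
           (0 - c * (N x $ i - 0) - A * d i) (0 - c * (e' i - 0) - A * e i)"
          by (intro jet2_diff jet2_const jet2_cmult e' de)
        then show ?thesis by (simp add: \<phi>_def d1_def e1_def)
      qed
      have prod: "\<bar>- (c * y) - A * z\<bar> \<le> D" if "\<bar>y\<bar> \<le> C" "\<bar>z\<bar> \<le> Mb" for y z
      proof -
        have "\<bar>c * y\<bar> \<le> L * C * C"
          unfolding abs_mult by (rule mult_mono) (use that c L C0 in auto)
        moreover have "\<bar>A * z\<bar> \<le> A * Mb"
          unfolding abs_mult by (rule mult_mono) (use that A in auto)
        ultimately show ?thesis unfolding D_def by linarith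
      qed
      have Ni: "\<bar>N x $ i\<bar> \<le> C" for i using component_le_norm_cart[of "N x" i] N_upper[OF xr] by linarith
      have d1: "\<bar>d1 i\<bar> \<le> D" "\<bar>e1 i\<bar> \<le> D" for i
        unfolding d1_def e1_def using prod Ni de(2,3) e'(2) by auto
      have bounds: "(\<Sum>i\<in>UNIV. (d1 i)\<^sup>2) \<le> M" "- M \<le> (\<Sum>i\<in>UNIV. e1 i)"
        using sum_square_bounds[of d1 D e1, OF d1 D] unfolding M_def by linarith+
      show "\<exists>d e. axis_jets \<phi> x d e \<and>
        (\<Sum>i\<in>UNIV. (d i)\<^sup>2) \<le> M \<and> - M \<le> (\<Sum>i\<in>UNIV. e i)"
        by (intro exI conjI allI, rule jet, rule bounds(1), rule bounds(2))
    next
      fix x assume "x \<in> frontier \<Omega> \<inter> ball x0 R"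
      then have x: "x \<in> ball p r" "x \<in> frontier \<Omega>" using sub by auto
      define n where "n = N x /\<^sub>R norm (N x)"
      obtain D1 where D1: "0 < D1" "((\<lambda>h. bowl x0 k (x - h *\<^sub>R n)) has_real_derivative - D1) (at_right 0)"
        using bowl_normal_derivative[OF x x0r x0cl k(1)] unfolding n_def by blast
      have "((\<lambda>h. g (x - h *\<^sub>R n)) has_real_derivative - (N x \<bullet> n)) (at_right 0)"
        by (rule normal_derivative[OF x(1) g_deriv[OF x(1)]])
      moreover have "0 \<le> N x \<bullet> n" by (simp add: n_def)
      ultimately show "inward_increasing \<Omega> \<phi> x"
        using normal[OF x] inward_normal[OF x] D1 c(1) A(3) unfolding \<phi>_def n_def[symmetric]
        by (intro exI[of _ n] exI[of _ "c * (N x \<bullet> n) + A * D1"] conjI)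
          (auto intro!: derivative_eq_intros add_nonneg_pos)
    qed
  qed
qed

end

text \<open>The barriers need only a surrogate v for the gradient with quadratic remainder.
  Replacing v by - v shows that the property passes to - u, so the reflected problem needs no
  barriers of its own.\<close>

definition locally_C11 :: "'a::real_inner set \<Rightarrow> ('a \<Rightarrow> real) \<Rightarrow> bool" where
  "locally_C11 S u \<longleftrightarrow> (\<forall>p\<in>S. \<exists>r>0. \<exists>L\<ge>0. \<exists>v. \<forall>x\<in>ball p r. norm (v x) \<le> L \<and>
     (\<forall>y\<in>ball p r. \<bar>u y - u x - v x \<bullet> (y - x)\<bar> \<le> L * (norm (y - x))\<^sup>2))"

lemma locally_C11_uminus:
  assumes "locally_C11 S u"
  shows "locally_C11 S (\<lambda>x. - u x)"
  unfolding locally_C11_def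
proof
  fix p assume "p \<in> S"
  then obtain r L v where rLv: "0 < r" "0 \<le> L" "\<forall>x\<in>ball p r. norm (v x) \<le> L \<and>
      (\<forall>y\<in>ball p r. \<bar>u y - u x - v x \<bullet> (y - x)\<bar> \<le> L * (norm (y - x))\<^sup>2)"
    using assms unfolding locally_C11_def by blast
  have "\<bar>- u y - - u x - - v x \<bullet> (y - x)\<bar> \<le> L * (norm (y - x))\<^sup>2"
    if "x \<in> ball p r" "y \<in> ball p r" for x y
  proof -
    have "- u y - - u x - - v x \<bullet> (y - x) = - (u y - u x - v x \<bullet> (y - x))" by simp
    moreover have "\<bar>u y - u x - v x \<bullet> (y - x)\<bar> \<le> L * (norm (y - x))\<^sup>2" using rLv(3) that by blast
    ultimately show ?thesis by (simp only: abs_minus_cancel)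
  qed
  moreover have "norm (- v x) \<le> L" if "x \<in> ball p r" for x using rLv(3) that by simp
  ultimately show "\<exists>r>0. \<exists>L\<ge>0. \<exists>v. \<forall>x\<in>ball p r. norm (v x) \<le> L \<and>
     (\<forall>y\<in>ball p r. \<bar>- u y - - u x - v x \<bullet> (y - x)\<bar> \<le> L * (norm (y - x))\<^sup>2)"
    using rLv(1,2) by (intro exI[of _ r] exI[of _ L] exI[of _ "\<lambda>x. - v x"] conjI ballI)
qed

text \<open>Local constants are merged through a finite subcover of the compact closure. Near a
  boundary point u0 - a has no zero in \<Omega>, since the level set inside \<Omega> is closed in
  the whole space; its sign is then constant, and where it is negative nothing is claimed.\<close>

lemma lower_barrier_exists:
  fixes u0 :: "real^'n::finite \<Rightarrow> real"
  assumes dom: "smooth_bounded_domain \<Omega>"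
    and cont: "continuous_on (closure \<Omega>) u0" and C11: "locally_C11 (closure \<Omega>) u0"
    and level: "closed {x\<in>\<Omega>. u0 x = a}"
  obtains M where "0 < M" "\<And>x. x \<in> \<Omega> \<Longrightarrow> a < u0 x \<Longrightarrow> lower_barrier \<Omega> u0 a K M x"
proof -
  have op: "open \<Omega>" and bd: "bounded \<Omega>" using dom by (auto simp: smooth_bounded_domain_def)
  have comp: "compact (closure \<Omega>)" using bd by (simp add: compact_closure)
  have "\<exists>\<delta>>0. \<exists>M>0. \<forall>x\<in>\<Omega> \<inter> ball p \<delta>. a < u0 x \<longrightarrow> lower_barrier \<Omega> u0 a K M x"
    if p: "p \<in> closure \<Omega>" for p
  proof -
    obtain r0 L0 v0 where r0: "r0 > 0" "L0 \<ge> 0"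
      and v0: "\<And>x. x \<in> ball p r0 \<Longrightarrow> norm (v0 x) \<le> L0"
      and t0: "\<And>x y. x \<in> ball p r0 \<Longrightarrow> y \<in> ball p r0 \<Longrightarrow>
       \<bar>u0 y - u0 x - v0 x \<bullet> (y - x)\<bar> \<le> L0 * (norm (y - x))\<^sup>2"
      using C11 p unfolding locally_C11_def by blast
    define L where "L = L0 + 1"
    have L: "1 \<le> L" "0 \<le> L" using r0 by (auto simp: L_def)
    have v: "norm (v0 x) \<le> L" if "x \<in> ball p r0" for x using v0[OF that] by (simp add: L_def)
    have t: "\<bar>u0 y - u0 x - v0 x \<bullet> (y - x)\<bar> \<le> L * (norm (y - x))\<^sup>2"
      if "x \<in> ball p r0" "y \<in> ball p r0" for x y
      using t0[OF that] by (simp add: L_def distrib_right add_increasing2)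
    define H where "H = 1 + \<bar>u0 p\<bar> + \<bar>a\<bar> + (L * r0 + L * r0\<^sup>2)"
    have "0 \<le> L * r0 + L * r0\<^sup>2" using L r0 by simp
    then have H1: "1 \<le> H" by (simp add: H_def)
    have H: "u0 x \<le> H" "u0 x - a \<le> H" if x: "x \<in> ball p r0" for x
    proof -
      have pr: "p \<in> ball p r0" using r0 by simp
      have n: "norm (x - p) \<le> r0" using x by (simp add: dist_norm norm_minus_commute)
      have "v0 p \<bullet> (x - p) \<le> norm (v0 p) * norm (x - p)" by (rule norm_cauchy_schwarz)
      also have "\<dots> \<le> L * r0" using v[OF pr] n r0 L by (intro mult_mono) auto
      finally have 1: "v0 p \<bullet> (x - p) \<le> L * r0" .
      have "L * (norm (x - p))\<^sup>2 \<le> L * r0\<^sup>2" using n L by (intro mult_left_mono power_mono) auto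
      then have "u0 x \<le> u0 p + L * r0 + L * r0\<^sup>2" using t[OF pr x] 1 by (simp add: abs_le_iff)
      then show "u0 x \<le> H" "u0 x - a \<le> H" unfolding H_def by linarith+
    qed
    show ?thesis
    proof (cases "p \<in> \<Omega>")
      case True
      then obtain r1 where r1: "r1 > 0" "ball p r1 \<subseteq> \<Omega>" using op open_contains_ball by blast
      define r where "r = min r0 r1"
      have r: "0 < r" "ball p r \<subseteq> \<Omega>" "ball p r \<subseteq> ball p r0" using r0 r1 by (auto simp: r_def)
      have 1: "norm (v0 x) \<le> L" "u0 x \<le> H" if "x \<in> ball p r" for x using v H r(3) that by blast+
      have 2: "\<bar>u0 y - u0 x - v0 x \<bullet> (y - x)\<bar> \<le> L * (norm (y - x))\<^sup>2"
        if "x \<in> ball p r" "y \<in> ball p r" for x y using t r(3) that by blast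
      obtain M where "0 < M" "\<And>x. x \<in> ball p (r / 2) \<Longrightarrow> a < u0 x \<Longrightarrow> lower_barrier \<Omega> u0 a K M x"
        using lower_barrier_interior[OF op r(1,2) L(2) 1(1) 2 1(2)] by blast
      then show ?thesis using r(1) by (intro exI[of _ "r / 2"] exI[of _ M] conjI) auto
    next
      case False
      then have fr: "p \<in> frontier \<Omega>" using p op by (simp add: frontier_def interior_open)
      obtain r1 C g N where "boundary_chart \<Omega> p r1 C g N" using boundary_chart_exists[OF dom fr] .
      then interpret c1: boundary_chart \<Omega> p r1 C g N .
      \<comment> \<open>This holds even if u0 p = a, because the set contains points of \<Omega>
        only.\<close>
      have "p \<in> - {x\<in>\<Omega>. u0 x = a}" "open (- {x\<in>\<Omega>. u0 x = a})" using level False by auto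
      then obtain r2 where r2: "r2 > 0" "ball p r2 \<subseteq> - {x\<in>\<Omega>. u0 x = a}" using open_contains_ball by blast
      define r3 where "r3 = min r0 (min r1 r2)"
      have r3: "0 < r3" "r3 \<le> r1" "ball p r3 \<subseteq> ball p r0" "ball p r3 \<subseteq> ball p r2"
        using r0 c1.r_pos r2 by (auto simp: r3_def)
      have chart3: "boundary_chart \<Omega> p r3 C g N"
        by (rule boundary_chart_shrink[OF \<open>boundary_chart \<Omega> p r1 C g N\<close> r3(1,2)])
      then interpret c3: boundary_chart \<Omega> p r3 C g N .
      have "continuous_on (\<Omega> \<inter> ball p r3) (\<lambda>x. u0 x - a)"
        using closure_subset[of \<Omega>] by (intro continuous_intros continuous_on_subset[OF cont]) auto
      moreover have "u0 x - a \<noteq> 0" if "x \<in> \<Omega> \<inter> ball p r3" for x using that r3(4) r2(2) by auto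
      ultimately obtain \<delta> where \<delta>: "0 < \<delta>" "\<delta> \<le> r3"
        "(\<forall>x\<in>\<Omega> \<inter> ball p \<delta>. 0 < u0 x - a) \<or> (\<forall>x\<in>\<Omega> \<inter> ball p \<delta>. u0 x - a < 0)"
        by (rule c3.sign_near_boundary)
      show ?thesis
      proof (cases "\<forall>x\<in>\<Omega> \<inter> ball p \<delta>. 0 < u0 x - a")
        case True
        interpret c4: boundary_chart \<Omega> p \<delta> C g N
          by (rule boundary_chart_shrink[OF chart3 \<delta>(1,2)])
        have sub: "ball p \<delta> \<subseteq> ball p r0" using \<delta>(2) r3(3) by (meson order_trans subset_ball)
        have 1: "norm (v0 x) \<le> L" "u0 x - a \<le> H" if "x \<in> ball p \<delta>" for x using v H sub that by blast+
        have 2: "\<bar>u0 y - u0 x - v0 x \<bullet> (y - x)\<bar> \<le> L * (norm (y - x))\<^sup>2"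
          if "x \<in> ball p \<delta>" "y \<in> ball p \<delta>" for x y using t sub that by blast
        have 3: "a \<le> u0 x" if "x \<in> \<Omega> \<inter> ball p \<delta>" for x using bspec[OF True that] by linarith
        obtain M where "0 < M" "\<And>x. x \<in> \<Omega> \<inter> ball p (\<delta> / 2) \<Longrightarrow> a < u0 x \<Longrightarrow> lower_barrier \<Omega> u0 a K M x"
          using c4.lower_barrier_boundary[OF L(1) 1(1) 2 H1 1(2) 3] by blast
        then show ?thesis using \<delta>(1) by (intro exI[of _ "\<delta> / 2"] exI[of _ M] conjI) auto
      next
        case False
        then have "\<forall>x\<in>\<Omega> \<inter> ball p \<delta>. u0 x - a < 0" using \<delta>(3) by blast
        then show ?thesis using \<delta>(1) by (intro exI[of _ \<delta>] exI[of _ 1] conjI) force+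
      qed
    qed
  qed
  then obtain \<delta> M where \<delta>: "\<And>p. p \<in> closure \<Omega> \<Longrightarrow> 0 < \<delta> p" and M: "\<And>p. p \<in> closure \<Omega> \<Longrightarrow> 0 < M p"
    and bar: "\<And>p x. p \<in> closure \<Omega> \<Longrightarrow> x \<in> \<Omega> \<inter> ball p (\<delta> p) \<Longrightarrow> a < u0 x \<Longrightarrow> lower_barrier \<Omega> u0 a K (M p) x"
    by metis
  have "closure \<Omega> \<subseteq> (\<Union>p\<in>closure \<Omega>. ball p (\<delta> p))" using \<delta> by force
  then obtain S where S: "S \<subseteq> closure \<Omega>" "finite S" "closure \<Omega> \<subseteq> (\<Union>p\<in>S. ball p (\<delta> p))"
    using compactE_image[OF comp, of "closure \<Omega>" "\<lambda>p. ball p (\<delta> p)"] by auto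
  define M0 where "M0 = 1 + (\<Sum>p\<in>S. M p)"
  have nonneg: "0 \<le> M p" if "p \<in> S" for p using M[of p] that S(1) by force
  show thesis
  proof (rule that[of M0])
    show "0 < M0" using sum_nonneg[of S M] nonneg by (simp add: M0_def add_pos_nonneg)
    fix x assume x: "x \<in> \<Omega>" and pos: "a < u0 x"
    then have "x \<in> closure \<Omega>" using closure_subset by blast
    then obtain p where p: "p \<in> S" "x \<in> ball p (\<delta> p)" using S(3) by blast
    have "M p \<le> (\<Sum>p\<in>S. M p)" using p(1) S(2) nonneg by (intro member_le_sum) auto
    then show "lower_barrier \<Omega> u0 a K M0 x"
      using lower_barrier_mono[OF bar[of p x] M[of p] _ pos] p S(1) x pos by (auto simp: M0_def)
  qed
qed

section \<open>Bistable nonlinearities\<close>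

lemma compact_interval_positive_lower_bound:
  fixes F :: "real \<Rightarrow> real"
  assumes "continuous_on {c..d} F" "\<And>y. c \<le> y \<Longrightarrow> y \<le> d \<Longrightarrow> 0 < F y"
  obtains m where "0 < m" "\<And>y. c \<le> y \<Longrightarrow> y \<le> d \<Longrightarrow> m \<le> F y"
proof (cases "c \<le> d")
  case True
  then obtain y0 where y0: "y0 \<in> {c..d}" "\<forall>y\<in>{c..d}. F y0 \<le> F y"
    using continuous_attains_inf[OF compact_Icc _ assms(1)] by auto
  show thesis by (rule that[of "F y0"]) (use y0 assms(2) in auto)
next
  case False
  show thesis by (rule that[of 1]) (use False in auto)
qed

locale bistable =
  fixes f :: "real \<Rightarrow> real \<Rightarrow> real" and a \<mu> :: real
  assumes a_gt: "-1 < a" and a_lt: "a < 1" and \<mu>_pos: "0 < \<mu>"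
    and cont: "continuous_on UNIV (\<lambda>y. f y 0)"
    and pos_left: "y < -1 \<Longrightarrow> 0 < f y 0" and pos_mid: "a < y \<Longrightarrow> y < 1 \<Longrightarrow> 0 < f y 0"
    and neg_right: "1 < y \<Longrightarrow> f y 0 < 0" and neg_mid: "-1 < y \<Longrightarrow> y < a \<Longrightarrow> f y 0 < 0"
    and quadratic: "\<exists>L>0. \<forall>y. \<bar>y\<bar> \<le> r \<longrightarrow> \<bar>f (a + y) 0 - \<mu> * y\<bar> \<le> L * y\<^sup>2"
    and lipschitz: "\<exists>G>0. \<forall>y v. \<bar>y\<bar> \<le> r \<longrightarrow> \<bar>v\<bar> \<le> 1 \<longrightarrow> \<bar>f y v - f y 0\<bar> \<le> G * \<bar>v\<bar>"

lemma bistable_reflect: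
  assumes "bistable f a \<mu>"
  shows "bistable (\<lambda>y v. - f (- y) (- v)) (- a) \<mu>"
proof -
  interpret bistable f a \<mu> by fact
  show ?thesis
  proof
    show "continuous_on UNIV (\<lambda>y. - f (- y) (- 0))"
      using continuous_on_minus[OF continuous_on_compose2[OF cont continuous_on_minus[OF continuous_on_id] subset_UNIV]]
      by simp
    fix r :: real
    obtain L where L: "L > 0" "\<And>y. \<bar>y\<bar> \<le> r \<Longrightarrow> \<bar>f (a + y) 0 - \<mu> * y\<bar> \<le> L * y\<^sup>2"
      using quadratic by blast
    have "\<bar>- f (- (- a + y)) (- 0) - \<mu> * y\<bar> \<le> L * y\<^sup>2" if "\<bar>y\<bar> \<le> r" for y
    proof -
      have "- f (- (- a + y)) (- 0) - \<mu> * y = - (f (a + - y) 0 - \<mu> * - y)" by simp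
      then show ?thesis using L(2)[of "- y"] that by (simp only: abs_minus_cancel power2_minus)
    qed
    then show "\<exists>L>0. \<forall>y. \<bar>y\<bar> \<le> r \<longrightarrow> \<bar>- f (- (- a + y)) (- 0) - \<mu> * y\<bar> \<le> L * y\<^sup>2" using L(1) by blast
    obtain G where G: "G > 0" "\<And>y v. \<bar>y\<bar> \<le> r \<Longrightarrow> \<bar>v\<bar> \<le> 1 \<Longrightarrow> \<bar>f y v - f y 0\<bar> \<le> G * \<bar>v\<bar>"
      using lipschitz by blast
    have "\<bar>- f (- y) (- v) - - f (- y) (- 0)\<bar> \<le> G * \<bar>v\<bar>" if "\<bar>y\<bar> \<le> r" "\<bar>v\<bar> \<le> 1" for y v
      using G(2)[of "- y" "- v"] that by simp
    then show "\<exists>G>0. \<forall>y v. \<bar>y\<bar> \<le> r \<longrightarrow> \<bar>v\<bar> \<le> 1 \<longrightarrow> \<bar>- f (- y) (- v) - - f (- y) (- 0)\<bar> \<le> G * \<bar>v\<bar>"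
      using G(1) by blast
  qed (use a_gt a_lt \<mu>_pos pos_left pos_mid neg_right neg_mid in auto)
qed

lemma (in bistable) relaxation_from_below:
  fixes \<Omega> :: "(real^'n::finite) set"
  assumes dom: "smooth_bounded_domain \<Omega>" and \<eta>: "0 < \<eta>" and K: "0 < K" and V: "0 < V"
  obtains \<epsilon>1 \<kappa> where "0 < \<epsilon>1" "0 < \<kappa>"
    "\<And>\<epsilon> u v T x t. \<lbrakk>0 < \<epsilon>; \<epsilon> < \<epsilon>1; nonlocal_solution \<Omega> f \<epsilon> v u;
       \<And>x. x \<in> closure \<Omega> \<Longrightarrow> - K < u x 0; \<And>t. 0 < t \<Longrightarrow> t \<le> T \<Longrightarrow> \<bar>v t\<bar> \<le> \<epsilon> * V;
       x \<in> closure \<Omega>; 0 \<le> t; t \<le> T\<rbrakk> \<Longrightarrow> -1 - \<eta> - K * exp (- (\<kappa> * t / \<epsilon>\<^sup>2)) < u x t"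
proof -
  \<comment> \<open>The lower end of the strip of half-width \<eta> / 2 around \<psi>, whose values
    lie between -1 - \<eta> - K and -1 - \<eta>.\<close>
  define lo where "lo = -1 - \<eta> - K - \<eta> / 2"
  obtain m where m: "0 < m" "\<And>y. lo \<le> y \<Longrightarrow> y \<le> -1 - \<eta> / 2 \<Longrightarrow> m \<le> f y 0"
  proof (rule compact_interval_positive_lower_bound[of lo "-1 - \<eta> / 2" "\<lambda>y. f y 0"])
    show "continuous_on {lo..-1 - \<eta> / 2} (\<lambda>y. f y 0)" using continuous_on_subset[OF cont] by blast
    show "0 < f y 0" if "y \<le> -1 - \<eta> / 2" for y using pos_left that \<eta> by simp
  qed (use that in blast)
  obtain G where G: "0 < G" "\<And>y v. \<bar>y\<bar> \<le> \<bar>lo\<bar> \<Longrightarrow> \<bar>v\<bar> \<le> 1 \<Longrightarrow> \<bar>f y v - f y 0\<bar> \<le> G * \<bar>v\<bar>"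
    using lipschitz[of "\<bar>lo\<bar>"] by blast
  define \<epsilon>1 where "\<epsilon>1 = min (1 / V) (m / (2 * G * V))"
  define \<kappa> where "\<kappa> = m / (4 * K)"
  show thesis
  proof (rule that[of \<epsilon>1 \<kappa>])
    show "0 < \<epsilon>1" "0 < \<kappa>" using m G V K by (auto simp: \<epsilon>1_def \<kappa>_def)
    fix \<epsilon> T t :: real and u :: "real^'n \<Rightarrow> real \<Rightarrow> real" and v x
    assume \<epsilon>: "0 < \<epsilon>" "\<epsilon> < \<epsilon>1" and sol: "nonlocal_solution \<Omega> f \<epsilon> v u"
      and init: "\<And>x. x \<in> closure \<Omega> \<Longrightarrow> - K < u x 0" and v: "\<And>t. 0 < t \<Longrightarrow> t \<le> T \<Longrightarrow> \<bar>v t\<bar> \<le> \<epsilon> * V"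
      and x: "x \<in> closure \<Omega>" and t: "0 \<le> t" "t \<le> T"
    have \<epsilon>V: "\<epsilon> * V \<le> 1" "G * (\<epsilon> * V) \<le> m / 2"
    proof -
      have "\<epsilon> * V \<le> 1 / V * V" using \<epsilon> V by (intro mult_right_mono) (auto simp: \<epsilon>1_def)
      then show "\<epsilon> * V \<le> 1" using V by simp
      have "\<epsilon> * (2 * G * V) \<le> m / (2 * G * V) * (2 * G * V)"
        using \<epsilon> V G by (intro mult_right_mono) (auto simp: \<epsilon>1_def)
      also have "\<dots> = m" using V G by simp
      finally show "G * (\<epsilon> * V) \<le> m / 2" by (simp add: mult_ac)
    qed
    define \<nu> where "\<nu> = \<kappa> / \<epsilon>\<^sup>2"
    define e where "e t = exp (- (\<nu> * t))" for t
    define \<psi> where "\<psi> t = -1 - \<eta> - K * e t" for t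
    have e: "0 < e t" "0 \<le> t \<Longrightarrow> e t \<le> 1" for t
      using m K \<epsilon> by (auto simp: e_def \<nu>_def \<kappa>_def)
    have "\<psi> t < u x t"
    proof (rule above_spatially_constant[OF dom sol, where T = T and \<psi>' = "\<lambda>t. K * (\<nu> * e t)"
          and \<sigma> = "m / (4 * \<epsilon>\<^sup>2)" and \<tau> = "\<eta> / 2"])
      show "(\<psi> has_real_derivative K * (\<nu> * e t)) (at t)" for t
        unfolding \<psi>_def e_def by (auto intro!: derivative_eq_intros)
      show "continuous_on {0..T} \<psi>" unfolding \<psi>_def e_def by (intro continuous_intros)
      show "0 < m / (4 * \<epsilon>\<^sup>2)" "0 < \<eta> / 2" using m \<epsilon> \<eta> by auto
      show "\<psi> 0 < u x 0" if "x \<in> closure \<Omega>" for x using init[OF that] \<eta> by (simp add: \<psi>_def e_def)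
      show "x \<in> closure \<Omega>" "0 \<le> t" "t \<le> T" using x t by auto
    next
      fix t y assume t: "0 < t" "t \<le> T" and y: "\<bar>y - \<psi> t\<bar> \<le> \<eta> / 2"
      have Ke: "0 < K * e t" "K * e t \<le> K" using e[of t] t K by auto
      then have y2: "lo \<le> y" "y \<le> -1 - \<eta> / 2" using y unfolding lo_def \<psi>_def by linarith+
      then have "\<bar>y\<bar> \<le> \<bar>lo\<bar>" using \<eta> by linarith
      then have "\<bar>f y (v t) - f y 0\<bar> \<le> G * \<bar>v t\<bar>" using v[OF t] \<epsilon>V by (intro G(2)) auto
      also have "\<dots> \<le> G * (\<epsilon> * V)" using G v[OF t] by (intro mult_left_mono) auto
      finally have "m / 2 \<le> f y (v t)" using m(2)[OF y2] \<epsilon>V(2) by linarith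
      then have "1 / \<epsilon>\<^sup>2 * (m / 2) \<le> 1 / \<epsilon>\<^sup>2 * f y (v t)" by (intro mult_left_mono) auto
      moreover have "K * (\<nu> * e t) \<le> m / (4 * \<epsilon>\<^sup>2)"
      proof -
        have "K * (\<nu> * e t) = \<nu> * (K * e t)" by simp
        also have "\<dots> \<le> \<nu> * K" using Ke m K by (intro mult_left_mono) (auto simp: \<nu>_def \<kappa>_def)
        also have "\<dots> = m / (4 * \<epsilon>\<^sup>2)" using K by (simp add: \<nu>_def \<kappa>_def)
        finally show ?thesis .
      qed
      moreover have "1 / \<epsilon>\<^sup>2 * (m / 2) = m / (4 * \<epsilon>\<^sup>2) + m / (4 * \<epsilon>\<^sup>2)" by simp
      ultimately show "K * (\<nu> * e t) + m / (4 * \<epsilon>\<^sup>2) \<le> 1 / \<epsilon>\<^sup>2 * f y (v t)" by linarith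
    qed
    then show "-1 - \<eta> - K * exp (- (\<kappa> * t / \<epsilon>\<^sup>2)) < u x t" by (simp add: \<psi>_def e_def \<nu>_def)
  qed
qed

lemma positive_right_of_zero:
  fixes F :: "real \<Rightarrow> real"
  assumes cont: "continuous_on UNIV F" and F': "(F has_real_derivative D) (at c)" "0 < D" and zero: "F c = 0"
    and y: "c < y" and nz: "\<And>z. c < z \<Longrightarrow> z \<le> y \<Longrightarrow> F z \<noteq> 0"
  shows "0 < F y"
proof -
  obtain d where d: "0 < d" "\<And>h. 0 < h \<Longrightarrow> h < d \<Longrightarrow> F c < F (c + h)"
    using DERIV_pos_inc_right[OF F'] by blast
  define h where "h = min (d / 2) (y - c)"
  have h: "0 < h" "h < d" "c + h \<le> y" using d(1) y by (auto simp: h_def)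
  have "0 < F (c + h)" using d(2)[OF h(1,2)] zero by simp
  moreover have "closed_segment (c + h) y = {c + h..y}" using h(3) by (simp add: closed_segment_eq_real_ivl)
  then have "F z \<noteq> 0" if "z \<in> closed_segment (c + h) y" for z
    using that h(1) by (intro nz) simp_all
  moreover have "continuous_on (closed_segment (c + h) y) F" using continuous_on_subset[OF cont] by blast
  ultimately show ?thesis using positive_along_segment[of "c + h" y F] by blast
qed

section \<open>Generation of interface\<close>

text \<open>Comparison on the set \<zeta> \<ge> z0. At the threshold the profile is below a bound
  \<open>lo\<close> already known for u, so contact needs \<zeta> > z0, a relatively open condition;
  on the sphere \<zeta> < - (K + a) \<le> z0, which keeps the set off the edge of the ball.
  \<open>lo\<close> may depend on \<zeta>, so that one profile can serve as the threshold for the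
  next.\<close>

lemma (in bistable) profile_comparison:
  fixes \<Omega> :: "(real^'n::finite) set" and \<phi> :: "real^'n \<Rightarrow> real" and \<zeta> :: "real^'n \<Rightarrow> real \<Rightarrow> real"
  assumes dom: "smooth_bounded_domain \<Omega>"
    and sol: "nonlocal_solution \<Omega> f \<epsilon> v u"
    and \<epsilon>: "0 < \<epsilon>"
    and time: "\<And>t. 0 \<le> t \<Longrightarrow> t \<le> T \<Longrightarrow> \<epsilon> * exp (\<mu> / \<epsilon>\<^sup>2 * t) \<le> 1"
    and \<phi>_cont: "continuous_on (closure \<Omega> \<inter> cball x0 R) \<phi>"
    and \<phi>_below: "\<And>x. x \<in> closure \<Omega> \<inter> cball x0 R \<Longrightarrow> \<phi> x \<le> u x 0"
    and \<phi>_sphere: "\<And>x. x \<in> closure \<Omega> \<Longrightarrow> dist x0 x = R \<Longrightarrow> \<phi> x \<le> - K"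
    and \<phi>_jet: "\<And>x. x \<in> \<Omega> \<inter> ball x0 R \<Longrightarrow>
        \<exists>d e. axis_jets \<phi> x d e \<and>
          (\<Sum>i\<in>UNIV. (d i)\<^sup>2) \<le> M \<and> - M \<le> (\<Sum>i\<in>UNIV. e i)"
    and \<phi>_normal: "\<And>x. x \<in> frontier \<Omega> \<inter> ball x0 R \<Longrightarrow> inward_increasing \<Omega> \<phi> x"
    and M: "0 \<le> M" and K: "0 \<le> K + a"
    and \<zeta>: "\<And>x t. \<zeta> x t = exp (\<mu> / \<epsilon>\<^sup>2 * t) * (\<phi> x - a)
        - B * (2 * \<epsilon> * exp (\<mu> / \<epsilon>\<^sup>2 * t) - \<epsilon> + (\<epsilon> * exp (\<mu> / \<epsilon>\<^sup>2 * t))\<^sup>2)"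
    and B: "0 < B" "B1 + M \<le> \<mu> * B" "C * M \<le> \<mu> * B"
    and lower: "\<And>x t. x \<in> closure \<Omega> \<inter> cball x0 R \<Longrightarrow> 0 \<le> t \<Longrightarrow> t \<le> T \<Longrightarrow> z0 \<le> \<zeta> x t \<Longrightarrow> lo (\<zeta> x t) < u x t"
    and z0: "\<Phi> z0 \<le> lo z0" "- (K + a) \<le> z0"
    and \<Phi>: "\<And>z. z0 < z \<Longrightarrow> (\<Phi> has_real_derivative \<Phi>1 z) (at z)"
      "\<And>z. z0 < z \<Longrightarrow> (\<Phi>1 has_real_derivative \<Phi>2 z) (at z)"
      "\<And>z. z0 < z \<Longrightarrow> 0 < \<Phi>1 z" "\<And>z. z0 < z \<Longrightarrow> \<bar>\<Phi>2 z\<bar> \<le> C * \<Phi>1 z"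
    and \<Phi>_cont: "continuous_on {z0..} \<Phi>"
    and \<Phi>_init: "\<And>z. z0 \<le> z \<Longrightarrow> \<Phi> z \<le> a + z"
    and \<Phi>_ineq: "\<And>z. z0 < z \<Longrightarrow> lo z < \<Phi> z \<Longrightarrow> \<mu> * z * \<Phi>1 z + G * \<epsilon> < f (\<Phi> z) 0 + \<Phi>1 z * (B1 * \<epsilon>)"
    and reaction: "\<And>z t. 0 < t \<Longrightarrow> t \<le> T \<Longrightarrow> z0 < z \<Longrightarrow> f (\<Phi> z) 0 - G * \<epsilon> \<le> f (\<Phi> z) (v t)"
    and x: "x \<in> closure \<Omega> \<inter> cball x0 R" and t: "0 \<le> t" "t \<le> T" and active: "z0 \<le> \<zeta> x t"
  shows "\<Phi> (\<zeta> x t) < u x t"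
proof -
  have op: "open \<Omega>" and bd: "bounded \<Omega>" using dom by (auto simp: smooth_bounded_domain_def)
  define E where "E t = exp (\<mu> / \<epsilon>\<^sup>2 * t)" for t
  define p where "p t = B * (2 * \<epsilon> * E t - \<epsilon> + (\<epsilon> * E t)\<^sup>2)" for t
  have E: "0 < E t" for t by (simp add: E_def)
  have E1: "1 \<le> E t" if "0 \<le> t" for t using that \<mu>_pos by (simp add: E_def)
  have p: "0 < p t" if "0 \<le> t" for t
  proof -
    have "\<epsilon> * 1 \<le> \<epsilon> * E t" using E1[OF that] \<epsilon> by (intro mult_left_mono) auto
    then have "0 < 2 * \<epsilon> * E t - \<epsilon>" using \<epsilon> by linarith
    then show ?thesis using B(1) by (auto simp: p_def intro!: mult_pos_pos add_pos_nonneg)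
  qed
  have \<zeta>': "\<zeta> x t = E t * (\<phi> x - a) - p t" for x t using \<zeta> by (simp add: E_def p_def)
  define D where "D = (closure \<Omega> \<inter> cball x0 R) \<times> {0..T}"
  define A where "A = {z\<in>D. z0 \<le> (\<lambda>(x, t). \<zeta> x t) z}"
  have compD: "compact D" unfolding D_def using bd by (intro compact_Times compact_Int) (auto simp: compact_closure)
  have \<zeta>cont: "continuous_on D (\<lambda>(x, t). \<zeta> x t)"
    unfolding D_def \<zeta>' E_def p_def case_prod_unfold
    by (intro continuous_intros continuous_on_compose2[OF \<phi>_cont]) auto
  have "closed A"
    unfolding A_def using continuous_on_closed_Collect_le[OF continuous_on_const \<zeta>cont] compD compact_imp_closed by blast
  moreover have "D \<inter> A = A" by (auto simp: A_def)
  ultimately have compA: "compact A" using compact_Int_closed[OF compD, of A] by simp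
  have AD: "x \<in> closure \<Omega>" "x \<in> cball x0 R" "0 \<le> t" "t \<le> T" "z0 \<le> \<zeta> x t" if "(x, t) \<in> A" for x t
    using that by (auto simp: A_def D_def)
  have inside: "dist x0 x < R" if "(x, t) \<in> A" for x t
  proof (rule ccontr)
    note xt = AD[OF that]
    assume "\<not> dist x0 x < R"
    then have "\<phi> x - a \<le> - (K + a)" using \<phi>_sphere[OF xt(1)] xt(2) by simp
    then have "E t * (\<phi> x - a) \<le> 1 * - (K + a)"
      using E1[OF xt(3)] K mult_mono[of 1 "E t" "K + a" "a - \<phi> x"] by (simp add: algebra_simps)
    then have "\<zeta> x t < - (K + a)" using p[OF xt(3)] by (simp add: \<zeta>')
    then show False using z0(2) xt(5) by linarith
  qed
  have strict: "z0 < \<zeta> x t" if "(x, t) \<in> A" "u x t \<le> \<Phi> (\<zeta> x t)" for x t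
  proof -
    note xt = AD[OF that(1)]
    have "lo (\<zeta> x t) < u x t" using lower[of x t] xt by auto
    then have "\<zeta> x t \<noteq> z0" using z0(1) that(2) by auto
    then show ?thesis using xt(5) by simp
  qed
  show ?thesis
  proof (rule reaction_solution_comparison[OF sol op compA, of "\<lambda>x t. \<Phi> (\<zeta> x t)"])
    show "A \<subseteq> closure \<Omega> \<times> {0..}" by (auto simp: A_def D_def)
    have "continuous_on A (\<lambda>z. \<Phi> ((\<lambda>(x, t). \<zeta> x t) z))"
      by (rule continuous_on_compose2[OF \<Phi>_cont continuous_on_subset[OF \<zeta>cont]]) (auto simp: A_def)
    then show "continuous_on A (\<lambda>(x, t). \<Phi> (\<zeta> x t))" by (simp add: case_prod_unfold)
    show "\<Phi> (\<zeta> x 0) < u x 0" if "(x, 0) \<in> A" for x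
    proof -
      note xt = AD[OF that]
      have "\<Phi> (\<zeta> x 0) \<le> a + \<zeta> x 0" using \<Phi>_init xt(5) .
      also have "\<dots> < \<phi> x" using p[of 0] by (simp add: \<zeta>' E_def)
      also have "\<dots> \<le> u x 0" using \<phi>_below xt by auto
      finally show ?thesis .
    qed
    show "(x, t) \<in> A" using x t active by (auto simp: A_def D_def)
  next
    fix x t assume xt: "(x, t) \<in> A" and t: "0 < t" and above: "u x t \<le> \<Phi> (\<zeta> x t)"
    have xtD: "(x, t) \<in> D" using xt by (simp add: A_def)
    have "0 < \<zeta> x t - z0" using strict[OF xt above] by simp
    with bspec[OF \<zeta>cont[unfolded continuous_on_iff] xtD]
    have "\<exists>\<delta>>0. \<forall>z\<in>D. dist z (x, t) < \<delta> \<longrightarrow> dist ((\<lambda>(x, t). \<zeta> x t) z) (\<zeta> x t) < \<zeta> x t - z0" by simp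
    then obtain \<delta> where \<delta>: "\<delta> > 0"
      "\<And>z. z \<in> D \<Longrightarrow> dist z (x, t) < \<delta> \<Longrightarrow> dist ((\<lambda>(x, t). \<zeta> x t) z) (\<zeta> x t) < \<zeta> x t - z0"
      by blast
    define \<delta>' where "\<delta>' = min (\<delta> / 2) (min t (R - dist x0 x))"
    have \<delta>': "0 < \<delta>'" "\<delta>' \<le> t" "\<delta>' \<le> R - dist x0 x" "\<delta>' + \<delta>' \<le> \<delta>"
      using \<delta>(1) t inside[OF xt] by (auto simp: \<delta>'_def min_def)
    have "(y, s) \<in> A" if y: "y \<in> closure \<Omega>" and d: "dist y x < \<delta>'" and s: "t - \<delta>' < s" "s \<le> t" for y s
    proof -
      have "y \<in> cball x0 R" using dist_triangle[of x0 y x] d \<delta>'(3) by (simp add: dist_commute)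
      then have yD: "(y, s) \<in> D" using y s \<delta>'(2) AD(4)[OF xt] by (auto simp: D_def)
      have "dist (y, s) (x, t) \<le> dist y x + dist s t"
        unfolding dist_Pair_Pair by (rule sqrt_sum_squares_le_sum) auto
      also have "\<dots> < \<delta>" using d s \<delta>'(4) by (simp add: dist_real_def)
      finally have "dist (\<zeta> y s) (\<zeta> x t) < \<zeta> x t - z0" using \<delta>(2)[OF yD] by simp
      then have "z0 \<le> \<zeta> y s" by (simp add: dist_real_def abs_less_iff)
      then show ?thesis using yD by (simp add: A_def)
    qed
    then show "\<exists>\<delta>>0. \<forall>y\<in>closure \<Omega>. \<forall>s. dist y x < \<delta> \<longrightarrow> t - \<delta> < s \<longrightarrow> s \<le> t \<longrightarrow> (y, s) \<in> A"
      using \<delta>'(1) by blast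
  next
    fix x t assume xt: "(x, t) \<in> A" and x\<Omega>: "x \<in> \<Omega>" and t: "0 < t" and eq: "\<Phi> (\<zeta> x t) = u x t"
    note facts = AD[OF xt]
    define z where "z = \<zeta> x t"
    have z: "z0 < z" using strict[OF xt] eq by (simp add: z_def)
    have lo: "lo z < \<Phi> z" using lower[of x t] facts eq by (auto simp: z_def)
    obtain d e where de: "\<And>i. jet2 (\<lambda>s. \<phi> (x + s *\<^sub>R axis i 1)) (d i) (e i)"
          "(\<Sum>i\<in>UNIV. (d i)\<^sup>2) \<le> M" "- M \<le> (\<Sum>i\<in>UNIV. e i)"
      using \<phi>_jet[of x] x\<Omega> inside[OF xt] by auto
    have ev: "\<forall>\<^sub>F y in nhds z. (\<Phi> has_real_derivative \<Phi>1 y) (at y)"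
      using eventually_nhds_in_open[OF open_greaterThan, of z z0] z by (auto elim!: eventually_mono intro: \<Phi>(1))
    define P Q where "P = (\<Sum>i\<in>UNIV. e i)" and "Q = (\<Sum>i\<in>UNIV. (d i)\<^sup>2)"
    \<comment> \<open>The time derivative of \<zeta>, by the choice of the correction. The loss B
      \<epsilon> pays for the Laplacian of \<phi> and for \<open>B1\<close>, the loss B (\<epsilon>
      E)^2 for the term with \<Phi>2 and the squared gradient.\<close>
    define \<zeta>t where "\<zeta>t = \<mu> / \<epsilon>\<^sup>2 * (z - B * \<epsilon> - B * (\<epsilon> * E t)\<^sup>2)"
    have jet: "jet2 (\<lambda>s. \<Phi> (\<zeta> (x + s *\<^sub>R axis i 1) t)) (\<Phi>1 z * (E t * d i))
        (\<Phi>1 z * (E t * e i) + \<Phi>2 z * (E t * d i)\<^sup>2)" for i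
    proof -
      have "jet2 (\<lambda>s. E t * (\<phi> (x + s *\<^sub>R axis i 1) - a) - p t) (E t * (d i - 0) - 0) (E t * (e i - 0) - 0)"
        by (intro jet2_diff jet2_cmult jet2_const de)
      then have "jet2 (\<lambda>s. \<zeta> (x + s *\<^sub>R axis i 1) t) (E t * d i) (E t * e i)" by (simp add: \<zeta>')
      from jet2_comp[OF this, of \<Phi> \<Phi>1 "\<Phi>2 z"] show ?thesis using ev \<Phi>(2)[OF z] by (simp add: z_def)
    qed
    have "((\<lambda>t. exp (c * t)) has_real_derivative c * exp (c * t)) (at t)" for c :: real
      by (auto intro!: derivative_eq_intros)
    then have Et: "(E has_real_derivative \<mu> / \<epsilon>\<^sup>2 * E t) (at t)" unfolding E_def .
    define \<nu> where "\<nu> = \<mu> / \<epsilon>\<^sup>2"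
    have "((\<lambda>t. E t * (\<phi> x - a) - p t) has_real_derivative
        \<nu> * (E t * (\<phi> x - a) - B * (2 * \<epsilon> * E t + 2 * (\<epsilon> * E t)\<^sup>2))) (at t)"
      unfolding p_def
      by (rule derivative_eq_intros Et[folded \<nu>_def] refl)+ (simp add: algebra_simps power2_eq_square)
    moreover have "E t * (\<phi> x - a) - B * (2 * \<epsilon> * E t + 2 * (\<epsilon> * E t)\<^sup>2) = z - B * \<epsilon> - B * (\<epsilon> * E t)\<^sup>2"
      by (simp add: z_def \<zeta>' p_def algebra_simps)
    ultimately have \<zeta>_t: "(\<zeta> x has_real_derivative \<zeta>t) (at t)" by (simp add: \<zeta>t_def \<zeta>'[abs_def] \<nu>_def)
    have time_der: "((\<lambda>t. \<Phi> (\<zeta> x t)) has_real_derivative \<Phi>1 z * \<zeta>t) (at t)"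
      using DERIV_chain2[OF _ \<zeta>_t, of \<Phi> "\<Phi>1 z"] \<Phi>(1)[OF z] by (simp add: z_def)
    have sum: "(\<Sum>i\<in>UNIV. \<Phi>1 z * (E t * e i) + \<Phi>2 z * (E t * d i)\<^sup>2) = \<Phi>1 z * E t * P + \<Phi>2 z * (E t)\<^sup>2 * Q"
      by (simp add: P_def Q_def sum.distrib sum_distrib_left power_mult_distrib mult.assoc)
    have ineq: "\<Phi>1 z * \<zeta>t < \<Phi>1 z * E t * P + \<Phi>2 z * (E t)\<^sup>2 * Q + 1 / \<epsilon>\<^sup>2 * f (\<Phi> z) (v t)"
    proof -
      define q where "q = \<Phi>1 z"
      define w where "w = (\<epsilon> * E t)\<^sup>2"
      have q: "0 < q" using \<Phi>(3)[OF z] by (simp add: q_def)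
      have w: "0 \<le> w" by (simp add: w_def)
      have \<epsilon>E: "0 \<le> \<epsilon> * E t" "\<epsilon> * E t \<le> 1" using time[of t] t facts \<epsilon> E[of t] by (auto simp: E_def)
      \<comment> \<open>Since \<epsilon> E \<le> 1 up to time T, the factor \<epsilon>^2 E is at
        most \<epsilon>.\<close>
      have 1: "- (q * \<epsilon> * M) \<le> q * (\<epsilon>\<^sup>2 * E t) * P"
      proof -
        have "\<epsilon>\<^sup>2 * E t = \<epsilon> * (\<epsilon> * E t)" by (simp add: power2_eq_square)
        also have "\<dots> \<le> \<epsilon> * 1" using \<epsilon>E \<epsilon> by (intro mult_left_mono) auto
        finally have "q * (\<epsilon>\<^sup>2 * E t) * M \<le> q * (\<epsilon> * 1) * M"
          using q M by (intro mult_right_mono mult_left_mono) auto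
        moreover have "q * (\<epsilon>\<^sup>2 * E t) * - M \<le> q * (\<epsilon>\<^sup>2 * E t) * P"
          using de(3) q E[of t] by (intro mult_left_mono) (auto simp: P_def)
        ultimately show ?thesis by simp
      qed
      have 2: "- (C * q * w * M) \<le> \<Phi>2 z * w * Q"
      proof -
        have Q: "0 \<le> Q" "Q \<le> M" using de(2) by (auto simp: Q_def sum_nonneg)
        have "\<bar>\<Phi>2 z * w * Q\<bar> \<le> (C * q) * w * M"
          unfolding abs_mult using \<Phi>(4)[OF z] Q w q by (intro mult_mono) (auto simp: q_def intro: order_trans[OF abs_ge_zero])
        then show ?thesis by (simp add: abs_le_iff)
      qed
      have 3: "\<mu> * z * q < f (\<Phi> z) (v t) + q * (B1 * \<epsilon>)"
        using \<Phi>_ineq[OF z lo] reaction[OF t facts(4) z] by (simp add: q_def)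
      have 4: "q * \<epsilon> * (B1 + M) \<le> q * \<epsilon> * (\<mu> * B)" using B(2) q \<epsilon> by (intro mult_left_mono) auto
      have 5: "q * w * (C * M) \<le> q * w * (\<mu> * B)" using B(3) q w by (intro mult_left_mono) auto
      \<comment> \<open>The subsolution inequality times \<epsilon>^2. Facts 4 and 5 absorb the
        errors in 1 and 2, and strictness comes from 3.\<close>
      have "\<mu> * z * q - \<mu> * B * \<epsilon> * q - \<mu> * B * w * q < q * (\<epsilon>\<^sup>2 * E t) * P + \<Phi>2 z * w * Q + f (\<Phi> z) (v t)"
        using 1 2 3 4 5 by (simp add: algebra_simps)
      moreover have "\<epsilon>\<^sup>2 * (q * \<zeta>t) = \<mu> * z * q - \<mu> * B * \<epsilon> * q - \<mu> * B * w * q"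
        using \<epsilon> by (simp add: \<zeta>t_def w_def algebra_simps)
      moreover have "\<epsilon>\<^sup>2 * (q * E t * P + \<Phi>2 z * (E t)\<^sup>2 * Q + 1 / \<epsilon>\<^sup>2 * f (\<Phi> z) (v t))
         = q * (\<epsilon>\<^sup>2 * E t) * P + \<Phi>2 z * w * Q + f (\<Phi> z) (v t)"
        using \<epsilon> by (simp add: w_def power_mult_distrib algebra_simps)
      ultimately have "\<epsilon>\<^sup>2 * (q * \<zeta>t) < \<epsilon>\<^sup>2 * (q * E t * P + \<Phi>2 z * (E t)\<^sup>2 * Q + 1 / \<epsilon>\<^sup>2 * f (\<Phi> z) (v t))" by simp
      then show ?thesis using \<epsilon> by (simp add: q_def)
    qed
    show "\<exists>d e \<omega>t. axis_jets (\<lambda>z. \<Phi> (\<zeta> z t)) x d e \<and>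
          ((\<lambda>t. \<Phi> (\<zeta> x t)) has_real_derivative \<omega>t) (at t) \<and>
          \<omega>t < (\<Sum>i\<in>UNIV. e i) + 1 / \<epsilon>\<^sup>2 * f (u x t) (v t)"
      by (intro exI conjI allI, rule jet, rule time_der) (use ineq sum eq in \<open>simp add: z_def\<close>)
  next
    fix x t assume xt: "(x, t) \<in> A" and xf: "x \<in> frontier \<Omega>" and t: "0 < t" and eq: "\<Phi> (\<zeta> x t) = u x t"
    have z: "z0 < \<zeta> x t" using strict[OF xt] eq by simp
    obtain n D where n: "outer_unit_normal \<Omega> x n" "0 < D"
        "((\<lambda>h. \<phi> (x - h *\<^sub>R n)) has_real_derivative D) (at_right 0)"
        "\<forall>\<^sub>F h in at_right 0. x - h *\<^sub>R n \<in> closure \<Omega>"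
      using \<phi>_normal[of x] xf inside[OF xt] by auto
    have "((\<lambda>h. \<zeta> (x - h *\<^sub>R n) t) has_real_derivative E t * D) (at_right 0)"
      unfolding \<zeta>' by (rule derivative_eq_intros n(3) refl)+ simp
    from DERIV_chain2[OF _ this, of \<Phi> "\<Phi>1 (\<zeta> x t)"]
    have "((\<lambda>h. \<Phi> (\<zeta> (x - h *\<^sub>R n) t)) has_real_derivative \<Phi>1 (\<zeta> x t) * (E t * D)) (at_right 0)"
      using \<Phi>(1)[OF z] by simp
    moreover have "0 < \<Phi>1 (\<zeta> x t) * (E t * D)" using \<Phi>(3)[OF z] E n(2) by simp
    ultimately show "inward_increasing \<Omega> (\<lambda>z. \<Phi> (\<zeta> z t)) x"
      using n by blast
  qed
qed

text \<open>With y = P z - a the first profile satisfies \<mu> z P' z = \<mu> y - \<mu> L y^2, so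
  the expansion of f at a is all it needs. S takes over at z = 2: wherever it exceeds P, its values
  lie in an interval on which f is at least s2, while \<mu> z S' z \<le> \<mu> q (b - a) can be made
  small through q.\<close>

lemma (in bistable) generation_from_below:
  fixes \<Omega> :: "(real^'n::finite) set"
  assumes dom: "smooth_bounded_domain \<Omega>" and \<eta>: "0 < \<eta>" "\<eta> < 1 - a"
    and M: "0 < M" and K: "1 \<le> K" and V: "0 < V"
  obtains \<epsilon>2 M0 where "0 < \<epsilon>2" "0 < M0"
    "\<And>\<epsilon> u v x0. \<lbrakk>0 < \<epsilon>; \<epsilon> < \<epsilon>2; nonlocal_solution \<Omega> f \<epsilon> v u;
       \<And>x t. x \<in> closure \<Omega> \<Longrightarrow> 0 \<le> t \<Longrightarrow> - K < u x t;
       \<And>t. 0 < t \<Longrightarrow> \<bar>v t\<bar> \<le> \<epsilon> * V; x0 \<in> \<Omega>;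
       lower_barrier \<Omega> (\<lambda>x. u x 0) a K M x0; a + M0 * \<epsilon> \<le> u x0 0\<rbrakk>
       \<Longrightarrow> 1 - \<eta> \<le> u x0 (inverse \<mu> * \<epsilon>\<^sup>2 * \<bar>ln \<epsilon>\<bar>)"
proof -
  obtain L0 where L0: "L0 > 0" "\<And>y. \<bar>y\<bar> \<le> K + 2 \<Longrightarrow> \<bar>f (a + y) 0 - \<mu> * y\<bar> \<le> L0 * y\<^sup>2"
    using quadratic by blast
  obtain G0 where G0: "G0 > 0" "\<And>y v. \<bar>y\<bar> \<le> K + 2 \<Longrightarrow> \<bar>v\<bar> \<le> 1 \<Longrightarrow> \<bar>f y v - f y 0\<bar> \<le> G0 * \<bar>v\<bar>"
    using lipschitz by blast
  \<comment> \<open>Ensures L0 \<le> \<mu> L / 2: half of the loss \<mu> L y^2 covers the quadratic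
    error of f, the other half remains as slack.\<close>
  define L where "L = 1 + 2 * L0 / \<mu>"
  have L: "1 \<le> L" "L0 \<le> \<mu> * (L / 2)" using L0(1) \<mu>_pos by (auto simp: L_def field_simps)
  define G where "G = G0 * V"
  have G: "0 < G" using G0 V by (simp add: G_def)
  have Ka: "0 < K + a" using K a_gt by simp
  \<comment> \<open>Bounds 1 / (1 + L z) for z \<ge> \<open>zL\<close>, close to the pole at - 1 /
    L; then |P''| / P' = 2 L / (1 + L z) is at most \<open>C\<close>.\<close>
  define \<kappa> where "\<kappa> = 1 + L * (K + a)"
  have \<kappa>: "1 \<le> \<kappa>" using L Ka by (simp add: \<kappa>_def)
  define C where "C = 2 * L * \<kappa>"
  have C: "2 \<le> C" using mult_mono[of 1 L 1 \<kappa>] L \<kappa> by (simp add: C_def)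
  \<comment> \<open>For z > 1 one has y \<ge> 1 / (1 + L), so the slack is at least s1. For z \<le>
    1 the slack may vanish, but P' \<ge> 1 / (1 + L)^2 there, and \<open>B1\<close> makes P' B1
    \<epsilon> exceed G \<epsilon>.\<close>
  define s1 where "s1 = \<mu> * (L / 2) * (1 / (1 + L))\<^sup>2"
  have s1: "0 < s1" using L \<mu>_pos by (simp add: s1_def)
  define B1 where "B1 = (G + 1) * (1 + L)\<^sup>2"
  have B1: "0 < B1" using G L by (simp add: B1_def)
  define B where "B = (B1 + M + C * M) / \<mu>"
  have \<mu>B: "\<mu> * B = B1 + M + C * M" using \<mu>_pos by (simp add: B_def)
  have B: "0 < B" "B1 + M \<le> \<mu> * B" "C * M \<le> \<mu> * B"
  proof -
    have "0 < C * M" using C M by simp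
    then show "B1 + M \<le> \<mu> * B" "C * M \<le> \<mu> * B" unfolding \<mu>B using M B1 by linarith+
    show "0 < B" unfolding B_def using \<open>0 < C * M\<close> M B1 \<mu>_pos by (intro divide_pos_pos) linarith+
  qed
  define b where "b = 1 - \<eta> / 2"
  have b: "a < b" "b < 1" using \<eta> by (auto simp: b_def)
  \<comment> \<open>The height P 2 - a reached by the first profile where the second takes
    over.\<close>
  define y1 where "y1 = 2 / (1 + 2 * L)"
  have y1: "0 < y1" using L by (simp add: y1_def)
  obtain s2 where s2: "0 < s2" "\<And>y. a + y1 \<le> y \<Longrightarrow> y \<le> b \<Longrightarrow> s2 \<le> f y 0"
  proof (rule compact_interval_positive_lower_bound[of "a + y1" b "\<lambda>y. f y 0"])
    show "continuous_on {a + y1..b} (\<lambda>y. f y 0)" using continuous_on_subset[OF cont] by blast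
    show "0 < f y 0" if "a + y1 \<le> y" "y \<le> b" for y using that y1 b by (intro pos_mid) auto
  qed (use that in blast)
  \<comment> \<open>Slow enough that \<mu> z S' z \<le> s2 / 2, which leaves s2 / 2 for the nonlocal
    error.\<close>
  define q where "q = min 1 (s2 / (2 * \<mu> * (b - a)))"
  have q: "0 < q" "q \<le> 1" "\<mu> * (q * (b - a)) \<le> s2 / 2"
  proof -
    have d: "0 < 2 * \<mu> * (b - a)" using \<mu>_pos b by simp
    show "0 < q" "q \<le> 1" using s2 d by (auto simp: q_def)
    have "q * (2 * \<mu> * (b - a)) \<le> s2 / (2 * \<mu> * (b - a)) * (2 * \<mu> * (b - a))"
      using d by (intro mult_right_mono) (auto simp: q_def)
    also have "\<dots> = s2" using d by (intro nonzero_eq_divide_eq[THEN iffD1]) auto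
    finally have "q * (2 * \<mu> * (b - a)) \<le> s2" .
    moreover have "q * (2 * \<mu> * (b - a)) = 2 * (\<mu> * (q * (b - a)))" by simp
    ultimately show "\<mu> * (q * (b - a)) \<le> s2 / 2" by linarith
  qed
  define \<theta> where "\<theta> = \<eta> / 2 / (b - a)"
  have \<theta>: "0 < \<theta>" "(b - a) * \<theta> = \<eta> / 2"
  proof -
    show "0 < \<theta>" using \<eta> b by (simp add: \<theta>_def)
    have "\<theta> * (b - a) = \<eta> / 2" unfolding \<theta>_def using b by (intro nonzero_eq_divide_eq[THEN iffD1]) auto
    then show "(b - a) * \<theta> = \<eta> / 2" by (simp add: mult.commute)
  qed
  \<comment> \<open>From z = Z on, the gap b - S z is at most \<eta> / 2; with b = 1 - \<eta> / 2
    this gives S z \<ge> 1 - \<eta>.\<close>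
  define Z where "Z = 2 * exp (\<bar>ln \<theta>\<bar> / q)"
  have Z: "2 \<le> Z" using q by (simp add: Z_def)
  \<comment> \<open>3 B dominates the correction at the final time, and the factor M undoes the
    share lost at the centre of the barrier.\<close>
  define M0 where "M0 = M * (3 * B + Z)"
  define \<epsilon>2 where "\<epsilon>2 = min (min 1 (1 / V)) (min (s1 / G) (s2 / (2 * G)))"
  show thesis
  proof (rule that[of \<epsilon>2 M0])
    show "0 < \<epsilon>2" "0 < M0" using V G s1 s2 M B Z by (auto simp: \<epsilon>2_def M0_def)
    fix \<epsilon> :: real and u :: "real^'n \<Rightarrow> real \<Rightarrow> real" and v x0
    assume \<epsilon>: "0 < \<epsilon>" "\<epsilon> < \<epsilon>2" and sol: "nonlocal_solution \<Omega> f \<epsilon> v u"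
      and above: "\<And>x t. x \<in> closure \<Omega> \<Longrightarrow> 0 \<le> t \<Longrightarrow> - K < u x t"
      and v: "\<And>t. 0 < t \<Longrightarrow> \<bar>v t\<bar> \<le> \<epsilon> * V" and x0: "x0 \<in> \<Omega>"
      and barrier: "lower_barrier \<Omega> (\<lambda>x. u x 0) a K M x0" and start: "a + M0 * \<epsilon> \<le> u x0 0"
    have small: "\<epsilon> < 1" "\<epsilon> * V \<le> 1" "G * \<epsilon> < s1" "G * \<epsilon> < s2 / 2"
    proof -
      show "\<epsilon> < 1" using \<epsilon> by (simp add: \<epsilon>2_def)
      have "\<epsilon> < 1 / V" "\<epsilon> < s1 / G" "\<epsilon> < s2 / (2 * G)" using \<epsilon> by (auto simp: \<epsilon>2_def)
      then show "\<epsilon> * V \<le> 1" "G * \<epsilon> < s1" "G * \<epsilon> < s2 / 2" using V G by (auto simp: field_simps)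
    qed
    define T where "T = inverse \<mu> * \<epsilon>\<^sup>2 * \<bar>ln \<epsilon>\<bar>"
    have T: "0 \<le> T" "\<mu> / \<epsilon>\<^sup>2 * T = - ln \<epsilon>"
    proof -
      show "0 \<le> T" using \<mu>_pos by (simp add: T_def)
      have "\<mu> / \<epsilon>\<^sup>2 * T = \<bar>ln \<epsilon>\<bar>" using \<mu>_pos \<epsilon>(1) by (simp add: T_def)
      then show "\<mu> / \<epsilon>\<^sup>2 * T = - ln \<epsilon>" using \<epsilon>(1) small(1) by simp
    qed
    have ET: "exp (\<mu> / \<epsilon>\<^sup>2 * T) = 1 / \<epsilon>" unfolding T(2) using \<epsilon> by (simp add: exp_minus inverse_eq_divide)
    have time: "\<epsilon> * exp (\<mu> / \<epsilon>\<^sup>2 * t) \<le> 1" if "0 \<le> t" "t \<le> T" for t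
    proof -
      have "exp (\<mu> / \<epsilon>\<^sup>2 * t) \<le> 1 / \<epsilon>"
        unfolding ET[symmetric] exp_le_cancel_iff using that \<mu>_pos by (intro mult_left_mono) auto
      then have "\<epsilon> * exp (\<mu> / \<epsilon>\<^sup>2 * t) \<le> \<epsilon> * (1 / \<epsilon>)" using \<epsilon>(1) by (rule mult_left_mono[OF _ less_imp_le])
      then show ?thesis using \<epsilon> by simp
    qed
    have reaction: "f y 0 - G * \<epsilon> \<le> f y (v t)" if "\<bar>y\<bar> \<le> K + 2" "0 < t" for y t
    proof -
      have "\<bar>f y (v t) - f y 0\<bar> \<le> G0 * \<bar>v t\<bar>" using G0(2)[OF that(1), of "v t"] v[OF that(2)] small(2) by linarith
      also have "\<dots> \<le> G0 * (\<epsilon> * V)" using G0(1) v[OF that(2)] by (intro mult_left_mono) auto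
      finally show ?thesis by (simp add: G_def mult_ac abs_le_iff)
    qed
    obtain R \<phi> where R: "0 < R" and \<phi>: "continuous_on (closure \<Omega> \<inter> cball x0 R) \<phi>"
      "\<And>x. x \<in> closure \<Omega> \<inter> cball x0 R \<Longrightarrow> \<phi> x \<le> u x 0"
      "\<And>x. x \<in> closure \<Omega> \<Longrightarrow> dist x0 x = R \<Longrightarrow> \<phi> x \<le> - K"
      "\<And>x. x \<in> \<Omega> \<inter> ball x0 R \<Longrightarrow> \<exists>d e. axis_jets \<phi> x d e \<and>
          (\<Sum>i\<in>UNIV. (d i)\<^sup>2) \<le> M \<and> - M \<le> (\<Sum>i\<in>UNIV. e i)"
      "\<And>x. x \<in> frontier \<Omega> \<inter> ball x0 R \<Longrightarrow> inward_increasing \<Omega> \<phi> x"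
      and \<phi>0: "a + (u x0 0 - a) / M \<le> \<phi> x0"
      using barrier unfolding lower_barrier_def by (elim exE conjE) blast
    define \<zeta> where "\<zeta> x t = exp (\<mu> / \<epsilon>\<^sup>2 * t) * (\<phi> x - a)
        - B * (2 * \<epsilon> * exp (\<mu> / \<epsilon>\<^sup>2 * t) - \<epsilon> + (\<epsilon> * exp (\<mu> / \<epsilon>\<^sup>2 * t))\<^sup>2)" for x t
    note comparison = profile_comparison[where T = T and G = G, OF dom sol \<epsilon>(1) time \<phi> less_imp_le[OF M] less_imp_le[OF Ka] \<zeta>_def B]
    \<comment> \<open>The solution of P zL = - K to the right of the pole: the bound u > - K starts
      the first comparison.\<close>
    define zL where "zL = - ((K + a) / \<kappa>)"
    have zL: "1 + L * zL = 1 / \<kappa>" "- (K + a) \<le> zL" "zL < 0"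
    proof -
      show "1 + L * zL = 1 / \<kappa>" using \<kappa> by (simp add: zL_def \<kappa>_def field_simps)
      have "(K + a) / \<kappa> \<le> (K + a) / 1" using \<kappa> Ka by (intro divide_left_mono) auto
      then show "- (K + a) \<le> zL" by (simp add: zL_def)
      show "zL < 0" using \<kappa> Ka by (simp add: zL_def divide_neg_pos)
    qed
    have den: "1 / \<kappa> \<le> 1 + L * z" "0 < 1 + L * z" if "zL \<le> z" for z
    proof -
      have "L * zL \<le> L * z" using that L by (intro mult_left_mono) auto
      then show "1 / \<kappa> \<le> 1 + L * z" using zL(1) by linarith
      then show "0 < 1 + L * z" using \<kappa> by (smt (verit) divide_pos_pos)
    qed
    define P where "P z = a + z / (1 + L * z)" for z
    have P_range: "- (K + a) \<le> P z - a" "P z - a \<le> 1" if "zL \<le> z" for z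
    proof -
      have "zL * \<kappa> \<le> z * \<kappa>" using that \<kappa> by (intro mult_right_mono) auto
      then have "- (K + a) \<le> z * \<kappa>" using \<kappa> by (simp add: zL_def)
      then have "- (K + a) * (1 + L * z) \<le> z" by (simp add: \<kappa>_def algebra_simps)
      then show "- (K + a) \<le> P z - a" using den[OF that] by (simp add: P_def pos_le_divide_eq)
      have "z \<le> 1 + L * z" using L(1) den(2)[OF that] mult_right_mono[of 1 L z] by (cases "0 \<le> z") auto
      then show "P z - a \<le> 1" using den[OF that] by (simp add: P_def divide_le_eq)
    qed
    have P_bound: "\<bar>P z\<bar> \<le> K + 2" "\<bar>P z - a\<bar> \<le> K + 2" if "zL \<le> z" for z
      using P_range[OF that] K a_gt a_lt by linarith+
    have stage1: "P (\<zeta> x t) < u x t"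
      if x: "x \<in> closure \<Omega> \<inter> cball x0 R" and t: "0 \<le> t" "t \<le> T" and z: "zL \<le> \<zeta> x t" for x t
    proof (rule comparison[where lo = "\<lambda>_. - K" and ?z0.0 = zL and \<Phi> = P
          and ?\<Phi>1.0 = "\<lambda>z. 1 / (1 + L * z)\<^sup>2" and ?\<Phi>2.0 = "\<lambda>z. - 2 * L / (1 + L * z) ^ 3"])
      show "x \<in> closure \<Omega> \<inter> cball x0 R" "0 \<le> t" "t \<le> T" "zL \<le> \<zeta> x t" by fact+
      show "- K < u x t" if "x \<in> closure \<Omega> \<inter> cball x0 R" "0 \<le> t" for x t using above that by blast
      have "zL / (1 + L * zL) = - (K + a)" unfolding zL(1) using \<kappa> by (simp add: zL_def)
      then show "P zL \<le> - K" by (simp add: P_def)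
      show "- (K + a) \<le> zL" by fact
      show "continuous_on {zL..} P" unfolding P_def using den(2)
        by (intro continuous_intros) fastforce
      fix z
      show "P z \<le> a + z" if "zL \<le> z"
        using den(2)[OF that] L by (simp add: P_def divide_le_eq algebra_simps)
      assume zlt: "zL < z"
      then have zle: "zL \<le> z" by simp
      define d where "d = 1 + L * z"
      have d: "0 < d" "1 / \<kappa> \<le> d" using den[OF zle] by (auto simp: d_def)
      show "(P has_real_derivative 1 / (1 + L * z)\<^sup>2) (at z)"
        unfolding P_def using d(1) by (auto intro!: derivative_eq_intros simp: d_def field_simps power2_eq_square)
      show "((\<lambda>z. 1 / (1 + L * z)\<^sup>2) has_real_derivative - 2 * L / (1 + L * z) ^ 3) (at z)"
      proof -
        have "((\<lambda>y. 1 / y\<^sup>2) has_real_derivative - 2 / y ^ 3) (at y)" if "0 < y" for y :: real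
          using that by (auto intro!: derivative_eq_intros simp: field_simps eval_nat_numeral)
        moreover have "((\<lambda>z. 1 + L * z) has_real_derivative L) (at z)" by (auto intro!: derivative_eq_intros)
        ultimately have "((\<lambda>z. 1 / (1 + L * z)\<^sup>2) has_real_derivative - 2 / (1 + L * z) ^ 3 * L) (at z)"
          using den(2)[OF zle] by (intro DERIV_chain2[where g = "\<lambda>z. 1 + L * z"])
        then show ?thesis by simp
      qed
      show "0 < 1 / (1 + L * z)\<^sup>2" using d(1) by (simp add: d_def)
      show "\<bar>- 2 * L / (1 + L * z) ^ 3\<bar> \<le> C * (1 / (1 + L * z)\<^sup>2)"
      proof -
        have "1 / d \<le> \<kappa>" using d \<kappa> by (simp add: field_simps)
        then have "2 * L * (1 / d) * (1 / d\<^sup>2) \<le> 2 * L * \<kappa> * (1 / d\<^sup>2)"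
          using L by (intro mult_right_mono mult_left_mono) auto
        moreover have "\<bar>- 2 * L / d ^ 3\<bar> = 2 * L * (1 / d) * (1 / d\<^sup>2)"
          using L d by (simp add: power2_eq_square power3_eq_cube)
        ultimately show ?thesis by (simp add: C_def d_def)
      qed
      define y where "y = z / d"
      have Py: "P z = a + y" by (simp add: P_def y_def d_def)
      have yd: "\<mu> * z * (1 / (1 + L * z)\<^sup>2) = \<mu> * y - \<mu> * L * y\<^sup>2"
      proof -
        have zy: "z = y * d" using d(1) by (simp add: y_def)
        have "(1 - L * y) * d = d - L * (y * d)" by (simp add: algebra_simps)
        also have "\<dots> = 1" unfolding zy[symmetric] by (simp add: d_def)
        finally have inv: "1 - L * y = 1 / d" using d(1) by (simp add: eq_divide_eq)
        have "\<mu> * y - \<mu> * L * y\<^sup>2 = \<mu> * y * (1 - L * y)" by (simp add: algebra_simps power2_eq_square)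
        also have "\<dots> = \<mu> * z * (1 / d\<^sup>2)" unfolding inv using d(1) by (simp add: y_def power2_eq_square)
        finally show ?thesis by (simp add: d_def)
      qed
      have "\<mu> * y - L0 * y\<^sup>2 \<le> f (P z) 0" using L0(2)[of y] P_bound(2)[OF zle] by (simp add: Py abs_le_iff)
      moreover have "L0 * y\<^sup>2 \<le> \<mu> * (L / 2) * y\<^sup>2" using L(2) by (intro mult_right_mono) auto
      moreover have "\<mu> * L * y\<^sup>2 = \<mu> * (L / 2) * y\<^sup>2 + \<mu> * (L / 2) * y\<^sup>2" by simp
      ultimately have slack: "\<mu> * z * (1 / (1 + L * z)\<^sup>2) + \<mu> * (L / 2) * y\<^sup>2 \<le> f (P z) 0" using yd by linarith
      show "\<mu> * z * (1 / (1 + L * z)\<^sup>2) + G * \<epsilon> < f (P z) 0 + 1 / (1 + L * z)\<^sup>2 * (B1 * \<epsilon>)"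
      proof (cases "z \<le> 1")
        case True
        have "d \<le> 1 + L" using True L mult_left_mono[of z 1 L] by (simp add: d_def)
        then have "d\<^sup>2 \<le> (1 + L)\<^sup>2" using d(1) by (intro power_mono) auto
        then have "1 \<le> 1 / d\<^sup>2 * (1 + L)\<^sup>2" using d(1) by simp
        then have "(G + 1) * \<epsilon> * 1 \<le> (G + 1) * \<epsilon> * (1 / d\<^sup>2 * (1 + L)\<^sup>2)" using G \<epsilon> by (intro mult_left_mono) auto
        also have "(G + 1) * \<epsilon> * (1 / d\<^sup>2 * (1 + L)\<^sup>2) = 1 / (1 + L * z)\<^sup>2 * (B1 * \<epsilon>)"
          unfolding B1_def d_def by simp
        finally have "G * \<epsilon> + \<epsilon> \<le> 1 / (1 + L * z)\<^sup>2 * (B1 * \<epsilon>)" by (simp only: distrib_right mult_1_left mult_1_right)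
        moreover have "0 \<le> \<mu> * (L / 2) * y\<^sup>2" using \<mu>_pos L by simp
        ultimately show ?thesis using slack \<epsilon> by linarith
      next
        case False
        then have "d \<le> z * (1 + L)" by (simp add: d_def algebra_simps)
        then have "1 / (1 + L) \<le> y" using d(1) L by (simp add: y_def field_simps)
        then have "(1 / (1 + L))\<^sup>2 \<le> y\<^sup>2" using L by (intro power_mono) auto
        then have "s1 \<le> \<mu> * (L / 2) * y\<^sup>2" unfolding s1_def using \<mu>_pos L by (intro mult_left_mono) auto
        moreover have "0 < 1 / (1 + L * z)\<^sup>2 * (B1 * \<epsilon>)" using d(1) B1 \<epsilon> by (simp add: d_def)
        ultimately show ?thesis using slack small(3) by linarith
      qed
      show "f (P z) 0 - G * \<epsilon> \<le> f (P z) (v t)" if "0 < t" for t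
        using reaction[OF P_bound(1)[OF zle] that] .
    qed (use \<epsilon> in auto)
    define w where "w z = exp (- q * ln (z / 2))" for z
    have w: "0 < w z" for z by (simp add: w_def)
    have w1: "w z \<le> 1" if "2 \<le> z" for z using that q by (simp add: w_def)
    have w_der: "(w has_real_derivative - q / z * w z) (at z)" if "0 < z" for z
      unfolding w_def using that by (auto intro!: derivative_eq_intros)
    define S where "S z = b - (b - a) * w z" for z
    have S_range: "a \<le> S z" "S z < b" if "2 \<le> z" for z
    proof -
      have "(b - a) * w z \<le> (b - a) * 1" using w1[OF that] b by (intro mult_left_mono) auto
      moreover have "0 < (b - a) * w z" using w[of z] b by simp
      ultimately show "a \<le> S z" "S z < b" by (simp_all add: S_def)
    qed
    have stage2: "S (\<zeta> x t) < u x t"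
      if x: "x \<in> closure \<Omega> \<inter> cball x0 R" and t: "0 \<le> t" "t \<le> T" and z: "2 \<le> \<zeta> x t" for x t
    proof (rule comparison[where lo = P and ?z0.0 = 2 and \<Phi> = S
          and ?\<Phi>1.0 = "\<lambda>z. (b - a) * q * w z / z" and ?\<Phi>2.0 = "\<lambda>z. - ((q + 1) / z * ((b - a) * q * w z / z))"])
      show "x \<in> closure \<Omega> \<inter> cball x0 R" "0 \<le> t" "t \<le> T" "2 \<le> \<zeta> x t" by fact+
      show "P (\<zeta> x t) < u x t" if "x \<in> closure \<Omega> \<inter> cball x0 R" "0 \<le> t" "t \<le> T" "2 \<le> \<zeta> x t" for x t
        using that zL(3) by (intro stage1) auto
      show "S 2 \<le> P 2" using L by (simp add: S_def P_def w_def)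
      show "- (K + a) \<le> 2" using Ka by simp
      show "continuous_on {2..} S" unfolding S_def w_def by (intro continuous_intros) auto
      fix z :: real
      show "S z \<le> a + z" if "2 \<le> z" using S_range[OF that] b a_gt that by linarith
      assume z2: "2 < z"
      then have z: "2 \<le> z" "0 < z" by auto
      have pos: "0 < (b - a) * q * w z / z" using b q w[of z] z by simp
      show "0 < (b - a) * q * w z / z" by fact
      show "(S has_real_derivative (b - a) * q * w z / z) (at z)"
        unfolding S_def using z by (auto intro!: derivative_eq_intros w_der)
      show "((\<lambda>z. (b - a) * q * w z / z) has_real_derivative - ((q + 1) / z * ((b - a) * q * w z / z))) (at z)"
        using z by (auto intro!: derivative_eq_intros w_der simp: field_simps)
      show "\<bar>- ((q + 1) / z * ((b - a) * q * w z / z))\<bar> \<le> C * ((b - a) * q * w z / z)"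
      proof -
        have "2 * 2 \<le> C * z" using C z by (intro mult_mono) auto
        then have "(q + 1) / z \<le> C" using q(2) z by (simp add: divide_le_eq)
        then have "(q + 1) / z * ((b - a) * q * w z / z) \<le> C * ((b - a) * q * w z / z)"
          using pos by (intro mult_right_mono) auto
        moreover have "0 \<le> (q + 1) / z * ((b - a) * q * w z / z)" using pos q z by (intro mult_nonneg_nonneg) auto
        ultimately show ?thesis by linarith
      qed
      show "f (S z) 0 - G * \<epsilon> \<le> f (S z) (v t)" if "0 < t" for t
        using S_range[OF z(1)] a_gt b K that by (intro reaction) auto
      \<comment> \<open>Where P z \<ge> S z the first stage already suffices. Here S z > P z \<ge> a
        + y1, which places S z in the range of s2.\<close>
      assume lo: "P z < S z"
      have "0 < 1 + L * z" "0 < 1 + 2 * L" using z L by (auto intro: add_pos_pos)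
      moreover have "2 * (1 + L * z) \<le> z * (1 + 2 * L)" using z(1) by (simp add: algebra_simps)
      ultimately have "y1 \<le> z / (1 + L * z)" by (simp add: y1_def pos_le_divide_eq pos_divide_le_eq)
      then have "s2 \<le> f (S z) 0" using lo S_range[OF z(1)] by (intro s2(2)) (auto simp: P_def)
      moreover have "\<mu> * z * ((b - a) * q * w z / z) \<le> s2 / 2"
      proof -
        have "\<mu> * z * ((b - a) * q * w z / z) = \<mu> * (q * (b - a)) * w z" using z by simp
        also have "\<dots> \<le> \<mu> * (q * (b - a)) * 1" using w1[OF z(1)] \<mu>_pos q b by (intro mult_left_mono) auto
        finally show ?thesis using q(3) by simp
      qed
      moreover have "0 < (b - a) * q * w z / z * (B1 * \<epsilon>)" using pos B1 \<epsilon>(1) by (intro mult_pos_pos[of "(b - a) * q * w z / z"] mult_pos_pos[of B1])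
      ultimately show "\<mu> * z * ((b - a) * q * w z / z) + G * \<epsilon> < f (S z) 0 + (b - a) * q * w z / z * (B1 * \<epsilon>)"
        using small(4) by linarith
    qed
    have Zle: "Z \<le> \<zeta> x0 T"
    proof -
      have "M0 * \<epsilon> / M \<le> (u x0 0 - a) / M" using start M by (intro divide_right_mono) auto
      moreover have "M0 * \<epsilon> / M = (3 * B + Z) * \<epsilon>" using M by (simp add: M0_def)
      ultimately have "(3 * B + Z) * \<epsilon> \<le> \<phi> x0 - a" using \<phi>0 by linarith
      then have "(3 * B + Z) * \<epsilon> / \<epsilon> \<le> (\<phi> x0 - a) / \<epsilon>" using \<epsilon> by (intro divide_right_mono) auto
      then have "3 * B + Z \<le> 1 / \<epsilon> * (\<phi> x0 - a)" using \<epsilon> by simp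
      moreover have "\<zeta> x0 T = 1 / \<epsilon> * (\<phi> x0 - a) - B * (3 - \<epsilon>)" unfolding \<zeta>_def ET using \<epsilon> by simp
      moreover have "B * (3 - \<epsilon>) \<le> B * 3" using B \<epsilon> by (intro mult_left_mono) auto
      ultimately show ?thesis by linarith
    qed
    have "w (\<zeta> x0 T) \<le> \<theta>"
    proof -
      have "\<bar>ln \<theta>\<bar> / q = ln (Z / 2)" by (simp add: Z_def)
      also have "\<dots> \<le> ln (\<zeta> x0 T / 2)" using Zle Z by simp
      finally have "\<bar>ln \<theta>\<bar> \<le> q * ln (\<zeta> x0 T / 2)" using q by (simp add: field_simps)
      then have "w (\<zeta> x0 T) \<le> exp (ln \<theta>)" unfolding w_def exp_le_cancel_iff by linarith
      then show ?thesis using \<theta> by simp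
    qed
    then have "(b - a) * w (\<zeta> x0 T) \<le> (b - a) * \<theta>" using b by (intro mult_left_mono) auto
    then have "(b - a) * w (\<zeta> x0 T) \<le> \<eta> / 2" unfolding \<theta>(2) .
    then have "1 - \<eta> \<le> S (\<zeta> x0 T)" by (simp add: S_def b_def)
    also have "\<dots> < u x0 T"
      using x0 R T(1) Zle Z closure_subset[of \<Omega>] by (intro stage2) auto
    finally show "1 - \<eta> \<le> u x0 (inverse \<mu> * \<epsilon>\<^sup>2 * \<bar>ln \<epsilon>\<bar>)" by (simp add: T_def)
  qed
qed

lemma (in bistable) two_phase_bounds_from_below:
  fixes \<Omega> :: "(real^'n::finite) set" and u0 :: "real^'n \<Rightarrow> real"
  assumes dom: "smooth_bounded_domain \<Omega>" and \<eta>: "0 < \<eta>" "\<eta> < 1 - a"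
    and cont_u0: "continuous_on (closure \<Omega>) u0" and C11: "locally_C11 (closure \<Omega>) u0"
    and level: "closed {x\<in>\<Omega>. u0 x = a}"
    and K: "1 \<le> K" and V: "0 < V"
  obtains \<epsilon>1 M0 where "0 < \<epsilon>1" "0 < M0"
    "\<And>\<epsilon> u v x. \<lbrakk>0 < \<epsilon>; \<epsilon> < \<epsilon>1; nonlocal_solution \<Omega> f \<epsilon> v u;
       \<And>x. x \<in> closure \<Omega> \<Longrightarrow> u x 0 = u0 x; \<And>x t. x \<in> closure \<Omega> \<Longrightarrow> 0 \<le> t \<Longrightarrow> - K < u x t;
       \<And>t. 0 < t \<Longrightarrow> \<bar>v t\<bar> \<le> \<epsilon> * V; x \<in> \<Omega>\<rbrakk>
       \<Longrightarrow> -1 - \<eta> \<le> u x (inverse \<mu> * \<epsilon>\<^sup>2 * \<bar>ln \<epsilon>\<bar>) \<and>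
          (a + M0 * \<epsilon> \<le> u0 x \<longrightarrow> 1 - \<eta> \<le> u x (inverse \<mu> * \<epsilon>\<^sup>2 * \<bar>ln \<epsilon>\<bar>))"
proof -
  have "0 < \<eta> / 2" "0 < K" using \<eta> K by auto
  from relaxation_from_below[OF dom this V] obtain \<epsilon>1 \<kappa> where \<epsilon>1: "0 < \<epsilon>1" "0 < \<kappa>"
    and relax: "\<And>\<epsilon> u v T x t. \<lbrakk>0 < \<epsilon>; \<epsilon> < \<epsilon>1; nonlocal_solution \<Omega> f \<epsilon> v u;
       \<And>x. x \<in> closure \<Omega> \<Longrightarrow> - K < u x 0; \<And>t. 0 < t \<Longrightarrow> t \<le> T \<Longrightarrow> \<bar>v t\<bar> \<le> \<epsilon> * V;
       x \<in> closure \<Omega>; 0 \<le> t; t \<le> T\<rbrakk> \<Longrightarrow> -1 - \<eta> / 2 - K * exp (- (\<kappa> * t / \<epsilon>\<^sup>2)) < u x t"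
    by blast
  obtain M where M: "0 < M" "\<And>x. x \<in> \<Omega> \<Longrightarrow> a < u0 x \<Longrightarrow> lower_barrier \<Omega> u0 a K M x"
    using lower_barrier_exists[OF dom cont_u0 C11 level] by blast
  obtain \<epsilon>2 M0 where \<epsilon>2: "0 < \<epsilon>2" "0 < M0"
    and generation: "\<And>\<epsilon> u v x0. \<lbrakk>0 < \<epsilon>; \<epsilon> < \<epsilon>2; nonlocal_solution \<Omega> f \<epsilon> v u;
       \<And>x t. x \<in> closure \<Omega> \<Longrightarrow> 0 \<le> t \<Longrightarrow> - K < u x t;
       \<And>t. 0 < t \<Longrightarrow> \<bar>v t\<bar> \<le> \<epsilon> * V; x0 \<in> \<Omega>;
       lower_barrier \<Omega> (\<lambda>x. u x 0) a K M x0; a + M0 * \<epsilon> \<le> u x0 0\<rbrakk>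
       \<Longrightarrow> 1 - \<eta> \<le> u x0 (inverse \<mu> * \<epsilon>\<^sup>2 * \<bar>ln \<epsilon>\<bar>)"
    using generation_from_below[OF dom \<eta> M(1) K V] by blast
  \<comment> \<open>\<epsilon> < exp c amounts to K \<epsilon> powr (\<kappa> / \<mu>) < \<eta> / 2,
    where \<epsilon> powr (\<kappa> / \<mu>) is the relaxation factor at the final time. The other
    \<eta> / 2 is spent in the limit level of the relaxation.\<close>
  define c where "c = ln (\<eta> / (2 * K)) * \<mu> / \<kappa>"
  define \<epsilon>3 where "\<epsilon>3 = min (min \<epsilon>1 \<epsilon>2) (min 1 (exp c))"
  show thesis
  proof (rule that[of \<epsilon>3 M0])
    show "0 < \<epsilon>3" "0 < M0" using \<epsilon>1 \<epsilon>2 by (auto simp: \<epsilon>3_def)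
    fix \<epsilon> u v x assume \<epsilon>: "0 < \<epsilon>" "\<epsilon> < \<epsilon>3" and sol: "nonlocal_solution \<Omega> f \<epsilon> v u"
      and init: "\<And>x. x \<in> closure \<Omega> \<Longrightarrow> u x 0 = u0 x"
      and above: "\<And>x t. x \<in> closure \<Omega> \<Longrightarrow> 0 \<le> t \<Longrightarrow> - K < u x t"
      and v: "\<And>t. 0 < t \<Longrightarrow> \<bar>v t\<bar> \<le> \<epsilon> * V" and x: "x \<in> \<Omega>"
    define T where "T = inverse \<mu> * \<epsilon>\<^sup>2 * \<bar>ln \<epsilon>\<bar>"
    have \<epsilon>': "\<epsilon> < \<epsilon>1" "\<epsilon> < \<epsilon>2" "\<epsilon> < 1" "\<epsilon> < exp c" using \<epsilon> by (auto simp: \<epsilon>3_def)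
    have T0: "0 \<le> T" using \<mu>_pos by (simp add: T_def)
    have xcl: "x \<in> closure \<Omega>" using x closure_subset by blast
    have "-1 - \<eta> / 2 - K * exp (- (\<kappa> * T / \<epsilon>\<^sup>2)) < u x T"
      by (rule relax[OF \<epsilon>(1) \<epsilon>'(1) sol _ _ xcl T0 order_refl]) (use above v in auto)
    moreover have "K * exp (- (\<kappa> * T / \<epsilon>\<^sup>2)) \<le> \<eta> / 2"
    proof -
      have "ln \<epsilon> < c" using \<epsilon>'(4) \<epsilon>(1) by (metis ln_exp ln_less_cancel_iff exp_gt_zero)
      then have "\<kappa> * ln \<epsilon> / \<mu> \<le> \<kappa> * c / \<mu>" using \<mu>_pos \<epsilon>1(2) by (intro divide_right_mono mult_left_mono) auto
      also have "\<kappa> * c / \<mu> = ln (\<eta> / (2 * K))" using \<mu>_pos \<epsilon>1(2) by (simp add: c_def)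
      also have "\<kappa> * ln \<epsilon> / \<mu> = - (\<kappa> * T / \<epsilon>\<^sup>2)" using \<epsilon>(1) \<epsilon>'(3) \<mu>_pos by (simp add: T_def divide_inverse mult_ac)
      finally have "exp (- (\<kappa> * T / \<epsilon>\<^sup>2)) \<le> exp (ln (\<eta> / (2 * K)))" by simp
      also have "\<dots> = \<eta> / (2 * K)" using \<eta> K by simp
      finally have "K * exp (- (\<kappa> * T / \<epsilon>\<^sup>2)) \<le> K * (\<eta> / (2 * K))" using K by (intro mult_left_mono) auto
      then show ?thesis using K by simp
    qed
    ultimately have "-1 - \<eta> \<le> u x T" by linarith
    moreover have "1 - \<eta> \<le> u x T" if start: "a + M0 * \<epsilon> \<le> u0 x"
    proof -
      have "0 < M0 * \<epsilon>" using \<epsilon>2(2) \<epsilon>(1) by simp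
      then have "lower_barrier \<Omega> u0 a K M x" using M(2)[OF x] start by simp
      then have "lower_barrier \<Omega> (\<lambda>x. u x 0) a K M x"
        using init[OF xcl] init unfolding lower_barrier_def by (elim ex_forward conj_forward) auto
      then show ?thesis
        unfolding T_def using above v start init[OF xcl]
        by (intro generation[OF \<epsilon>(1) \<epsilon>'(2) sol _ _ x]) auto
    qed
    ultimately show "-1 - \<eta> \<le> u x (inverse \<mu> * \<epsilon>\<^sup>2 * \<bar>ln \<epsilon>\<bar>) \<and>
          (a + M0 * \<epsilon> \<le> u0 x \<longrightarrow> 1 - \<eta> \<le> u x (inverse \<mu> * \<epsilon>\<^sup>2 * \<bar>ln \<epsilon>\<bar>))"
      unfolding T_def by blast
  qed
qed

lemma reaction_solution_reflect:
  fixes f :: "real \<Rightarrow> real \<Rightarrow> real" and v :: "real \<Rightarrow> real"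
  assumes "nonlocal_solution \<Omega> f \<epsilon> v u"
  shows "reaction_solution \<Omega> (\<lambda>t y. 1 / \<epsilon>\<^sup>2 * - f (- y) (- (- v t))) (\<lambda>x t. - u x t)"
  using reaction_solution_uminus[OF assms] by simp

text \<open>The bound on v presupposes one on u, and conversely. Up to the first time at which |u|
  reaches K + 2 the bound on v holds, so \<open>relaxation_from_below\<close> with \<eta> = 1, for u
  and for - u, gives |u| < K + 2 at that time: a contradiction.\<close>

lemma (in bistable) a_priori_bound:
  fixes \<Omega> :: "(real^'n::finite) set"
  assumes dom: "smooth_bounded_domain \<Omega>" and K: "0 < K" and V: "0 < V"
  obtains \<epsilon>1 where "0 < \<epsilon>1"
    "\<And>\<epsilon> u v x t. \<lbrakk>0 < \<epsilon>; \<epsilon> < \<epsilon>1; nonlocal_solution \<Omega> f \<epsilon> v u;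
       \<And>x. x \<in> closure \<Omega> \<Longrightarrow> \<bar>u x 0\<bar> < K;
       \<And>t. 0 < t \<Longrightarrow> (\<And>x. x \<in> closure \<Omega> \<Longrightarrow> \<bar>u x t\<bar> \<le> K + 2) \<Longrightarrow> \<bar>v t\<bar> \<le> \<epsilon> * V;
       x \<in> closure \<Omega>; 0 \<le> t\<rbrakk> \<Longrightarrow> \<bar>u x t\<bar> < K + 2"
proof -
  obtain \<epsilon>1 \<kappa>1 where \<epsilon>1: "0 < \<epsilon>1" "0 < \<kappa>1"
    and lower: "\<And>\<epsilon> u v T x t. \<lbrakk>0 < \<epsilon>; \<epsilon> < \<epsilon>1; nonlocal_solution \<Omega> f \<epsilon> v u;
       \<And>x. x \<in> closure \<Omega> \<Longrightarrow> - K < u x 0; \<And>t. 0 < t \<Longrightarrow> t \<le> T \<Longrightarrow> \<bar>v t\<bar> \<le> \<epsilon> * V;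
       x \<in> closure \<Omega>; 0 \<le> t; t \<le> T\<rbrakk> \<Longrightarrow> -1 - 1 - K * exp (- (\<kappa>1 * t / \<epsilon>\<^sup>2)) < u x t"
    using relaxation_from_below[OF dom zero_less_one K V] by blast
  interpret refl: bistable "\<lambda>y v. - f (- y) (- v)" "- a" \<mu>
    by (rule bistable_reflect) unfold_locales
  obtain \<epsilon>2 \<kappa>2 where \<epsilon>2: "0 < \<epsilon>2" "0 < \<kappa>2"
    and upper: "\<And>\<epsilon> u v T x t. \<lbrakk>0 < \<epsilon>; \<epsilon> < \<epsilon>2; reaction_solution \<Omega> (\<lambda>t y. 1 / \<epsilon>\<^sup>2 * - f (- y) (- v t)) u;
       \<And>x. x \<in> closure \<Omega> \<Longrightarrow> - K < u x 0; \<And>t. 0 < t \<Longrightarrow> t \<le> T \<Longrightarrow> \<bar>v t\<bar> \<le> \<epsilon> * V;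
       x \<in> closure \<Omega>; 0 \<le> t; t \<le> T\<rbrakk> \<Longrightarrow> -1 - 1 - K * exp (- (\<kappa>2 * t / \<epsilon>\<^sup>2)) < u x t"
    using refl.relaxation_from_below[OF dom zero_less_one K V] by blast
  show thesis
  proof (rule that[of "min \<epsilon>1 \<epsilon>2"])
    show "0 < min \<epsilon>1 \<epsilon>2" using \<epsilon>1 \<epsilon>2 by simp
    fix \<epsilon> u v x1 and t1 :: real
    assume \<epsilon>: "0 < \<epsilon>" "\<epsilon> < min \<epsilon>1 \<epsilon>2" and sol: "nonlocal_solution \<Omega> f \<epsilon> v u"
      and init: "\<And>x. x \<in> closure \<Omega> \<Longrightarrow> \<bar>u x 0\<bar> < K"
      and v: "\<And>t. 0 < t \<Longrightarrow> (\<And>x. x \<in> closure \<Omega> \<Longrightarrow> \<bar>u x t\<bar> \<le> K + 2) \<Longrightarrow> \<bar>v t\<bar> \<le> \<epsilon> * V"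
      and x1: "x1 \<in> closure \<Omega>" and t1: "0 \<le> t1"
    have contu: "continuous_on (closure \<Omega> \<times> {0..}) (\<lambda>(x, t). u x t)"
      using sol by (simp add: reaction_solution_def)
    show "\<bar>u x1 t1\<bar> < K + 2"
    proof (rule ccontr)
      assume neg: "\<not> \<bar>u x1 t1\<bar> < K + 2"
      define D where "D = closure \<Omega> \<times> {0..t1}"
      define S where "S = {z\<in>D. K + 2 \<le> \<bar>(\<lambda>(x, t). u x t) z\<bar>}"
      have compD: "compact D"
        using dom by (auto simp: D_def smooth_bounded_domain_def compact_closure intro: compact_Times)
      have "continuous_on D (\<lambda>z. \<bar>(\<lambda>(x, t). u x t) z\<bar>)"
        by (intro continuous_on_rabs continuous_on_subset[OF contu]) (auto simp: D_def)
      then have "closed S"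
        unfolding S_def using continuous_on_closed_Collect_le[OF continuous_on_const] compD compact_imp_closed by blast
      moreover have "D \<inter> S = S" by (auto simp: S_def)
      ultimately have "compact S" using compact_Int_closed[OF compD, of S] by simp
      moreover have "(x1, t1) \<in> S" using neg x1 t1 by (simp add: S_def D_def)
      then have "S \<noteq> {}" by blast
      ultimately obtain z where z: "z \<in> S" "\<forall>z'\<in>S. snd z \<le> snd z'"
        using continuous_attains_inf[of S snd, OF _ _ continuous_on_snd[OF continuous_on_id]] by blast
      obtain p t0 where pt: "z = (p, t0)" by fastforce
      have p: "p \<in> closure \<Omega>" "0 \<le> t0" "t0 \<le> t1" "K + 2 \<le> \<bar>u p t0\<bar>"
        using z(1) by (auto simp: pt S_def D_def)
      have t0: "0 < t0" using init[OF p(1)] p(2,4) by (cases "t0 = 0") auto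
      have before: "\<bar>u y s\<bar> < K + 2" if "y \<in> closure \<Omega>" "0 \<le> s" "s < t0" for y s
      proof (rule ccontr)
        assume "\<not> \<bar>u y s\<bar> < K + 2"
        then have "(y, s) \<in> S" using that p(3) by (simp add: S_def D_def)
        from bspec[OF z(2) this] that(3) show False by (simp add: pt)
      qed
      have le: "\<bar>u y s\<bar> \<le> K + 2" if y: "y \<in> closure \<Omega>" and s: "0 < s" "s \<le> t0" for y s
      proof -
        have "continuous_on {0..s} (\<lambda>s. (\<lambda>(x, t). u x t) (y, s))"
          using y by (intro continuous_on_compose2[OF contu] continuous_intros) auto
        then have "continuous_on {0..s} (\<lambda>s. K + 2 - \<bar>u y s\<bar>)" by (intro continuous_intros) simp
        from nonneg_at_right_end[OF this s(1)] before[OF y] s(2) show ?thesis by fastforce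
      qed
      have v': "\<bar>v s\<bar> \<le> \<epsilon> * V" if "0 < s" "s \<le> t0" for s
        using le that by (intro v) auto
      have e: "K * exp (- (k * t0 / \<epsilon>\<^sup>2)) \<le> K" if "0 < k" for k
        using K that t0 by (simp add: mult_le_cancel_left2)
      have "-1 - 1 - K * exp (- (\<kappa>1 * t0 / \<epsilon>\<^sup>2)) < u p t0"
      proof (rule lower[OF \<epsilon>(1) _ sol _ v' p(1,2) order_refl])
        show "\<epsilon> < \<epsilon>1" using \<epsilon> by simp
        show "- K < u x 0" if "x \<in> closure \<Omega>" for x using init[OF that] by (simp add: abs_less_iff)
      qed auto
      moreover have "-1 - 1 - K * exp (- (\<kappa>2 * t0 / \<epsilon>\<^sup>2)) < - u p t0"
      proof (rule upper[where v = "\<lambda>t. - v t", OF \<epsilon>(1) _ reaction_solution_reflect[where f = f and v = v, OF sol] _ _ p(1,2) order_refl])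
        show "\<epsilon> < \<epsilon>2" using \<epsilon> by simp
        show "- K < - u x 0" if "x \<in> closure \<Omega>" for x using init[OF that] by (simp add: abs_less_iff)
        show "\<bar>- v t\<bar> \<le> \<epsilon> * V" if "0 < t" "t \<le> t0" for t using v'[OF that] by simp
      qed
      ultimately show False using e[OF \<epsilon>1(2)] e[OF \<epsilon>2(2)] p(4) by linarith
    qed
  qed
qed

section \<open>From the data of the problem to the abstract hypotheses\<close>

lemma line_derivative:
  fixes h :: "'a::real_normed_vector \<Rightarrow> real"
  assumes "h differentiable (at (z + s *\<^sub>R w))"
  shows "((\<lambda>s. h (z + s *\<^sub>R w)) has_real_derivative frechet_derivative h (at (z + s *\<^sub>R w)) w) (at s)"
proof -
  let ?D = "frechet_derivative h (at (z + s *\<^sub>R w))"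
  have h: "(h has_derivative ?D) (at (z + s *\<^sub>R w))" using assms frechet_derivative_works by blast
  have "((\<lambda>s. z + s *\<^sub>R w) has_derivative (\<lambda>k. k *\<^sub>R w)) (at s)" by (auto intro!: derivative_eq_intros)
  from has_derivative_compose[OF this h]
  have "((\<lambda>s. h (z + s *\<^sub>R w)) has_derivative (\<lambda>k. ?D (k *\<^sub>R w))) (at s)" .
  moreover have "(\<lambda>k. ?D (k *\<^sub>R w)) = (*) (?D w)"
    using linear_cmul[OF has_derivative_linear[OF h]] by (auto simp: mult.commute)
  ultimately show ?thesis by (simp add: has_field_derivative_def)
qed

text \<open>All zeros are simple, so the slopes at -1, a and 1 fix the sign up to the next zero;
  reflections in argument and in sign reduce the four cases to
  \<open>positive_right_of_zero\<close>. The two estimates are mean value bounds on compact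
  sets.\<close>

lemma bistableI:
  fixes f :: "real \<Rightarrow> real \<Rightarrow> real"
  assumes smooth: "smooth_on UNIV (\<lambda>(u, v). f u v)"
    and a: "-1 < a" "a < 1" and zeros: "{u. f u 0 = 0} = {-1, a, 1}"
    and stable: "deriv (\<lambda>u. f u 0) (-1) < 0" "deriv (\<lambda>u. f u 0) 1 < 0"
    and unstable: "0 < deriv (\<lambda>u. f u 0) a"
  shows "bistable f a (deriv (\<lambda>u. f u 0) a)"
proof -
  define h where "h = (\<lambda>(u, v). f u v)"
  define D where "D w z = frechet_derivative h (at z) w" for w z :: "real \<times> real"
  define D2 where "D2 w z = frechet_derivative (D w) (at z) w" for w z :: "real \<times> real"
  have "Ck_on 2 UNIV h" using smooth by (simp add: smooth_on_def h_def)
  then have Ck: "(\<forall>z\<in>UNIV. h differentiable (at z)) \<and> (\<forall>w. (\<forall>z\<in>UNIV. D w differentiable (at z)) \<and>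
      (\<forall>w'. continuous_on UNIV (\<lambda>z. frechet_derivative (D w) (at z) w')))"
    unfolding numeral_2_eq_2 Ck_on.simps D_def[abs_def] .
  have diff: "h differentiable (at z)" and diff2: "D w differentiable (at z)" for z w
    using Ck by blast+
  have cont2: "continuous_on UNIV (D2 w)" for w
    using Ck unfolding D2_def[abs_def] by blast
  have contD: "continuous_on UNIV (D w)" for w
    using diff2 differentiable_imp_continuous_within by (blast intro: continuous_at_imp_continuous_on)
  have bound: "\<exists>B. \<forall>z\<in>S. \<bar>g z\<bar> \<le> B" if "compact S" "continuous_on UNIV g" for S and g :: "real \<times> real \<Rightarrow> real"
    using compact_imp_bounded[OF compact_continuous_image[OF continuous_on_subset[OF that(2)] that(1)]]
    by (auto simp: bounded_iff)
  define F where "F u = f u 0" for u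
  define F1 where "F1 u = D (1, 0) (u, 0)" for u
  define F2 where "F2 u = D2 (1, 0) (u, 0)" for u
  have F_der: "(F has_real_derivative F1 u) (at u)" for u
    using line_derivative[OF diff, of "(0, 0)" "(1, 0)" u] by (simp add: F_def[abs_def] F1_def D_def h_def)
  have F1_der: "(F1 has_real_derivative F2 u) (at u)" for u
    using line_derivative[OF diff2, of "(1, 0)" "(0, 0)" "(1, 0)" u] by (simp add: F1_def[abs_def] F2_def D2_def)
  have v_der: "((\<lambda>v. f u v) has_real_derivative D (0, 1) (u, v)) (at v)" for u v
    using line_derivative[OF diff, of "(u, 0)" "(0, 1)" v] by (simp add: D_def h_def)
  have contF: "continuous_on UNIV F" using F_der DERIV_isCont by (blast intro: continuous_at_imp_continuous_on)
  have deriv_F: "deriv (\<lambda>u. f u 0) u = F1 u" for u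
    using DERIV_imp_deriv[OF F_der[of u]] by (simp add: F_def[abs_def])
  have zero_iff: "F u = 0 \<longleftrightarrow> u = -1 \<or> u = a \<or> u = 1" for u using zeros by (auto simp: F_def)
  have contm: "continuous_on UNIV (\<lambda>u. F (- u))"
    using continuous_on_compose2[OF contF continuous_on_minus[OF continuous_on_id] subset_UNIV] by simp
  have F_derm: "((\<lambda>u. F (- u)) has_real_derivative - F1 (- u)) (at u)" for u
    using DERIV_chain2[OF F_der DERIV_minus[OF DERIV_ident], of u] by simp
  show ?thesis
  proof
    show "-1 < a" "a < 1" "0 < deriv (\<lambda>u. f u 0) a" by fact+
    show "continuous_on UNIV (\<lambda>y. f y 0)" using contF by (simp add: F_def[abs_def])
    show "0 < f y 0" if "a < y" "y < 1" for y
      using positive_right_of_zero[OF contF F_der[of a], of y] unstable that a zero_iff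
      by (auto simp: deriv_F F_def)
    show "f y 0 < 0" if "-1 < y" "y < a" for y
    proof -
      have "0 < - F (- (- y))"
        using that a unstable zero_iff
        by (intro positive_right_of_zero[of "\<lambda>u. - F (- u)" "F1 a" "- a"] continuous_on_minus contm)
          (auto simp: deriv_F intro!: derivative_eq_intros F_derm)
      then show ?thesis by (simp add: F_def)
    qed
    show "0 < f y 0" if "y < -1" for y
    proof -
      have "0 < F (- (- y))"
        using that a stable(1) zero_iff
        by (intro positive_right_of_zero[of "\<lambda>u. F (- u)" "- F1 (- 1)" 1] contm F_derm) (auto simp: deriv_F)
      then show ?thesis by (simp add: F_def)
    qed
    show "f y 0 < 0" if "1 < y" for y
    proof -
      have "0 < - F y"
        using that a stable(2) zero_iff
        by (intro positive_right_of_zero[of "\<lambda>u. - F u" "- F1 1" 1] continuous_on_minus contF DERIV_minus F_der)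
          (auto simp: deriv_F)
      then show ?thesis by (simp add: F_def)
    qed
    fix r :: real
    show "\<exists>L>0. \<forall>y. \<bar>y\<bar> \<le> r \<longrightarrow> \<bar>f (a + y) 0 - deriv (\<lambda>u. f u 0) a * y\<bar> \<le> L * y\<^sup>2"
    proof -
      have "compact ({a - r..a + r} \<times> {0 :: real})" by (intro compact_Times) auto
      from bound[OF this cont2] obtain B where "\<forall>z\<in>{a - r..a + r} \<times> {0}. \<bar>D2 (1, 0) z\<bar> \<le> B" by blast
      then have B: "\<bar>F2 u\<bar> \<le> B" if "u \<in> {a - r..a + r}" for u
        using that by (simp add: F2_def)
      have "\<bar>F (a + y) - F1 a * y\<bar> \<le> (\<bar>B\<bar> + 1) * y\<^sup>2" if y: "\<bar>y\<bar> \<le> r" for y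
      proof -
        \<comment> \<open>Radius |y| instead of r: the first mean value bound is then of order |y|,
          and the second, for F minus its linear part, of order y^2.\<close>
        define S where "S = {a - \<bar>y\<bar>..a + \<bar>y\<bar>}"
        have S: "convex S" "a \<in> S" "a + y \<in> S" "S \<subseteq> {a - r..a + r}" using y by (auto simp: S_def)
        have F1_bound: "\<bar>F1 u - F1 a\<bar> \<le> (\<bar>B\<bar> + 1) * \<bar>y\<bar>" if "u \<in> S" for u
        proof -
          have "norm (F1 u - F1 a) \<le> (\<bar>B\<bar> + 1) * norm (u - a)"
          proof (rule field_differentiable_bound[OF S(1)])
            show "(F1 has_field_derivative F2 z) (at z within S)" for z
              using F1_der has_field_derivative_at_within by blast
            show "norm (F2 z) \<le> \<bar>B\<bar> + 1" if "z \<in> S" for z using B[of z] S(4) that by fastforce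
          qed (use S that in auto)
          also have "\<dots> \<le> (\<bar>B\<bar> + 1) * \<bar>y\<bar>" using that by (intro mult_left_mono) (auto simp: S_def abs_le_iff)
          finally show ?thesis by simp
        qed
        have "norm ((F (a + y) - F1 a * (a + y)) - (F a - F1 a * a)) \<le> (\<bar>B\<bar> + 1) * \<bar>y\<bar> * norm (a + y - a)"
        proof (rule field_differentiable_bound[OF S(1), where f' = "\<lambda>u. F1 u - F1 a"])
          show "((\<lambda>u. F u - F1 a * u) has_field_derivative F1 z - F1 a) (at z within S)" for z
            by (rule has_field_derivative_at_within) (auto intro!: derivative_eq_intros F_der)
          show "norm (F1 z - F1 a) \<le> (\<bar>B\<bar> + 1) * \<bar>y\<bar>" if "z \<in> S" for z using F1_bound[OF that] by simp
        qed (use S in auto)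
        moreover have "F a = 0" using zero_iff by blast
        ultimately show ?thesis by (simp add: algebra_simps power2_eq_square abs_mult_self_eq)
      qed
      then show ?thesis by (intro exI[of _ "\<bar>B\<bar> + 1"]) (auto simp: F_def deriv_F)
    qed
    show "\<exists>G>0. \<forall>y v. \<bar>y\<bar> \<le> r \<longrightarrow> \<bar>v\<bar> \<le> 1 \<longrightarrow> \<bar>f y v - f y 0\<bar> \<le> G * \<bar>v\<bar>"
    proof -
      have "compact ({-r..r} \<times> {-1..1 :: real})" by (intro compact_Times) auto
      from bound[OF this contD] obtain B where B: "\<forall>z\<in>{-r..r} \<times> {-1..1}. \<bar>D (0, 1) z\<bar> \<le> B" by blast
      have "norm (f y v - f y 0) \<le> (\<bar>B\<bar> + 1) * norm (v - 0)" if "\<bar>y\<bar> \<le> r" "\<bar>v\<bar> \<le> 1" for y v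
      proof (rule field_differentiable_bound[of "{-1..1}"])
        show "((\<lambda>v. f y v) has_field_derivative D (0, 1) (y, z)) (at z within {-1..1})" for z
          using v_der has_field_derivative_at_within by blast
        show "norm (D (0, 1) (y, z)) \<le> \<bar>B\<bar> + 1" if "z \<in> {-1..1}" for z
          using bspec[OF B, of "(y, z)"] that \<open>\<bar>y\<bar> \<le> r\<close> by (auto simp: abs_le_iff)
      qed (use that in auto)
      then show ?thesis by (intro exI[of _ "\<bar>B\<bar> + 1"]) auto
    qed
  qed
qed

lemma reaction_solution_of_solves_P:
  assumes "solves_P \<Omega> f u0 \<epsilon> u" "open \<Omega>"
  shows "reaction_solution \<Omega> (\<lambda>t y. 1 / \<epsilon>\<^sup>2 * f y (\<epsilon> * integral \<Omega> (\<lambda>y. u y t))) u"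
  unfolding reaction_solution_def
proof (intro conjI ballI allI impI)
  show "continuous_on (closure \<Omega> \<times> {0..}) (\<lambda>(x, t). u x t)"
    using assms(1) by (simp add: solves_P_def classical_regularity_def)
next
  fix x and t :: real assume x: "x \<in> \<Omega>" and t: "0 < t"
  have Ck: "Ck_on 2 \<Omega> (\<lambda>x. u x t)" and diff: "u x differentiable (at t)"
    using assms(1) x t by (auto simp: solves_P_def classical_regularity_def)
  have eq: "deriv (u x) t = laplacian (\<lambda>y. u y t) x + 1 / \<epsilon>\<^sup>2 * f (u x t) (\<epsilon> * integral \<Omega> (\<lambda>y. u y t))"
    using assms(1) x t by (simp add: solves_P_def)
  have jets: "jet2 (\<lambda>s. u (x + s *\<^sub>R axis i 1) t) (gradient (\<lambda>y. u y t) x $ i)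
      (partial_deriv i (partial_deriv i (\<lambda>y. u y t)) x)" for i
    using Ck2_local_estimates[OF assms(2) Ck x] x by metis
  have dt: "(u x has_real_derivative deriv (u x) t) (at t)"
    using diff DERIV_deriv_iff_real_differentiable by blast
  show "\<exists>d e. axis_jets (\<lambda>z. u z t) x d e \<and>
        (u x has_real_derivative (\<Sum>i\<in>UNIV. e i) + 1 / \<epsilon>\<^sup>2 * f (u x t) (\<epsilon> * integral \<Omega> (\<lambda>y. u y t))) (at t)"
    by (intro exI conjI allI, rule jets, rule dt[unfolded eq laplacian_def])
next
  fix x n and t :: real assume "x \<in> frontier \<Omega>" "outer_unit_normal \<Omega> x n" "0 < t"
  then show "has_normal_derivative (\<lambda>y. u y t) 0 x n" using assms(1) by (simp add: solves_P_def)
qed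

text \<open>Covers nonintegrable \<open>w\<close> as well, whose integral is \<open>0\<close>.\<close>

lemma integral_bound_on_bounded_open:
  fixes w :: "'a::euclidean_space \<Rightarrow> real"
  assumes "open \<Omega>" "bounded \<Omega>" "\<And>x. x \<in> \<Omega> \<Longrightarrow> \<bar>w x\<bar> \<le> K" "0 \<le> K"
  shows "\<bar>integral \<Omega> w\<bar> \<le> K * measure lebesgue \<Omega>"
proof (cases "w integrable_on \<Omega>")
  case True
  have m: "\<Omega> \<in> lmeasurable" using assms(1,2) by (rule lmeasurable_open[rotated])
  have "norm (integral \<Omega> w) \<le> integral \<Omega> (\<lambda>_. K)"
    by (rule integral_norm_bound_integral[OF True]) (use m assms(3) in \<open>auto simp: integrable_on_const\<close>)
  also have "integral \<Omega> (\<lambda>_. K) = K * measure lebesgue \<Omega>"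
    using lmeasure_integral[OF m] integral_mult_right[of \<Omega> K "\<lambda>_. 1"] by simp
  finally show ?thesis by simp
next
  case False
  then show ?thesis using assms(4) by (simp add: not_integrable_integral)
qed

lemma locally_C11_of_Ck2:
  fixes u0 :: "real^'n::finite \<Rightarrow> real"
  assumes "open V" "Ck_on 2 V u0" "S \<subseteq> V"
  shows "locally_C11 S u0"
  unfolding locally_C11_def
proof
  fix p assume "p \<in> S"
  then have "p \<in> V" using assms(3) by blast
  obtain r L where rL: "0 < r" "0 < L" and 1: "\<And>x. x \<in> ball p r \<Longrightarrow> norm (gradient u0 x) \<le> L"
    "\<And>x y. x \<in> ball p r \<Longrightarrow> y \<in> ball p r \<Longrightarrow>
       \<bar>u0 y - u0 x - gradient u0 x \<bullet> (y - x)\<bar> \<le> L * (norm (y - x))\<^sup>2"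
    using Ck2_local_estimates[OF assms(1,2) \<open>p \<in> V\<close>] by metis
  have "\<forall>x\<in>ball p r. norm (gradient u0 x) \<le> L \<and>
     (\<forall>y\<in>ball p r. \<bar>u0 y - u0 x - gradient u0 x \<bullet> (y - x)\<bar> \<le> L * (norm (y - x))\<^sup>2)"
    using 1 by blast
  then show "\<exists>r>0. \<exists>L\<ge>0. \<exists>v. \<forall>x\<in>ball p r. norm (v x) \<le> L \<and>
     (\<forall>y\<in>ball p r. \<bar>u0 y - u0 x - v x \<bullet> (y - x)\<bar> \<le> L * (norm (y - x))\<^sup>2)"
    using rL(1) less_imp_le[OF rL(2)] by blast
qed

theorem theorem2p1:
  fixes \<Omega> \<Gamma>0 \<Omega>0_minus \<Omega>0_plus :: "(real^'n::finite) set"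
    and f :: "real \<Rightarrow> real \<Rightarrow> real" and W :: "real \<Rightarrow> real"
    and u0 :: "real^'n \<Rightarrow> real"
    and a C0 \<eta>0 \<eta> \<mu> :: real
  assumes dim: "CARD('n) \<ge> 2"
    and domain: "smooth_bounded_domain \<Omega>"
    and f_smooth: "smooth_on UNIV (\<lambda>(u, v). f u v)"
    and potential: "\<And>u. (W has_real_derivative - f u 0) (at u)"
    and a_between: "-1 < a" "a < 1"
    and zeros: "{u. f u 0 = 0} = {-1, a, 1}"
    and stable: "deriv (\<lambda>u. f u 0) (-1) < 0" "deriv (\<lambda>u. f u 0) 1 < 0"
    and unstable: "deriv (\<lambda>u. f u 0) a > 0"
    and balanced: "integral {-1..1} (\<lambda>u. f u 0) = 0"
    and u0_smooth: "smooth_up_to_boundary \<Omega> u0"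
    and C0_ge: "C0 \<ge> 1"
    and u0_bound: "C0_norm (closure \<Omega>) u0 + C0_norm (closure \<Omega>) (gradient u0)
                     + C0_norm (closure \<Omega>) (hessian u0) \<le> C0"
    and \<Gamma>0_eq: "\<Gamma>0 = {x\<in>\<Omega>. u0 x = a}"
    and \<Gamma>0_hypersurface: "smooth_closed_hypersurface \<Gamma>0"
    and \<Gamma>0_inside: "compact (closure \<Gamma>0)" "closure \<Gamma>0 \<subseteq> \<Omega>"
    and \<Gamma>0_nondegenerate: "\<And>x. x \<in> \<Gamma>0 \<Longrightarrow> gradient u0 x \<noteq> 0"
    and \<Omega>0_minus_eq: "\<Omega>0_minus = \<Omega> \<inter> inside \<Gamma>0"
    and \<Omega>0_plus_eq: "\<Omega>0_plus = \<Omega> \<inter> outside \<Gamma>0"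
    and u0_plus: "\<And>x. x \<in> \<Omega>0_plus \<Longrightarrow> u0 x > a"
    and u0_minus: "\<And>x. x \<in> \<Omega>0_minus \<Longrightarrow> u0 x < a"
    and \<eta>0_eq: "\<eta>0 = min (a + 1) (1 - a)"
    and \<eta>_range: "\<eta> \<in> {0<..<\<eta>0}"
    and \<mu>_eq: "\<mu> = deriv (\<lambda>u. f u 0) a"
  shows "\<exists>\<epsilon>0>0. \<exists>M0>0. \<forall>\<epsilon>\<in>{0<..<\<epsilon>0}. \<forall>u. solves_P \<Omega> f u0 \<epsilon> u \<longrightarrow>
           (let T = inverse \<mu> * \<epsilon>\<^sup>2 * \<bar>ln \<epsilon>\<bar> in
             (\<forall>x\<in>\<Omega>. -1 - \<eta> \<le> u x T \<and> u x T \<le> 1 + \<eta>) \<and>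
             (\<forall>x\<in>\<Omega>. \<bar>u0 x - a\<bar> \<ge> M0 * \<epsilon> \<longrightarrow>
                (u0 x \<ge> a + M0 * \<epsilon> \<longrightarrow> u x T \<ge> 1 - \<eta>) \<and>
                (u0 x \<le> a - M0 * \<epsilon> \<longrightarrow> u x T \<le> -1 + \<eta>)))"
proof -
  interpret bistable f a \<mu>
    unfolding \<mu>_eq by (rule bistableI[OF f_smooth a_between zeros stable unstable])
  interpret refl: bistable "\<lambda>y v. - f (- y) (- v)" "- a" \<mu>
    by (rule bistable_reflect) unfold_locales
  have op: "open \<Omega>" and bd: "bounded \<Omega>" using domain by (auto simp: smooth_bounded_domain_def)
  have comp: "compact (closure \<Omega>)" using bd by (simp add: compact_closure)
  obtain V where V: "closure \<Omega> \<subseteq> V" "open V" "Ck_on 2 V u0"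
    using u0_smooth by (auto simp: smooth_up_to_boundary_def smooth_on_def)
  have cont_u0: "continuous_on (closure \<Omega>) u0"
    using V(1,3) by (auto simp: numeral_2_eq_2 intro!: continuous_at_imp_continuous_on differentiable_imp_continuous_within)
  have C11: "locally_C11 (closure \<Omega>) u0" by (rule locally_C11_of_Ck2[OF V(2,3,1)])
  \<comment> \<open>Compactness of the hypersurface makes the level set closed in the whole space,
    not only relative to \<Omega>; it therefore cannot accumulate at the boundary.\<close>
  have level: "closed {x\<in>\<Omega>. u0 x = a}"
    using \<Gamma>0_hypersurface unfolding \<Gamma>0_eq smooth_closed_hypersurface_def by (blast intro: compact_imp_closed)
  obtain B where B: "\<And>x. x \<in> closure \<Omega> \<Longrightarrow> \<bar>u0 x\<bar> \<le> B"
    using compact_imp_bounded[OF compact_continuous_image[OF cont_u0 comp]] by (auto simp: bounded_iff)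
  define K0 where "K0 = \<bar>B\<bar> + 1"
  have K0: "0 < K0" "1 \<le> K0 + 2" "\<And>x. x \<in> closure \<Omega> \<Longrightarrow> \<bar>u0 x\<bar> < K0" using B by (force simp: K0_def)+
  \<comment> \<open>Bounds the integral as long as |u| \<le> K0 + 2, the level granted by the a
    priori bound; the added 1 makes m > 0 immediate.\<close>
  define m where "m = (K0 + 2) * (measure lebesgue \<Omega> + 1)"
  have m: "0 < m" using K0(1) by (simp add: m_def add_nonneg_pos)
  \<comment> \<open>The entries 1 - a and a + 1 of \<eta>0 are the conditions for u and for its
    reflection, respectively.\<close>
  have \<eta>: "0 < \<eta>" "\<eta> < 1 - a" "\<eta> < 1 - - a" using \<eta>_range by (auto simp: \<eta>0_eq)
  from a_priori_bound[OF domain K0(1) m] obtain \<epsilon>1 where \<epsilon>1: "0 < \<epsilon>1"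
    and bound: "\<And>\<epsilon> u v x t. \<lbrakk>0 < \<epsilon>; \<epsilon> < \<epsilon>1; nonlocal_solution \<Omega> f \<epsilon> v u;
       \<And>x. x \<in> closure \<Omega> \<Longrightarrow> \<bar>u x 0\<bar> < K0;
       \<And>t. 0 < t \<Longrightarrow> (\<And>x. x \<in> closure \<Omega> \<Longrightarrow> \<bar>u x t\<bar> \<le> K0 + 2) \<Longrightarrow> \<bar>v t\<bar> \<le> \<epsilon> * m;
       x \<in> closure \<Omega>; 0 \<le> t\<rbrakk> \<Longrightarrow> \<bar>u x t\<bar> < K0 + 2"
    by blast
  from two_phase_bounds_from_below[OF domain \<eta>(1,2) cont_u0 C11 level K0(2) m] obtain \<epsilon>2 M1
    where \<epsilon>2: "0 < \<epsilon>2" "0 < M1"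
    and below: "\<And>\<epsilon> u v x. \<lbrakk>0 < \<epsilon>; \<epsilon> < \<epsilon>2; nonlocal_solution \<Omega> f \<epsilon> v u;
       \<And>x. x \<in> closure \<Omega> \<Longrightarrow> u x 0 = u0 x; \<And>x t. x \<in> closure \<Omega> \<Longrightarrow> 0 \<le> t \<Longrightarrow> - (K0 + 2) < u x t;
       \<And>t. 0 < t \<Longrightarrow> \<bar>v t\<bar> \<le> \<epsilon> * m; x \<in> \<Omega>\<rbrakk>
       \<Longrightarrow> -1 - \<eta> \<le> u x (inverse \<mu> * \<epsilon>\<^sup>2 * \<bar>ln \<epsilon>\<bar>) \<and>
          (a + M1 * \<epsilon> \<le> u0 x \<longrightarrow> 1 - \<eta> \<le> u x (inverse \<mu> * \<epsilon>\<^sup>2 * \<bar>ln \<epsilon>\<bar>))"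
    by blast
  have level': "closed {x\<in>\<Omega>. - u0 x = - a}" using level by simp
  from refl.two_phase_bounds_from_below[OF domain \<eta>(1,3) continuous_on_minus[OF cont_u0]
      locally_C11_uminus[OF C11] level' K0(2) m] obtain \<epsilon>3 M2
    where \<epsilon>3: "0 < \<epsilon>3" "0 < M2"
    and above: "\<And>\<epsilon> u v x. \<lbrakk>0 < \<epsilon>; \<epsilon> < \<epsilon>3; reaction_solution \<Omega> (\<lambda>t y. 1 / \<epsilon>\<^sup>2 * - f (- y) (- v t)) u;
       \<And>x. x \<in> closure \<Omega> \<Longrightarrow> u x 0 = - u0 x; \<And>x t. x \<in> closure \<Omega> \<Longrightarrow> 0 \<le> t \<Longrightarrow> - (K0 + 2) < u x t;
       \<And>t. 0 < t \<Longrightarrow> \<bar>v t\<bar> \<le> \<epsilon> * m; x \<in> \<Omega>\<rbrakk>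
       \<Longrightarrow> -1 - \<eta> \<le> u x (inverse \<mu> * \<epsilon>\<^sup>2 * \<bar>ln \<epsilon>\<bar>) \<and>
          (- a + M2 * \<epsilon> \<le> - u0 x \<longrightarrow> 1 - \<eta> \<le> u x (inverse \<mu> * \<epsilon>\<^sup>2 * \<bar>ln \<epsilon>\<bar>))"
    by blast
  define \<epsilon>0 where "\<epsilon>0 = min \<epsilon>1 (min \<epsilon>2 \<epsilon>3)"
  define M0 where "M0 = max M1 M2"
  have main: "-1 - \<eta> \<le> u x T \<and> u x T \<le> 1 + \<eta> \<and> (a + M0 * \<epsilon> \<le> u0 x \<longrightarrow> 1 - \<eta> \<le> u x T) \<and>
      (u0 x \<le> a - M0 * \<epsilon> \<longrightarrow> u x T \<le> -1 + \<eta>)"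
    if \<epsilon>: "\<epsilon> \<in> {0<..<\<epsilon>0}" and solves: "solves_P \<Omega> f u0 \<epsilon> u" and x: "x \<in> \<Omega>"
      and T: "T = inverse \<mu> * \<epsilon>\<^sup>2 * \<bar>ln \<epsilon>\<bar>" for \<epsilon> u x T
  proof -
    have \<epsilon>': "0 < \<epsilon>" "\<epsilon> < \<epsilon>1" "\<epsilon> < \<epsilon>2" "\<epsilon> < \<epsilon>3" using \<epsilon> by (auto simp: \<epsilon>0_def)
    define v where "v t = \<epsilon> * integral \<Omega> (\<lambda>y. u y t)" for t
    have sol: "nonlocal_solution \<Omega> f \<epsilon> v u"
      unfolding v_def by (rule reaction_solution_of_solves_P[OF solves op])
    \<comment> \<open>\<open>solves_P\<close> prescribes the initial value in \<Omega> only;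
      continuity carries it to the closure, where the comparisons start.\<close>
    have init: "u y 0 = u0 y" if y: "y \<in> closure \<Omega>" for y
    proof -
      have "continuous_on (closure \<Omega> \<times> {0..}) (\<lambda>(x, t). u x t)"
        using sol by (simp add: reaction_solution_def)
      then have "continuous_on (closure \<Omega>) (\<lambda>y. (\<lambda>(x, t). u x t) (y, 0) - u0 y)"
        by (intro continuous_on_diff cont_u0) (rule continuous_on_compose2, assumption, intro continuous_intros, auto)
      then have "continuous_on (closure \<Omega>) (\<lambda>y. u y 0 - u0 y)" by simp
      moreover have "u z 0 - u0 z = 0" if "z \<in> \<Omega>" for z using solves that by (simp add: solves_P_def)
      ultimately have "u y 0 - u0 y = 0" using y by (rule continuous_constant_on_closure)
      then show ?thesis by simp
    qed
    have v: "\<bar>v t\<bar> \<le> \<epsilon> * m" if "\<And>x. x \<in> closure \<Omega> \<Longrightarrow> \<bar>u x t\<bar> \<le> K0 + 2" for t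
    proof -
      have "\<bar>integral \<Omega> (\<lambda>y. u y t)\<bar> \<le> (K0 + 2) * measure lebesgue \<Omega>"
        using that closure_subset[of \<Omega>] K0(1) by (intro integral_bound_on_bounded_open op bd) auto
      also have "\<dots> \<le> m" unfolding m_def using K0(1) by (intro mult_left_mono) auto
      finally show ?thesis using \<epsilon>'(1) by (simp add: v_def abs_mult)
    qed
    \<comment> \<open>Closes the circle between u and v: the conditional estimate for v becomes an
      unconditional bound on u at all times.\<close>
    have abs_u: "\<bar>u y t\<bar> < K0 + 2" if "y \<in> closure \<Omega>" "0 \<le> t" for y t
      using init K0(3) v that by (intro bound[OF \<epsilon>'(1,2) sol]) auto
    have u_range: "- (K0 + 2) < u y t" "- (K0 + 2) < - u y t" if "y \<in> closure \<Omega>" "0 \<le> t" for y t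
      using abs_u[OF that] by linarith+
    have v': "\<bar>v t\<bar> \<le> \<epsilon> * m" if "0 < t" for t
      using abs_u that by (intro v less_imp_le) auto
    have lower: "-1 - \<eta> \<le> u x T \<and> (a + M1 * \<epsilon> \<le> u0 x \<longrightarrow> 1 - \<eta> \<le> u x T)"
      unfolding T by (rule below[OF \<epsilon>'(1,3) sol init u_range(1) v' x])
    \<comment> \<open>The lower estimates for - u, with level - a and frozen term - v.\<close>
    have upper: "-1 - \<eta> \<le> - u x T \<and> (- a + M2 * \<epsilon> \<le> - u0 x \<longrightarrow> 1 - \<eta> \<le> - u x T)"
      unfolding T
      by (rule above[where v = "\<lambda>t. - v t", OF \<epsilon>'(1,4) reaction_solution_reflect[where f = f and v = v, OF sol]
            _ u_range(2) _ x]) (use init v' in auto)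
    have "M1 * \<epsilon> \<le> M0 * \<epsilon>" "M2 * \<epsilon> \<le> M0 * \<epsilon>"
      using \<epsilon>'(1) by (auto simp: M0_def intro!: mult_right_mono)
    then show ?thesis using lower upper by auto
  qed
  have pos: "0 < \<epsilon>0" "0 < M0" using \<epsilon>1 \<epsilon>2 \<epsilon>3 by (auto simp: \<epsilon>0_def M0_def)
  show ?thesis
    by (rule exI[of _ \<epsilon>0], rule conjI, rule pos, rule exI[of _ M0], rule conjI, rule pos)
      (use main in \<open>simp add: Let_def\<close>)
qed

end
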